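(* Let $N\ge 2$, and for $1\le m\le N$ let $\frac14<s_{1,m}<\frac34$, $s_{1,m}<s_{2,m}<1$, $\varepsilon_m\ge 0$. Put $\varepsilon:=\max_m\varepsilon_m$, $s_1:=\min_m s_{1,m}$, $S_1:=\max_m s_{1,m}$. Assume (on $f_m$, $H_m$): for every $1\le m\le N$, $f_m,H_m:\mathbb R^3\to\mathbb R$ satisfy $f_m\in L^1(\mathbb R^3)$, $(-\Delta)^{1-s_{1,m}}f_m\in L^2(\mathbb R^3)$, $H_m\in L^1(\mathbb R^3)$, $(-\Delta)^{1-s_{1,m}}H_m\in L^2(\mathbb R^3)$; $f_m$ is nontrivial for at least one $m$; and $$H^2:=\sum_{m=1}^N\|H_m\|_{L^1(\mathbb R^3)}^2>0,\qquad Q^2:=\sum_{m=1}^N\|(-\Delta)^{1-s_{1,m}}H_m\|_{L^2(\mathbb R^3)}^2>0 .$$ Let $u_0=(u_{0,1},\dots,u_{0,N})^T\in H^2(\mathbb R^3,\mathbb R^N)$ be the vector of the unique solutions of $[(-\Delta)^{s_{1,m}}+(-\Delta)^{s_{2,m}}]u_{0,m}=f_m$, $1\le m\le N$, and let $$I:=\{z\in\mathbb R^N:\ |z|_{\mathbb R^N}\le c_e\|u_0\|_{H^2(\mathbb R^3,\mathbb R^N)}+c_e\}.$$ Let $M>0$ and for $j=1,2$ let $g_j=(g_{j,1},\dots,g_{j,N})$ with $g_{j,m}:\mathbb R^N\to\mathbb R$, $g_{j,m}(0)=0$, $\nabla g_{j,m}(0)=0$ for $1\le m\le N$, $g_j\in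 C^2(I,\mathbb R^N)$ with $\|g_j\|_{C^2(I,\mathbb R^N)}\le M$, and $g_j$ not identically zero in $I$. Let $\rho\in(0,1]$, and suppose $\varepsilon$ satisfies $$0<\varepsilon\le\frac{\rho}{M(\|u_0\|_{H^2(\mathbb R^3,\mathbb R^N)}+1)^2}\left[H^2(\|u_0\|_{H^2(\mathbb R^3,\mathbb R^N)}+1)^{\frac{8S_1}{3}-2}\frac{1}{(4s_1)^{\frac{4s_1}{3}}}\,\frac{3}{(3-4S_1)(2\pi^2)^{\frac{4s_1}{3}}}+Q^2\right]^{-\frac12}.$$ For $j=1,2$ let $u_{p,j}\in B_\rho$ be the unique fixed point of the strict contraction $\tau_{g_j}:B_\rho\to B_\rho$ (defined in the context), and let $u_j:=u_0+u_{p,j}$ be the resulting solution of the system $$-[(-\Delta)^{s_{1,m}}+(-\Delta)^{s_{2,m}}]u_m+\varepsilon_m\int_{\mathbb R^3}H_m(x-y)\,g_{j,m}(u(y))\,dy+f_m(x)=0,\qquad 1\le m\le N.$$ Define $$\sigma:=M(\|u_0\|_{H^2(\mathbb R^3,\mathbb R^N)}+1)\left\{\frac{3H^2(\|u_0\|_{H^2(\mathbb R^3,\mathbb R^N)}+1)^{\frac{8S_1}{3}-2}}{(3-4S_1)(2\pi^2)^{\frac{4s_1}{3}}}\,\frac{1}{(4s_1)^{\frac{4s_1}{3}}}+Q^2\right\}^{\frac12}.$$ Then $$\|u_1-u_2\|_{H^2(\mathbb R^3,\mathbb R^N)}\le\frac{\varepsilon\sigma}{M(1-\varepsilon\sigma)}\,(\|u_0\|_{H^2(\mathbb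 R^3,\mathbb R^N)}+1)\,\|g_1-g_2\|_{C^2(I,\mathbb R^N)}.$$
   Context: All functions are on $\mathbb R^3$. For $s>0$ the operator $(-\Delta)^{s}$ is the Fourier multiplier with symbol $|p|^{2s}$, where $\widehat\phi(p)=(2\pi)^{-3/2}\int_{\mathbb R^3}\phi(x)e^{-ipx}dx$. For $0<s_{2,m}\le 1$, $H^{2s_{2,m}}(\mathbb R^3)$ is the space of real-valued $\phi\in L^2(\mathbb R^3)$ with $(-\Delta)^{s_{2,m}}\phi\in L^2(\mathbb R^3)$, with norm $\|\phi\|_{H^{2s_{2,m}}}^2=\|\phi\|_{L^2}^2+\|(-\Delta)^{s_{2,m}}\phi\|_{L^2}^2$. In particular $\|\phi\|_{H^2(\mathbb R^3)}^2=\|\phi\|_{L^2}^2+\|\Delta\phi\|_{L^2}^2$. For vector functions, $\|u\|_{H^2(\mathbb R^3,\mathbb R^N)}^2:=\sum_{m=1}^N\{\|u_m\|_{L^2(\mathbb R^3)}^2+\|\Delta u_m\|_{L^2(\mathbb R^3)}^2\}$. $B_\rho:=\{u\in H^2(\mathbb R^3,\mathbb R^N):\ \|u\|_{H^2(\mathbb R^3,\mathbb R^N)}\le\rho\}$. $c_e>0$ is the constant of the Sobolev embedding $\|\phi\|_{L^\infty(\mathbb R^3)}\le c_e\|\phi\|_{H^2(\mathbb R^3)}$. $|\cdot|_{\mathbb R^N}$ is the Euclidean length. Under the stated assumptions on $f_m$, each $f_m\in L^2(\mathbb R^3)$ and each linear equation $[(-\Delta)^{s_{1,m}}+(-\Delta)^{s_{2,m}}]u_{0,m}=f_m$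 has a unique solution $u_{0,m}\in H^{2s_{2,m}}(\mathbb R^3)$, and this solution belongs to $H^2(\mathbb R^3)$; so $u_0$ is well defined. Norms of nonlinearities: for $g=(g_1,\dots,g_N)$ (components $g_m$), $\|g\|_{C^2(I,\mathbb R^N)}:=\sum_{m=1}^N\|g_m\|_{C^2(I)}$, where $$\|g_m\|_{C^2(I)}:=\|g_m\|_{C(I)}+\sum_{n=1}^N\Big\|\frac{\partial g_m}{\partial z_n}\Big\|_{C(I)}+\sum_{n,l=1}^N\Big\|\frac{\partial^2 g_m}{\partial z_n\partial z_l}\Big\|_{C(I)},\qquad \|h\|_{C(I)}:=\max_{z\in I}|h(z)|.$$ The symbols $H$ and $Q$ denote the positive square roots of $H^2$ and $Q^2$. The map $\tau_g$: for $g$ satisfying the assumptions imposed on $g_1,g_2$ and $v\in B_\rho$, $u=\tau_g v$ is the unique solution $u\in B_\rho$ of $$[(-\Delta)^{s_{1,m}}+(-\Delta)^{s_{2,m}}]u_m(x)=\varepsilon_m\int_{\mathbb R^3}H_m(x-y)\,g_m(u_0(y)+v(y))\,dy,\qquad 1\le m\le N.$$ For every $\rho\in(0,1]$ and all $\varepsilon$ satisfying the bound displayed in the claim, $\tau_g:B_\rho\to B_\rho$ is well defined and is a strict contraction in the $H^2(\mathbb R^3,\mathbb R^N)$ norm (a preceding theorem of the source), so it has a unique fixed point. *)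

theory Defs
  imports "HOL-Analysis.Analysis"
begin

text \<open>All measure theory is done with the completed measure \<open>lebesgue\<close>: a nonlinearity that is
  only assumed regular on a ball \<open>I\<close> gives, after composition with a function lying almost
  everywhere in \<open>I\<close>, a Lebesgue measurable function which need not be Borel measurable.\<close>

definition square_integrable :: "(real^3 \<Rightarrow> 'b::{real_normed_vector, second_countable_topology}) \<Rightarrow> bool" where
  "square_integrable f \<longleftrightarrow>
     f \<in> borel_measurable lebesgue \<and> integrable lebesgue (\<lambda>x. (norm (f x))\<^sup>2)"

definition L2_norm :: "(real^3 \<Rightarrow> real) \<Rightarrow> real" where
  "L2_norm f = sqrt (LINT x|lebesgue. (f x)\<^sup>2)"

definition L1_norm :: "(real^3 \<Rightarrow> real) \<Rightarrow> real" where
  "L1_norm f = (LINT x|lebesgue. \<bar>f x\<bar>)"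

subsection \<open>Fourier transform\<close>

definition fourier_integral :: "(real^3 \<Rightarrow> real) \<Rightarrow> real^3 \<Rightarrow> complex" where
  "fourier_integral f p =
     of_real ((2 * pi) powr (-3/2)) * (LINT x|lebesgue. of_real (f x) * exp (- \<i> * of_real (p \<bullet> x)))"

text \<open>\<open>F\<close> is (a representative of) the Fourier transform of \<open>f\<close>: given by the integral if
  \<open>f\<close> is in \<open>L\<^sup>1\<close>, and by the \<open>L\<^sup>2\<close>-limit of the transforms of the truncations of \<open>f\<close> to balls
  (Plancherel) if \<open>f\<close> is in \<open>L\<^sup>2\<close>. The two clauses agree almost everywhere if both apply.\<close>

definition is_fourier :: "(real^3 \<Rightarrow> real) \<Rightarrow> (real^3 \<Rightarrow> complex) \<Rightarrow> bool" where
  "is_fourier f F \<longleftrightarrow>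
     integrable lebesgue f \<and> (AE p in lebesgue. F p = fourier_integral f p) \<or>
     square_integrable f \<and> square_integrable F \<and>
       ((\<lambda>R. \<integral>\<^sup>+ p. ennreal ((norm (F p - fourier_integral (\<lambda>x. indicator (cball 0 R) x * f x) p))\<^sup>2) \<partial>lebesgue)
          \<longlongrightarrow> 0) at_top"

subsection \<open>Fractional Laplacian and Sobolev spaces\<close>

text \<open>\<open>(-\<Delta>)\<^sup>s \<phi>\<close> is defined as an element \<open>\<psi>\<close> of \<open>L\<^sup>2\<close>. As the symbol \<open>\<bar>p\<bar>\<^sup>2\<^sup>s\<close> is real and even,
  \<open>\<psi>\<close> is real-valued for real-valued \<open>\<phi>\<close>.\<close>

definition is_frac_laplacian :: "real \<Rightarrow> (real^3 \<Rightarrow> real) \<Rightarrow> (real^3 \<Rightarrow> real) \<Rightarrow> bool" where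
  "is_frac_laplacian s \<phi> \<psi> \<longleftrightarrow>
     square_integrable \<psi> \<and>
     (\<exists>F G. is_fourier \<phi> F \<and> is_fourier \<psi> G \<and>
        (AE p in lebesgue. G p = of_real (norm p powr (2 * s)) * F p))"

definition frac_laplacian_L2 :: "real \<Rightarrow> (real^3 \<Rightarrow> real) \<Rightarrow> bool" where
  "frac_laplacian_L2 s \<phi> \<longleftrightarrow> (\<exists>\<psi>. is_frac_laplacian s \<phi> \<psi>)"

text \<open>A representative; by injectivity of the Fourier transform it is unique up to null sets
  whenever \<open>frac_laplacian_L2 s \<phi>\<close> holds.\<close>

definition frac_laplacian :: "real \<Rightarrow> (real^3 \<Rightarrow> real) \<Rightarrow> real^3 \<Rightarrow> real" where
  "frac_laplacian s \<phi> = (SOME \<psi>. is_frac_laplacian s \<phi> \<psi>)"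

text \<open>The space \<open>H\<^sup>2\<^sup>s\<close>; note the factor 2, so that \<open>H\<^sup>2\<close> is \<open>sobolev_space 1\<close>.\<close>

definition sobolev_space :: "real \<Rightarrow> (real^3 \<Rightarrow> real) set" where
  "sobolev_space s = {\<phi>. square_integrable \<phi> \<and> frac_laplacian_L2 s \<phi>}"

definition sobolev_norm :: "real \<Rightarrow> (real^3 \<Rightarrow> real) \<Rightarrow> real" where
  "sobolev_norm s \<phi> = sqrt ((L2_norm \<phi>)\<^sup>2 + (L2_norm (frac_laplacian s \<phi>))\<^sup>2)"

definition H2_space :: "(real^3 \<Rightarrow> real^'n) set" where
  "H2_space = {u. \<forall>m. (\<lambda>x. u x $ m) \<in> sobolev_space 1}"

definition H2_norm :: "(real^3 \<Rightarrow> real^'n) \<Rightarrow> real" where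
  "H2_norm u = sqrt (\<Sum>m\<in>UNIV. (L2_norm (\<lambda>x. u x $ m))\<^sup>2
                             + (L2_norm (frac_laplacian 1 (\<lambda>x. u x $ m)))\<^sup>2)"

definition H2_ball :: "real \<Rightarrow> (real^3 \<Rightarrow> real^'n) set" where
  "H2_ball \<rho> = {u \<in> H2_space. H2_norm u \<le> \<rho>}"

definition sobolev_embedding_constant :: "real \<Rightarrow> bool" where
  "sobolev_embedding_constant c \<longleftrightarrow>
     c > 0 \<and> (\<forall>\<phi>\<in>sobolev_space 1. AE x in lebesgue. \<bar>\<phi> x\<bar> \<le> c * sobolev_norm 1 \<phi>)"

subsection \<open>The equations\<close>

definition solves_linear :: "real \<Rightarrow> real \<Rightarrow> (real^3 \<Rightarrow> real) \<Rightarrow> (real^3 \<Rightarrow> real) \<Rightarrow> bool" where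
  "solves_linear s\<^sub>1 s\<^sub>2 u f \<longleftrightarrow>
     u \<in> sobolev_space s\<^sub>2 \<and>
     (\<exists>a b. is_frac_laplacian s\<^sub>1 u a \<and> is_frac_laplacian s\<^sub>2 u b \<and>
        (AE x in lebesgue. a x + b x = f x))"

text \<open>The graph of the map \<open>\<tau>\<^sub>g\<close> on \<open>H2_ball \<rho>\<close>: \<open>u = \<tau>\<^sub>g v\<close>.  It is a relation because functions are
  representatives of classes modulo null sets.\<close>

definition tau_graph ::
  "('n::finite \<Rightarrow> real) \<Rightarrow> ('n \<Rightarrow> real) \<Rightarrow> ('n \<Rightarrow> real) \<Rightarrow> ('n \<Rightarrow> real^3 \<Rightarrow> real) \<Rightarrow>
   (real^3 \<Rightarrow> real^'n) \<Rightarrow> real \<Rightarrow> (real^'n \<Rightarrow> real^'n) \<Rightarrow>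
   (real^3 \<Rightarrow> real^'n) \<Rightarrow> (real^3 \<Rightarrow> real^'n) \<Rightarrow> bool" where
  "tau_graph s\<^sub>1 s\<^sub>2 \<epsilon> H u\<^sub>0 \<rho> g v u \<longleftrightarrow>
     v \<in> H2_ball \<rho> \<and> u \<in> H2_ball \<rho> \<and>
     (\<forall>m. solves_linear (s\<^sub>1 m) (s\<^sub>2 m) (\<lambda>x. u x $ m)
        (\<lambda>x. \<epsilon> m * (LINT y|lebesgue. H m (x - y) * (g (u\<^sub>0 y + v y) $ m))))"

subsection \<open>\<open>C\<^sup>2\<close> functions on a closed ball\<close>

text \<open>Derivatives are taken relative to \<open>I\<close>, so nothing is required of the functions outside \<open>I\<close>.
  They are unique when \<open>I\<close> is convex with nonempty interior; on a closed ball of positive radius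
  this notion of \<open>C\<^sup>2\<close> means that the derivatives in the interior extend continuously to \<open>I\<close>.\<close>

definition partial_deriv :: "(real^'n) set \<Rightarrow> 'n::finite \<Rightarrow> (real^'n \<Rightarrow> real) \<Rightarrow> real^'n \<Rightarrow> real" where
  "partial_deriv I n h z = frechet_derivative h (at z within I) (axis n 1)"

definition C2_on :: "(real^'n::finite) set \<Rightarrow> (real^'n \<Rightarrow> real) \<Rightarrow> bool" where
  "C2_on I h \<longleftrightarrow>
     h differentiable_on I \<and>
     (\<forall>n. partial_deriv I n h differentiable_on I) \<and>
     (\<forall>n l. continuous_on I (partial_deriv I l (partial_deriv I n h)))"

definition C_norm :: "(real^'n::finite) set \<Rightarrow> (real^'n \<Rightarrow> real) \<Rightarrow> real" where
  "C_norm I h = (SUP z\<in>I. \<bar>h z\<bar>)"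

definition C2_norm :: "(real^'n::finite) set \<Rightarrow> (real^'n \<Rightarrow> real) \<Rightarrow> real" where
  "C2_norm I h = C_norm I h
     + (\<Sum>n\<in>UNIV. C_norm I (partial_deriv I n h))
     + (\<Sum>n\<in>UNIV. \<Sum>l\<in>UNIV. C_norm I (partial_deriv I l (partial_deriv I n h)))"

definition C2_norm_vec :: "(real^'n::finite) set \<Rightarrow> (real^'n \<Rightarrow> real^'n) \<Rightarrow> real" where
  "C2_norm_vec I g = (\<Sum>m\<in>UNIV. C2_norm I (\<lambda>z. g z $ m))"

definition admissible :: "(real^'n::finite) set \<Rightarrow> real \<Rightarrow> (real^'n \<Rightarrow> real^'n) \<Rightarrow> bool" where
  "admissible I M g \<longleftrightarrow>
     (\<forall>m. g 0 $ m = 0 \<and> GDERIV (\<lambda>z. g z $ m) 0 :> 0 \<and> C2_on I (\<lambda>z. g z $ m)) \<and>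
     C2_norm_vec I g \<le> M \<and>
     (\<exists>z\<in>I. g z \<noteq> 0)"

end

(*
  On the Fourier side the difference U of the two solutions satisfies, component by component,
  (|p|^(2 s_1) + |p|^(2 s_2)) U^ = eps (2 pi)^(3/2) H^ G^  with  G = g_1(u_1) - g_2(u_2).
  Put D = |u_0| + 1, d = |U|_(L^2) and B = M d + |g_1 - g_2|_(C^2) D. Splitting
  G = (g_1(u_1) - g_1(u_2)) + (g_1 - g_2)(u_2) and using that the gradients vanish at 0 gives
  |G|_(L^2) <= B and |G|_(L^1) <= D B.  Low frequencies of U are controlled by |G|_(L^1), high
  ones by |G|_(L^2), and Delta U by |G|_(L^1) and (-Delta)^(1 - s_1) H; optimizing the cut-off
  radius produces exactly the constant in sigma, so |U|_(H^2) <= (eps sigma / M) B.  This can be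
  solved for |U|_(H^2) because eps sigma <= rho / D < 1, where D > 1 as u_0 is nontrivial.

  The Plancherel theorem is obtained from Gaussian summation: the Gaussian means of |f^|^2 are
  Gaussian means of the autocorrelation of f, which is bounded by |f|^2 and continuous at 0 for
  bounded continuous f; density of such f does the rest.
*)
theory Submission
  imports Defs "HOL-Probability.Characteristic_Functions"
begin

text \<open>\<open>is_fourier\<close> holds by either of two clauses, and the data fall under
  different ones: a kernel \<open>H m\<close> has a Fourier integral, its fractional Laplacian and
  the solutions have L^2 transforms. The equation is read off where both clauses apply: its
  right-hand side, a multiple of a convolution, is integrable by Fubini and square integrable as a
  sum of two fractional Laplacians. The constant in sigma leaves no room for a factor 2. In the L^1
  bound of G the increments of g_1 must carry (|z| + |w|) / 2, not the maximum of |z| and |w|,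
  because Cauchy-Schwarz turns |u_1| + |u_2| into 2 D. The spare 1/2 in the term with g_1 - g_2 is
  given away, so that the L^1 bound is exactly D times the L^2 bound B; hence the best cut-off
  radius depends on s and D alone. Both ends of the range of s_1 matter: |p|^(-4 s) is integrable
  near the origin of R^3 only for s < 3/4, and s > 1/4 gives 4 s > 1, so that (4 s)^(4 s / 3)
  increases with s and the optima of all components are dominated by one expression in the least and
  the largest exponent.\<close>

section \<open>Cauchy-Schwarz and the L^2 norm of vector-valued functions\<close>

lemma integral_mult_CS:
  fixes f g :: "'a \<Rightarrow> real"
  assumes [measurable]: "f \<in> borel_measurable M" "g \<in> borel_measurable M"
    and f2: "integrable M (\<lambda>x. (f x)\<^sup>2)" and g2: "integrable M (\<lambda>x. (g x)\<^sup>2)"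
  shows "integrable M (\<lambda>x. f x * g x)"
    and "(LINT x|M. f x * g x) \<le> sqrt (LINT x|M. (f x)\<^sup>2) * sqrt (LINT x|M. (g x)\<^sup>2)"
proof -
  have young: "\<bar>a * b\<bar> \<le> a\<^sup>2 + b\<^sup>2" for a b :: real
  proof -
    have "0 \<le> (\<bar>a\<bar> - \<bar>b\<bar>)\<^sup>2" by simp
    then have "2 * (\<bar>a\<bar> * \<bar>b\<bar>) \<le> a\<^sup>2 + b\<^sup>2" by (simp add: power2_diff)
    moreover have "0 \<le> \<bar>a\<bar> * \<bar>b\<bar>" by simp
    ultimately show ?thesis unfolding abs_mult by linarith
  qed
  show int: "integrable M (\<lambda>x. f x * g x)"
    by (rule Bochner_Integration.integrable_bound[OF Bochner_Integration.integrable_add[OF f2 g2]])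
      (auto simp: young)
  let ?a = "LINT x|M. (f x)\<^sup>2" and ?b = "LINT x|M. (g x)\<^sup>2" and ?c = "LINT x|M. f x * g x"
  have quad: "0 \<le> ?a * t\<^sup>2 - 2 * t * ?c + ?b" for t
  proof -
    have "0 \<le> (LINT x|M. (t * f x - g x)\<^sup>2)" by simp
    also have "\<dots> = (LINT x|M. t\<^sup>2 * (f x)\<^sup>2 - 2 * t * (f x * g x) + (g x)\<^sup>2)"
      by (intro Bochner_Integration.integral_cong) (auto simp: power2_eq_square algebra_simps)
    also have "\<dots> = t\<^sup>2 * ?a - 2 * t * ?c + ?b"
      using int f2 g2 by simp
    finally show ?thesis by (simp add: mult.commute)
  qed
  have "?c\<^sup>2 \<le> ?a * ?b"
  proof (cases "?a = 0")
    case True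
    have "AE x in M. (f x)\<^sup>2 = 0"
      using True f2 by (subst (asm) integral_nonneg_eq_0_iff_AE) auto
    then have "?c = (LINT x|M. 0)" by (intro integral_cong_AE) auto
    then show ?thesis using True by simp
  next
    case False
    then have a: "0 < ?a" by (simp add: order_less_le)
    \<comment> \<open>The minimizer \<open>t = ?c / ?a\<close> of the quadratic turns its
      nonnegativity into the discriminant inequality.\<close>
    have "0 \<le> ?a * (?c / ?a)\<^sup>2 - 2 * (?c / ?a) * ?c + ?b" by (rule quad)
    also have "?a * (?c / ?a)\<^sup>2 - 2 * (?c / ?a) * ?c + ?b = ?b - ?c\<^sup>2 / ?a"
      using a by (simp add: power2_eq_square field_simps)
    finally have "?c\<^sup>2 / ?a \<le> ?b" by simp
    then show ?thesis using a by (simp add: field_simps)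
  qed
  then show "?c \<le> sqrt ?a * sqrt ?b"
    by (metis abs_le_D1 real_sqrt_abs real_sqrt_le_iff real_sqrt_mult)
qed

text \<open>\<open>L2_norm\<close> is reserved for real functions; one norm is wanted for these, for
  complex Fourier transforms and for solutions with values in \<open>real^'n\<close>.\<close>

definition l2 :: "(real^3 \<Rightarrow> 'b::{real_normed_vector, second_countable_topology}) \<Rightarrow> real" where
  "l2 f = sqrt (LINT x|lebesgue. (norm (f x))\<^sup>2)"

lemma L2_norm_eq_l2: "L2_norm f = l2 f"
  by (simp add: L2_norm_def l2_def)

lemma l2_nonneg [simp]: "0 \<le> l2 f"
  by (simp add: l2_def)

lemma l2_norm [simp]: "l2 (\<lambda>x. norm (f x)) = l2 f"
  by (simp add: l2_def)

lemma l2_power2: "(l2 f)\<^sup>2 = (LINT x|lebesgue. (norm (f x))\<^sup>2)"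
  by (simp add: l2_def)

lemma square_integrable_measurable:
  "square_integrable f \<Longrightarrow> f \<in> borel_measurable lebesgue"
  by (simp add: square_integrable_def)

lemma square_integrable_norm:
  "square_integrable f \<Longrightarrow> square_integrable (\<lambda>x. norm (f x))"
  by (auto simp: square_integrable_def)

lemma square_integrable_bound:
  assumes "square_integrable g" "f \<in> borel_measurable lebesgue"
    and "AE x in lebesgue. norm (f x) \<le> norm (g x)"
  shows "square_integrable f" and "l2 f \<le> l2 g"
proof -
  have ae: "AE x in lebesgue. (norm (f x))\<^sup>2 \<le> (norm (g x))\<^sup>2"
    using assms(3) by eventually_elim (simp add: power_mono)
  have g: "integrable lebesgue (\<lambda>x. (norm (g x))\<^sup>2)"
    using assms(1) by (simp add: square_integrable_def)
  have [measurable]: "f \<in> borel_measurable lebesgue" by fact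
  have f: "integrable lebesgue (\<lambda>x. (norm (f x))\<^sup>2)"
    by (rule Bochner_Integration.integrable_bound[OF g]) (use ae in auto)
  then show "square_integrable f" using assms by (simp add: square_integrable_def)
  show "l2 f \<le> l2 g"
    unfolding l2_def using integral_mono_AE[OF f g ae] by simp
qed

lemma square_integrable_scaleR:
  assumes "square_integrable f" shows "square_integrable (\<lambda>x. c *\<^sub>R f x)" "l2 (\<lambda>x. c *\<^sub>R f x) = \<bar>c\<bar> * l2 f"
  using assms by (auto simp: square_integrable_def l2_def power_mult_distrib real_sqrt_mult)

lemma l2_cong_AE:
  assumes "AE x in lebesgue. norm (f x) = norm (g x)" 
    "f \<in> borel_measurable lebesgue" "g \<in> borel_measurable lebesgue"
  shows "l2 f = l2 g"
  unfolding l2_def by (intro arg_cong[where f=sqrt] integral_cong_AE) (use assms in auto)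

lemma square_integrable_cong_AE:
  assumes "AE x in lebesgue. f x = g x" "square_integrable f" "g \<in> borel_measurable lebesgue"
  shows "square_integrable g"
  by (rule square_integrable_bound(1)[OF assms(2,3)]) (use assms(1) in auto)

lemma l2_eq_0_AE:
  assumes "square_integrable f" "l2 f = 0"
  shows "AE x in lebesgue. f x = 0"
  using assms by (auto simp: square_integrable_def l2_def integral_nonneg_eq_0_iff_AE)

lemma l2_CS:
  assumes "square_integrable f" "square_integrable g"
  shows "integrable lebesgue (\<lambda>x. norm (f x) * norm (g x))"
    and "(LINT x|lebesgue. norm (f x) * norm (g x)) \<le> l2 f * l2 g"
  using integral_mult_CS[of "\<lambda>x. norm (f x)" lebesgue "\<lambda>x. norm (g x)"] assms
  by (auto simp: square_integrable_def l2_def)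

lemma square_integrable_add:
  assumes f: "square_integrable f" and g: "square_integrable g"
  shows "square_integrable (\<lambda>x. f x + g x)" and "l2 (\<lambda>x. f x + g x) \<le> l2 f + l2 g"
proof -
  have [measurable]: "f \<in> borel_measurable lebesgue" "g \<in> borel_measurable lebesgue"
    and f2: "integrable lebesgue (\<lambda>x. (norm (f x))\<^sup>2)" and g2: "integrable lebesgue (\<lambda>x. (norm (g x))\<^sup>2)"
    using f g by (auto simp: square_integrable_def)
  note fg = l2_CS[OF f g]
  let ?h = "\<lambda>x. (norm (f x))\<^sup>2 + 2 * (norm (f x) * norm (g x)) + (norm (g x))\<^sup>2"
  have h: "integrable lebesgue ?h" using f2 g2 fg(1) by auto
  have le: "(norm (f x + g x))\<^sup>2 \<le> ?h x" for x
    using power_mono[OF norm_triangle_ineq[of "f x" "g x"], of 2] by (simp add: power2_sum)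
  have i: "integrable lebesgue (\<lambda>x. (norm (f x + g x))\<^sup>2)"
    by (rule Bochner_Integration.integrable_bound[OF h]) (auto intro!: always_eventually order_trans[OF le])
  then show "square_integrable (\<lambda>x. f x + g x)" by (simp add: square_integrable_def)
  have "(l2 (\<lambda>x. f x + g x))\<^sup>2 \<le> integral\<^sup>L lebesgue ?h"
    unfolding l2_power2 by (rule integral_mono[OF i h le])
  also have "\<dots> = (l2 f)\<^sup>2 + 2 * (LINT x|lebesgue. norm (f x) * norm (g x)) + (l2 g)\<^sup>2"
    using f2 g2 fg(1) by (simp add: l2_power2)
  also have "\<dots> \<le> (l2 f + l2 g)\<^sup>2" using fg(2) by (simp add: power2_sum)
  finally show "l2 (\<lambda>x. f x + g x) \<le> l2 f + l2 g"
    by (rule power2_le_imp_le) simp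
qed

lemma square_integrable_diff:
  assumes f: "square_integrable f" and g: "square_integrable g"
  shows "square_integrable (\<lambda>x. f x - g x)" and "l2 (\<lambda>x. f x - g x) \<le> l2 f + l2 g"
  using square_integrable_add[OF f square_integrable_scaleR(1)[OF g, of "-1"]]
  by (simp_all add: square_integrable_scaleR(2)[OF g, of "-1", simplified])

lemma nn_integral_eq_l2:
  assumes "square_integrable f"
  shows "(\<integral>\<^sup>+ x. ennreal ((norm (f x))\<^sup>2) \<partial>lebesgue) = ennreal ((l2 f)\<^sup>2)"
  unfolding l2_power2 using assms by (intro nn_integral_eq_integral) (auto simp: square_integrable_def)

lemma square_integrable_vec:
  fixes u :: "real^3 \<Rightarrow> real^'n::finite"
  assumes "\<And>m. square_integrable (\<lambda>x. u x $ m)"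
  shows "square_integrable u" and "(l2 u)\<^sup>2 = (\<Sum>m\<in>UNIV. (l2 (\<lambda>x. u x $ m))\<^sup>2)"
proof -
  have [measurable]: "u \<in> borel_measurable lebesgue"
  proof -
    have "u = (\<lambda>x. \<Sum>m\<in>UNIV. (u x $ m) *\<^sub>R axis m 1)"
      by (simp add: vec_eq_iff fun_eq_iff axis_def if_distrib cong: if_cong)
    moreover have "(\<lambda>x. \<Sum>m\<in>UNIV. (u x $ m) *\<^sub>R (axis m 1 :: real^'n)) \<in> borel_measurable lebesgue"
      using assms by (intro borel_measurable_sum borel_measurable_scaleR)
        (auto simp: square_integrable_def)
    ultimately show ?thesis by simp
  qed
  have eq: "(norm (u x))\<^sup>2 = (\<Sum>m\<in>UNIV. (u x $ m)\<^sup>2)" for x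
    by (simp add: norm_vec_def L2_set_def sum_nonneg)
  have i: "integrable lebesgue (\<lambda>x. (u x $ m)\<^sup>2)" for m
    using assms by (simp add: square_integrable_def)
  show "square_integrable u" using i by (simp add: square_integrable_def eq)
  show "(l2 u)\<^sup>2 = (\<Sum>m\<in>UNIV. (l2 (\<lambda>x. u x $ m))\<^sup>2)"
    using i by (simp add: l2_power2 eq)
qed

subsection \<open>The Fourier integral and Plancherel's theorem\<close>

text \<open>The transform without its normalizing factor and over the Borel measure
  \<open>lborel\<close>, where product measures and Fubini are at hand. Complex arguments are
  allowed because the duality argument below transforms a function built from a conjugated Fourier
  transform.\<close>

definition fint :: "(real^3 \<Rightarrow> complex) \<Rightarrow> real^3 \<Rightarrow> complex" where
  "fint f p = (LINT x|lborel. f x * exp (- \<i> * of_real (p \<bullet> x)))"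

lemma norm_exp_i [simp]: "norm (exp (- (\<i> * complex_of_real t))) = 1"
  by (simp add: norm_exp_eq_Re)

lemma integrable_lborel_prod:
  fixes f h :: "'a::euclidean_space \<Rightarrow> 'b::{real_normed_field, banach, second_countable_topology}"
  assumes f: "integrable lborel f" and h: "integrable lborel h"
  shows "integrable (lborel \<Otimes>\<^sub>M lborel) (\<lambda>(p, x). f x * h p)"
proof (rule lborel_pair.Fubini_integrable)
  have [measurable]: "f \<in> borel_measurable borel" "h \<in> borel_measurable borel"
    using assms by auto
  show "(\<lambda>(p, x). f x * h p) \<in> borel_measurable (lborel \<Otimes>\<^sub>M lborel)" by measurable
  show "integrable lborel (\<lambda>p. LINT x|lborel. norm (case (p, x) of (p, x) \<Rightarrow> f x * h p))"
    using f h by (simp add: norm_mult)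
  show "AE p in lborel. integrable lborel (\<lambda>x. case (p, x) of (p, x) \<Rightarrow> f x * h p)"
    using f by simp
qed

text \<open>The kernel exp(-i p.x) is symmetric in p and x and has modulus 1, so Fubini moves the
  transform from one factor to the other. This duality stands in for Fourier inversion.\<close>

lemma fint_mult:
  assumes f: "integrable lborel f" and h: "integrable lborel h"
  shows "(LINT p|lborel. fint f p * h p) = (LINT x|lborel. f x * fint h x)"
proof -
  have [measurable]: "f \<in> borel_measurable borel" "h \<in> borel_measurable borel"
    using assms by auto
  have *: "integrable (lborel \<Otimes>\<^sub>M lborel) (\<lambda>(p, x). f x * h p * exp (- \<i> * of_real (p \<bullet> x)))"
    by (rule Bochner_Integration.integrable_bound[OF integrable_lborel_prod[OF f h]])
      (auto simp: norm_mult)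
  have "(LINT p|lborel. fint f p * h p) = (LINT p|lborel. LINT x|lborel. f x * h p * exp (- \<i> * of_real (p \<bullet> x)))"
    unfolding fint_def
    by (simp del: integral_mult_left_zero add: integral_mult_left_zero[symmetric]) (simp add: mult_ac)
  also have "\<dots> = (LINT x|lborel. LINT p|lborel. f x * h p * exp (- \<i> * of_real (p \<bullet> x)))"
    using lborel_pair.Fubini_integral[OF *] by simp
  also have "\<dots> = (LINT x|lborel. f x * fint h x)"
    unfolding fint_def by (simp add: mult.assoc inner_commute)
  finally show ?thesis .
qed

lemma fint_measurable [measurable]:
  assumes [measurable]: "f \<in> borel_measurable borel"
  shows "fint f \<in> borel_measurable borel"
  unfolding fint_def by measurable

lemma norm_fint_le: "norm (fint f p) \<le> (LINT x|lborel. norm (f x))"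
  unfolding fint_def
  using integral_norm_bound[of lborel "\<lambda>x. f x * exp (- \<i> * of_real (p \<bullet> x))"] by (simp add: norm_mult)

section \<open>Affine substitutions and the transform of the Gaussian\<close>

lemma integral_lborel_affine:
  fixes f :: "'a::euclidean_space \<Rightarrow> 'b::{banach, second_countable_topology}"
  assumes [measurable]: "f \<in> borel_measurable borel" and "c \<noteq> 0"
  shows "(LINT x|lborel. f x) = \<bar>c\<bar> ^ DIM('a) *\<^sub>R (LINT x|lborel. f (t + c *\<^sub>R x))"
proof -
  have "(LINT x|lborel. f x) = integral\<^sup>L (density (distr lborel borel (\<lambda>x. t + c *\<^sub>R x)) (\<lambda>_. \<bar>c\<bar> ^ DIM('a))) f"
    using lborel_affine[OF assms(2), of t] by simp
  also have "\<dots> = (LINT x|distr lborel borel (\<lambda>x. t + c *\<^sub>R x). \<bar>c\<bar> ^ DIM('a) *\<^sub>R f x)"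
    by (subst integral_density) auto
  also have "\<dots> = (LINT x|lborel. \<bar>c\<bar> ^ DIM('a) *\<^sub>R f (t + c *\<^sub>R x))"
    by (subst integral_distr) auto
  finally show ?thesis by simp
qed

lemma nn_integral_lborel_affine:
  fixes f :: "'a::euclidean_space \<Rightarrow> ennreal"
  assumes [measurable]: "f \<in> borel_measurable borel" and "c \<noteq> 0"
  shows "(\<integral>\<^sup>+x. f x \<partial>lborel) = ennreal (\<bar>c\<bar> ^ DIM('a)) * (\<integral>\<^sup>+x. f (t + c *\<^sub>R x) \<partial>lborel)"
proof -
  have "(\<integral>\<^sup>+x. f x \<partial>lborel) = integral\<^sup>N (density (distr lborel borel (\<lambda>x. t + c *\<^sub>R x)) (\<lambda>_. \<bar>c\<bar> ^ DIM('a))) f"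
    using lborel_affine[OF assms(2), of t] by simp
  also have "\<dots> = (\<integral>\<^sup>+x. ennreal (\<bar>c\<bar> ^ DIM('a)) * f x \<partial>distr lborel borel (\<lambda>x. t + c *\<^sub>R x))"
    by (subst nn_integral_density) auto
  also have "\<dots> = (\<integral>\<^sup>+x. ennreal (\<bar>c\<bar> ^ DIM('a)) * f (t + c *\<^sub>R x) \<partial>lborel)"
    by (subst nn_integral_distr) auto
  finally show ?thesis by (simp add: nn_integral_cmult)
qed

lemma integrable_lborel_affine:
  fixes f :: "'a::euclidean_space \<Rightarrow> 'b::{banach, second_countable_topology}"
  assumes f: "integrable lborel f" and "c \<noteq> 0"
  shows "integrable lborel (\<lambda>x. f (t + c *\<^sub>R x))"
proof (rule integrableI_bounded)
  have [measurable]: "f \<in> borel_measurable borel" using f by auto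
  show "(\<lambda>x. f (t + c *\<^sub>R x)) \<in> borel_measurable lborel" by measurable
  have "ennreal (\<bar>c\<bar> ^ DIM('a)) * (\<integral>\<^sup>+x. norm (f (t + c *\<^sub>R x)) \<partial>lborel) < \<infinity>"
    using f by (subst nn_integral_lborel_affine[symmetric]) (auto simp: integrable_iff_bounded assms(2))
  then show "(\<integral>\<^sup>+x. norm (f (t + c *\<^sub>R x)) \<partial>lborel) < \<infinity>"
    using assms(2) by (auto simp: ennreal_mult_less_top)
qed

lemma prod_integral_lborel:
  fixes f :: "'a::euclidean_space \<Rightarrow> real \<Rightarrow> 'b::{real_normed_field, banach, second_countable_topology}"
  assumes f: "\<And>b. b \<in> Basis \<Longrightarrow> integrable lborel (f b)"
  shows "integrable lborel (\<lambda>x. \<Prod>b\<in>Basis. f b (x \<bullet> b))"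
    and "(LINT x|lborel. (\<Prod>b\<in>Basis. f b (x \<bullet> b))) = (\<Prod>b\<in>Basis. (LINT x|lborel. f b x))"
proof -
  interpret product_sigma_finite "\<lambda>_::'a. lborel :: real measure" ..
  have [measurable]: "b \<in> Basis \<Longrightarrow> f b \<in> borel_measurable borel" for b using f by auto
  have sum: "(\<Sum>j\<in>Basis. x j *\<^sub>R j) \<bullet> b = x b" if "b \<in> Basis" for x :: "'a \<Rightarrow> real" and b
    using that by (simp add: inner_sum_left inner_Basis if_distrib cong: if_cong)
  have i: "integrable (\<Pi>\<^sub>M b\<in>Basis. lborel) (\<lambda>x. \<Prod>b\<in>(Basis::'a set). f b (x b))"
    by (intro product_integrable_prod f) auto
  show "integrable lborel (\<lambda>x. \<Prod>b\<in>Basis. f b (x \<bullet> b))"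
    by (subst lborel_eq, subst integrable_distr_eq) (use i in \<open>simp_all add: sum\<close>)
  show "(LINT x|lborel. (\<Prod>b\<in>Basis. f b (x \<bullet> b))) = (\<Prod>b\<in>Basis. (LINT x|lborel. f b x))"
    by (subst lborel_eq, subst integral_distr) (simp_all add: sum product_integral_prod f)
qed

text \<open>This is the characteristic function of the standard normal distribution at
  \<open>- t\<close>, multiplied by the factor sqrt(2 pi) that its density divides by.\<close>

lemma gauss_1d:
  "integrable lborel (\<lambda>x. of_real (exp (- x\<^sup>2 / 2)) * exp (- \<i> * of_real (t * x)) :: complex)"
  "(LINT x|lborel. of_real (exp (- x\<^sup>2 / 2)) * exp (- \<i> * of_real (t * x)) :: complex)
     = of_real (sqrt (2 * pi) * exp (- t\<^sup>2 / 2))"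
proof -
  have d: "exp (- x\<^sup>2 / 2) = sqrt (2 * pi) * std_normal_density x" for x :: real
    by (simp add: std_normal_density_def)
  have "integrable lborel (\<lambda>x::real. exp (- x\<^sup>2 / 2))"
    unfolding d using integrable_std_normal_moment[of 0] by simp
  then show "integrable lborel (\<lambda>x. of_real (exp (- x\<^sup>2 / 2)) * exp (- \<i> * of_real (t * x)) :: complex)"
    by (rule Bochner_Integration.integrable_bound) (auto simp: norm_mult simp del: of_real_mult)
  have "char std_normal_distribution (- t) = (LINT x|lborel. std_normal_density x *\<^sub>R iexp (- t * x))"
    unfolding char_def by (subst integral_density) (auto simp: normal_density_nonneg)
  then have "(LINT x|lborel. std_normal_density x *\<^sub>R iexp (- t * x)) = of_real (exp (- t\<^sup>2 / 2))"
    by (simp add: char_std_normal_distribution)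
  then have "of_real (sqrt (2 * pi)) * (LINT x|lborel. std_normal_density x *\<^sub>R iexp (- t * x))
     = of_real (sqrt (2 * pi)) * (of_real (exp (- t\<^sup>2 / 2)) :: complex)" by simp
  also have "of_real (sqrt (2 * pi)) * (LINT x|lborel. std_normal_density x *\<^sub>R iexp (- t * x))
     = (LINT x|lborel. of_real (sqrt (2 * pi)) * (std_normal_density x *\<^sub>R iexp (- t * x)))"
    by (rule integral_mult_right_zero[symmetric])
  also have "\<dots> = (LINT x|lborel. of_real (exp (- x\<^sup>2 / 2)) * exp (- \<i> * of_real (t * x)) :: complex)"
    unfolding d by (intro Bochner_Integration.integral_cong) (auto simp: scaleR_conv_of_real)
  finally show "(LINT x|lborel. of_real (exp (- x\<^sup>2 / 2)) * exp (- \<i> * of_real (t * x)) :: complex)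
     = of_real (sqrt (2 * pi) * exp (- t\<^sup>2 / 2))" by simp
qed

definition gauss :: "real^3 \<Rightarrow> real" where "gauss x = exp (- (norm x)\<^sup>2 / 2)"

lemma gauss_measurable [measurable]: "gauss \<in> borel_measurable borel"
  unfolding gauss_def by measurable

lemma gauss_prod: "gauss x = (\<Prod>b\<in>Basis. exp (- (x \<bullet> b)\<^sup>2 / 2))"
proof -
  have "(norm x)\<^sup>2 = (\<Sum>b\<in>Basis. (x \<bullet> b)\<^sup>2)"
    by (simp add: norm_eq_sqrt_inner euclidean_inner[of x x] power2_eq_square sum_nonneg)
  then show ?thesis unfolding gauss_def
    by (simp add: exp_sum[symmetric] sum_negf sum_divide_distrib)
qed

text \<open>At once the total mass of \<open>gauss\<close> and the reciprocal of the factor in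
  \<open>fourier_integral\<close>; the cancellation of these two makes the normalized transform an
  isometry.\<close>

definition c3 :: real where "c3 = (2 * pi) powr (3/2)"

lemma c3_pos [simp]: "0 < c3" by (simp add: c3_def)

lemma c3_neq_0 [simp]: "c3 \<noteq> 0" using c3_pos by linarith

lemma c3_eq: "c3 = sqrt (2 * pi) ^ 3"
  unfolding c3_def by (simp add: powr_half_sqrt[symmetric] powr_powr powr_realpow[symmetric] del: powr_numeral)

lemma c3_sq: "c3\<^sup>2 = 8 * pi ^ 3"
proof -
  have "c3\<^sup>2 = (sqrt (2 * pi))\<^sup>2 ^ 3" unfolding c3_eq by (simp only: power_mult[symmetric] mult.commute)
  then show ?thesis by (simp add: power_mult_distrib)
qed

lemma gauss_fint: "integrable lborel (\<lambda>x. complex_of_real (gauss x))"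
    "fint (\<lambda>x. of_real (gauss x)) p = of_real (c3 * gauss p)"
proof -
  have eq: "of_real (gauss x) * exp (- \<i> * of_real (p \<bullet> x)) =
     (\<Prod>b\<in>Basis. of_real (exp (- (x \<bullet> b)\<^sup>2 / 2)) * exp (- \<i> * of_real ((p \<bullet> b) * (x \<bullet> b))))" for x p
    unfolding prod.distrib gauss_prod of_real_prod[symmetric]
    by (simp add: exp_sum[symmetric] euclidean_inner[of p x] sum_distrib_left sum_negf del: of_real_mult)
  \<comment> \<open>At frequency 0 the phase is 1, so the product formula \<open>eq\<close> also
    yields integrability of the Gaussian itself.\<close>
  have "integrable lborel (\<lambda>x. of_real (gauss x) * exp (- \<i> * of_real (0 \<bullet> x)))"
    unfolding eq by (rule prod_integral_lborel) (rule gauss_1d)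
  then show "integrable lborel (\<lambda>x. complex_of_real (gauss x))" by simp
  have "fint (\<lambda>x. of_real (gauss x)) p = (\<Prod>b\<in>(Basis::(real^3) set). of_real (sqrt (2 * pi) * exp (- (p \<bullet> b)\<^sup>2 / 2)))"
    unfolding fint_def eq by (subst prod_integral_lborel) (simp_all only: gauss_1d)
  also have "\<dots> = of_real (c3 * gauss p)"
    unfolding of_real_prod[symmetric] prod.distrib gauss_prod c3_eq by simp
  finally show "fint (\<lambda>x. of_real (gauss x)) p = of_real (c3 * gauss p)" .
qed

lemma gauss_integral: "integrable lborel gauss" "(LINT x|lborel. gauss x) = c3"
proof -
  show "integrable lborel gauss"
    using integrable_norm[OF gauss_fint(1)] by (simp add: gauss_def[abs_def])
  have "complex_of_real (LINT x|lborel. gauss x) = of_real c3"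
    using gauss_fint(2)[of 0] by (simp add: fint_def gauss_def)
  then show "(LINT x|lborel. gauss x) = c3" using of_real_eq_iff by blast
qed

text \<open>The frequency is written as \<open>t *\<^sub>R w\<close> because it will be evaluated
  after the substitution y = x - t w, whose Jacobian \<open>t ^ 3\<close> then cancels the
  denominator.\<close>

lemma gauss_fint_scaled:
  assumes t: "t > 0"
  shows "integrable lborel (\<lambda>p. complex_of_real (gauss (t *\<^sub>R p)))"
    "fint (\<lambda>p. of_real (gauss (t *\<^sub>R p))) (t *\<^sub>R w) = of_real (c3 * gauss w / t ^ 3)"
proof -
  show "integrable lborel (\<lambda>p. complex_of_real (gauss (t *\<^sub>R p)))"
    using integrable_lborel_affine[OF gauss_fint(1), of t 0] t by simp
  have "of_real (c3 * gauss w) = fint (\<lambda>x. of_real (gauss x)) w" by (simp add: gauss_fint)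
  also have "\<dots> = t ^ 3 *\<^sub>R (LINT x|lborel. of_real (gauss (t *\<^sub>R x)) * exp (- \<i> * of_real (w \<bullet> (t *\<^sub>R x))))"
    unfolding fint_def using t by (subst integral_lborel_affine[of _ t 0]) auto
  also have "\<dots> = of_real (t ^ 3) * fint (\<lambda>p. of_real (gauss (t *\<^sub>R p))) (t *\<^sub>R w)"
    by (simp add: fint_def scaleR_conv_of_real[where 'a=complex])
  finally show "fint (\<lambda>p. of_real (gauss (t *\<^sub>R p))) (t *\<^sub>R w) = of_real (c3 * gauss w / t ^ 3)"
    using t by (simp add: field_simps)
qed

lemma cnj_measurable [measurable]:
  "f \<in> borel_measurable M \<Longrightarrow> (\<lambda>x. cnj (f x)) \<in> borel_measurable M"
  by (rule measurable_compose[OF _ borel_measurable_continuous_onI]) (auto intro: continuous_intros)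

section \<open>Gaussian summation and Plancherel on the Borel measure\<close>

text \<open>Writing |F|^2 gauss(t p) as F times \<open>h\<close>, with \<open>h\<close> the
  conjugate of F times the Gaussian, \<open>fint_mult\<close> moves the transform from F onto
  \<open>h\<close>. A second use of \<open>fint_mult\<close> identifies the transform of
  \<open>h\<close> with a Gaussian mollification of \<open>f\<close> at scale
  \<open>t\<close>.\<close>

lemma gauss_weighted_fint:
  fixes f :: "real^3 \<Rightarrow> real"
  assumes f: "integrable lborel f" and t: "t > 0"
  shows "integrable lborel (\<lambda>p. (norm (fint (\<lambda>x. of_real (f x)) p))\<^sup>2 * gauss (t *\<^sub>R p))"
    and "(LINT p|lborel. (norm (fint (\<lambda>x. of_real (f x)) p))\<^sup>2 * gauss (t *\<^sub>R p))
      = c3 * (LINT x|lborel. f x * (LINT w|lborel. f (x - t *\<^sub>R w) * gauss w))"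
proof -
  have [measurable]: "f \<in> borel_measurable borel" using f by auto
  define F where "F = fint (\<lambda>x. of_real (f x))"
  have fc: "integrable lborel (\<lambda>x. complex_of_real (f x))" using f by simp
  have [measurable]: "F \<in> borel_measurable borel" unfolding F_def by measurable
  define B where "B = (LINT x|lborel. norm (f x))"
  have B: "norm (F p) \<le> B" for p
    unfolding F_def B_def using norm_fint_le[of "\<lambda>x. of_real (f x)" p] by simp
  have B0: "0 \<le> B" using order_trans[OF norm_ge_zero B] .
  define h where "h p = cnj (F p) * of_real (gauss (t *\<^sub>R p))" for p
  have gp: "0 \<le> gauss x" for x by (simp add: gauss_def)
  have gt: "integrable lborel (\<lambda>p. complex_of_real (gauss (t *\<^sub>R p)))"
    by (rule gauss_fint_scaled[OF t])
  have [measurable]: "(\<lambda>p. complex_of_real (gauss (t *\<^sub>R p))) \<in> borel_measurable borel"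
    using gt by auto
  have [measurable]: "h \<in> borel_measurable borel" unfolding h_def by measurable
  have h: "integrable lborel h"
    by (rule Bochner_Integration.integrable_bound[OF integrable_scaleR_right[OF gt, of B]])
      (use B gp B0 in \<open>auto simp: h_def norm_mult intro!: mult_right_mono\<close>)
  have Fh: "integrable lborel (\<lambda>p. F p * h p)"
    by (rule Bochner_Integration.integrable_bound[OF integrable_scaleR_right[OF h, of B]])
      (use B gp B0 in \<open>auto simp: norm_mult intro!: mult_right_mono\<close>)
  have eq: "F p * h p = of_real ((norm (F p))\<^sup>2 * gauss (t *\<^sub>R p))" for p
    unfolding h_def of_real_mult complex_norm_square by (simp add: mult.assoc)
  have nn: "norm (F p * h p) = (norm (F p))\<^sup>2 * gauss (t *\<^sub>R p)" for p
    unfolding eq norm_of_real using gp by (simp add: abs_mult)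
  have "integrable lborel (\<lambda>p. (norm (F p))\<^sup>2 * gauss (t *\<^sub>R p))"
    using integrable_norm[OF Fh] by (simp only: nn)
  then show "integrable lborel (\<lambda>p. (norm (fint (\<lambda>x. of_real (f x)) p))\<^sup>2 * gauss (t *\<^sub>R p))"
    by (simp add: F_def)
  have hx: "fint h x = of_real (c3 * (LINT w|lborel. f (x - t *\<^sub>R w) * gauss w))" for x
  proof -
    \<comment> \<open>Conjugating the transform of \<open>h\<close> at x restores F and reverses the
      phase; the phase is absorbed into the test function \<open>k\<close>, which makes it a
      Gaussian modulated by the frequency -x.\<close>
    define k where "k p = of_real (gauss (t *\<^sub>R p)) * exp (- \<i> * of_real ((- x) \<bullet> p))" for p
    have [measurable]: "k \<in> borel_measurable borel" unfolding k_def by measurable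
    have k: "integrable lborel k"
      by (rule Bochner_Integration.integrable_bound[OF gt]) (auto simp: k_def norm_mult)
    have "cnj (fint h x) = (LINT p|lborel. F p * k p)"
      unfolding fint_def by (subst Bochner_Integration.integral_cnj[symmetric])
        (simp add: h_def k_def exp_cnj mult.assoc)
    also have "\<dots> = (LINT y|lborel. of_real (f y) * fint k y)"
      unfolding F_def by (rule fint_mult[OF fc k])
    also have "\<dots> = t ^ 3 *\<^sub>R (LINT w|lborel. of_real (f (x - t *\<^sub>R w)) * fint k (x - t *\<^sub>R w))"
      using t by (subst integral_lborel_affine[of _ "- t" x]) auto
    also have "(\<lambda>w. fint k (x - t *\<^sub>R w)) = (\<lambda>w. of_real (c3 * gauss w / t ^ 3))"
    proof
      fix w
      have "fint k (x - t *\<^sub>R w) = fint (\<lambda>p. of_real (gauss (t *\<^sub>R p))) (t *\<^sub>R (- w))"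
        unfolding fint_def k_def
        by (intro Bochner_Integration.integral_cong)
          (auto simp: mult.assoc exp_add[symmetric] inner_diff_left algebra_simps)
      also have "\<dots> = of_real (c3 * gauss w / t ^ 3)"
        by (subst gauss_fint_scaled[OF t]) (simp add: gauss_def)
      finally show "fint k (x - t *\<^sub>R w) = of_real (c3 * gauss w / t ^ 3)" .
    qed
    then have "(LINT w|lborel. of_real (f (x - t *\<^sub>R w)) * fint k (x - t *\<^sub>R w))
       = (LINT w|lborel. of_real (f (x - t *\<^sub>R w)) * of_real (c3 * gauss w / t ^ 3))"
      by metis
    also have "\<dots> = (LINT w|lborel. complex_of_real ((c3 / t ^ 3) * (f (x - t *\<^sub>R w) * gauss w)))"
      by (intro Bochner_Integration.integral_cong) auto
    also have "\<dots> = of_real ((c3 / t ^ 3) * (LINT w|lborel. f (x - t *\<^sub>R w) * gauss w))"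
      by (subst integral_complex_of_real) simp
    finally have "cnj (fint h x) = of_real (c3 * (LINT w|lborel. f (x - t *\<^sub>R w) * gauss w))"
      using t by (simp add: scaleR_conv_of_real)
    then show ?thesis by (metis complex_cnj_cnj complex_cnj_complex_of_real)
  qed
  have "complex_of_real (LINT p|lborel. (norm (F p))\<^sup>2 * gauss (t *\<^sub>R p)) = (LINT p|lborel. F p * h p)"
    unfolding eq by (rule integral_complex_of_real[symmetric])
  also have "\<dots> = (LINT x|lborel. of_real (f x) * fint h x)"
    unfolding F_def by (rule fint_mult[OF fc h])
  also have "\<dots> = (LINT x|lborel. of_real (c3 * (f x * (LINT w|lborel. f (x - t *\<^sub>R w) * gauss w))))"
    unfolding hx by (intro Bochner_Integration.integral_cong) (auto simp: mult_ac)
  also have "\<dots> = of_real (c3 * (LINT x|lborel. f x * (LINT w|lborel. f (x - t *\<^sub>R w) * gauss w)))"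
    by (subst integral_complex_of_real) simp
  finally show "(LINT p|lborel. (norm (fint (\<lambda>x. of_real (f x)) p))\<^sup>2 * gauss (t *\<^sub>R p))
      = c3 * (LINT x|lborel. f x * (LINT w|lborel. f (x - t *\<^sub>R w) * gauss w))"
    unfolding F_def of_real_eq_iff .
qed

text \<open>Cauchy-Schwarz together with translation invariance: a shifted copy of \<open>f\<close>
  has the same L^2 norm, so the bound does not depend on the shift \<open>z\<close>.\<close>

lemma autocorrelation_le:
  fixes f :: "real^3 \<Rightarrow> real"
  assumes f: "f \<in> borel_measurable borel" and f2: "integrable lborel (\<lambda>x. (f x)\<^sup>2)"
  shows "integrable lborel (\<lambda>x. f x * f (x - z))"
    and "\<bar>LINT x|lborel. f x * f (x - z)\<bar> \<le> (LINT x|lborel. (f x)\<^sup>2)"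
proof -
  have [measurable]: "f \<in> borel_measurable borel" by fact
  have s: "integrable lborel (\<lambda>x. (f (x - z))\<^sup>2)"
    using integrable_lborel_affine[OF f2, of 1 "- z"] by simp
  have e: "(LINT x|lborel. (f (x - z))\<^sup>2) = (LINT x|lborel. (f x)\<^sup>2)"
    using integral_lborel_affine[of "\<lambda>x. (f x)\<^sup>2" 1 "- z"] by simp
  show "integrable lborel (\<lambda>x. f x * f (x - z))"
    by (rule integral_mult_CS[OF _ _ f2 s]) simp_all
  have "\<bar>LINT x|lborel. f x * f (x - z)\<bar> \<le> (LINT x|lborel. \<bar>f x\<bar> * \<bar>f (x - z)\<bar>)"
    using integral_abs_bound[of lborel "\<lambda>x. f x * f (x - z)"] by (simp add: abs_mult)
  also have "\<dots> \<le> sqrt (LINT x|lborel. (\<bar>f x\<bar>)\<^sup>2) * sqrt (LINT x|lborel. (\<bar>f (x - z)\<bar>)\<^sup>2)"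
    by (rule integral_mult_CS) (use f2 s in simp_all)
  also have "\<dots> = (LINT x|lborel. (f x)\<^sup>2)" by (simp add: e)
  finally show "\<bar>LINT x|lborel. f x * f (x - z)\<bar> \<le> (LINT x|lborel. (f x)\<^sup>2)" .
qed

lemma gauss_nonneg [simp]: "0 \<le> gauss x" by (simp add: gauss_def)

text \<open>After the order of integration is exchanged, the scale \<open>t\<close> occurs only in
  the shift of an autocorrelation. Its uniform bound supplies the integrable majorant, both for
  Fubini here and for the limit \<open>t\<close> to 0 later.\<close>

lemma gauss_weighted_autocorrelation:
  fixes f :: "real^3 \<Rightarrow> real"
  assumes f: "integrable lborel f" and f2: "integrable lborel (\<lambda>x. (f x)\<^sup>2)" and t: "t > 0"
  shows "(LINT p|lborel. (norm (fint (\<lambda>x. of_real (f x)) p))\<^sup>2 * gauss (t *\<^sub>R p))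
      = c3 * (LINT w|lborel. gauss w * (LINT x|lborel. f x * f (x - t *\<^sub>R w)))"
proof -
  have [measurable]: "f \<in> borel_measurable borel" using f by auto
  have "integrable (lborel \<Otimes>\<^sub>M lborel) (\<lambda>(w, x). (f x * f (x - t *\<^sub>R w)) * gauss w)"
  proof (rule lborel_pair.Fubini_integrable)
    show "(\<lambda>(w, x). (f x * f (x - t *\<^sub>R w)) * gauss w) \<in> borel_measurable (lborel \<Otimes>\<^sub>M lborel)"
      by measurable
    show "AE w in lborel. integrable lborel (\<lambda>x. case (w, x) of (w, x) \<Rightarrow> (f x * f (x - t *\<^sub>R w)) * gauss w)"
      using autocorrelation_le(1)[OF _ f2] by simp
    let ?A = "\<lambda>w. LINT x|lborel. \<bar>f x\<bar> * \<bar>f (x - t *\<^sub>R w)\<bar>"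
    have A: "\<bar>?A w\<bar> \<le> (LINT x|lborel. (f x)\<^sup>2)" for w
      using autocorrelation_le(2)[of "\<lambda>x. \<bar>f x\<bar>" "t *\<^sub>R w"] f2 by simp
    have i: "integrable lborel (\<lambda>w. gauss w * (LINT x|lborel. (f x)\<^sup>2))"
      using gauss_integral by simp
    have "integrable lborel (\<lambda>w. gauss w * ?A w)"
      by (rule Bochner_Integration.integrable_bound[OF i])
        (use A in \<open>auto simp: abs_mult intro!: mult_left_mono\<close>)
    then show "integrable lborel (\<lambda>w. LINT x|lborel. norm (case (w, x) of (w, x) \<Rightarrow> (f x * f (x - t *\<^sub>R w)) * gauss w))"
      by (simp add: abs_mult mult.commute)
  qed
  from lborel_pair.Fubini_integral[OF this]
  have "(LINT x|lborel. LINT w|lborel. (f x * f (x - t *\<^sub>R w)) * gauss w)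
     = (LINT w|lborel. LINT x|lborel. (f x * f (x - t *\<^sub>R w)) * gauss w)" by simp
  moreover have "(LINT x|lborel. f x * (LINT w|lborel. f (x - t *\<^sub>R w) * gauss w))
     = (LINT x|lborel. LINT w|lborel. (f x * f (x - t *\<^sub>R w)) * gauss w)"
    by (simp add: mult.assoc)
  moreover have "(LINT w|lborel. LINT x|lborel. (f x * f (x - t *\<^sub>R w)) * gauss w)
     = (LINT w|lborel. gauss w * (LINT x|lborel. f x * f (x - t *\<^sub>R w)))"
    by (simp add: mult.commute)
  ultimately show ?thesis
    unfolding gauss_weighted_fint(2)[OF f t] by simp
qed

lemma gauss_tendsto_1: "(\<lambda>n. gauss (inverse (real (Suc n)) *\<^sub>R p)) \<longlonglongrightarrow> 1"
proof -
  have "(\<lambda>n. gauss (inverse (real (Suc n)) *\<^sub>R p)) \<longlonglongrightarrow> exp (- (norm (0 *\<^sub>R p))\<^sup>2 / 2)"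
    unfolding gauss_def by (intro tendsto_intros LIMSEQ_inverse_real_of_nat) auto
  then show ?thesis by simp
qed

text \<open>Fatou's lemma as the scale tends to 0: the Gaussian weights tend to 1 pointwise, while
  the weighted integrals stay below the uniform autocorrelation bound. No regularity of
  \<open>f\<close> is required for this half of Plancherel.\<close>

lemma bessel_lborel:
  fixes f :: "real^3 \<Rightarrow> real"
  assumes f: "integrable lborel f" and f2: "integrable lborel (\<lambda>x. (f x)\<^sup>2)"
  shows "integrable lborel (\<lambda>p. (norm (fint (\<lambda>x. of_real (f x)) p))\<^sup>2)"
    and "(LINT p|lborel. (norm (fint (\<lambda>x. of_real (f x)) p))\<^sup>2) \<le> c3\<^sup>2 * (LINT x|lborel. (f x)\<^sup>2)"
proof -
  have [measurable]: "f \<in> borel_measurable borel" using f by auto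
  define F where "F = fint (\<lambda>x. of_real (f x))"
  have [measurable]: "F \<in> borel_measurable borel" unfolding F_def by measurable
  define I where "I = (LINT x|lborel. (f x)\<^sup>2)"
  define a where "a n p = (norm (F p))\<^sup>2 * gauss (inverse (real (Suc n)) *\<^sub>R p)" for n p
  have [measurable]: "a n \<in> borel_measurable borel" for n unfolding a_def by measurable
  have a_int: "integrable lborel (a n)" for n
    unfolding a_def F_def by (rule gauss_weighted_fint[OF f]) simp
  have a_le: "(LINT p|lborel. a n p) \<le> c3\<^sup>2 * I" for n
  proof -
    let ?A = "\<lambda>w. LINT x|lborel. f x * f (x - inverse (real (Suc n)) *\<^sub>R w)"
    have A: "\<bar>?A w\<bar> \<le> I" for w
      unfolding I_def by (rule autocorrelation_le(2)[OF _ f2]) simp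
    have i: "integrable lborel (\<lambda>w. gauss w * I)" using gauss_integral by simp
    have "(LINT w|lborel. gauss w * ?A w) \<le> (LINT w|lborel. gauss w * I)"
    proof (rule integral_mono[OF _ i])
      show "integrable lborel (\<lambda>w. gauss w * ?A w)"
        by (rule Bochner_Integration.integrable_bound[OF i])
          (use order_trans[OF A abs_ge_self] in \<open>auto simp: abs_mult simp del: of_nat_Suc intro!: mult_left_mono\<close>)
      show "gauss w * ?A w \<le> gauss w * I" for w
        using A[of w] by (intro mult_left_mono) auto
    qed
    also have "\<dots> = c3 * I" using gauss_integral by simp
    finally have "(LINT p|lborel. a n p) \<le> c3 * (c3 * I)"
      unfolding a_def F_def by (subst gauss_weighted_autocorrelation[OF f f2]) auto
    then show ?thesis by (simp add: power2_eq_square mult.assoc)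
  qed
  have "(\<integral>\<^sup>+p. ennreal ((norm (F p))\<^sup>2) \<partial>lborel) = (\<integral>\<^sup>+p. liminf (\<lambda>n. ennreal (a n p)) \<partial>lborel)"
  proof (intro nn_integral_cong)
    fix p
    have "(\<lambda>n. a n p) \<longlonglongrightarrow> (norm (F p))\<^sup>2 * 1"
      unfolding a_def by (intro tendsto_intros gauss_tendsto_1)
    then have "(\<lambda>n. ennreal (a n p)) \<longlonglongrightarrow> ennreal ((norm (F p))\<^sup>2)"
      by (auto intro: tendsto_ennrealI)
    then show "ennreal ((norm (F p))\<^sup>2) = liminf (\<lambda>n. ennreal (a n p))"
      by (rule lim_imp_Liminf[symmetric, rotated]) simp
  qed
  also have "\<dots> \<le> liminf (\<lambda>n. \<integral>\<^sup>+p. ennreal (a n p) \<partial>lborel)"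
    by (rule nn_integral_liminf) simp
  also have "\<dots> \<le> liminf (\<lambda>n. ennreal (c3\<^sup>2 * I))"
  proof (intro Liminf_mono always_eventually allI)
    fix n
    have "(\<integral>\<^sup>+p. ennreal (a n p) \<partial>lborel) = ennreal (LINT p|lborel. a n p)"
      by (rule nn_integral_eq_integral[OF a_int]) (simp add: a_def)
    then show "(\<integral>\<^sup>+p. ennreal (a n p) \<partial>lborel) \<le> ennreal (c3\<^sup>2 * I)"
      using a_le by (simp add: ennreal_leI)
  qed
  finally have *: "(\<integral>\<^sup>+p. ennreal ((norm (F p))\<^sup>2) \<partial>lborel) \<le> ennreal (c3\<^sup>2 * I)"
    by (simp add: Liminf_const)
  show **: "integrable lborel (\<lambda>p. (norm (fint (\<lambda>x. of_real (f x)) p))\<^sup>2)"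
    using * unfolding F_def[symmetric] by (intro integrableI_bounded) (auto simp: le_less_trans)
  have "ennreal (LINT p|lborel. (norm (F p))\<^sup>2) \<le> ennreal (c3\<^sup>2 * I)"
    using * nn_integral_eq_integral[OF **] by (simp add: F_def)
  then show "(LINT p|lborel. (norm (fint (\<lambda>x. of_real (f x)) p))\<^sup>2) \<le> c3\<^sup>2 * (LINT x|lborel. (f x)\<^sup>2)"
    by (simp add: F_def I_def)
qed

text \<open>Both sides of the autocorrelation identity pass to the limit by dominated convergence:
  the left one is dominated by |F|^2, integrable by the Bessel inequality, and on the right the
  autocorrelation at a shift tending to 0 converges by continuity of \<open>f\<close>, with majorant
  B |f|.\<close>

lemma plancherel_continuous:
  fixes f :: "real^3 \<Rightarrow> real"
  assumes f: "integrable lborel f" and f2: "integrable lborel (\<lambda>x. (f x)\<^sup>2)"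
    and cont: "continuous_on UNIV f" and bdd: "\<And>x. \<bar>f x\<bar> \<le> B"
  shows "(LINT p|lborel. (norm (fint (\<lambda>x. of_real (f x)) p))\<^sup>2) = c3\<^sup>2 * (LINT x|lborel. (f x)\<^sup>2)"
proof -
  have [measurable]: "f \<in> borel_measurable borel" using f by auto
  define F where "F = fint (\<lambda>x. of_real (f x))"
  have [measurable]: "F \<in> borel_measurable borel" unfolding F_def by measurable
  define I where "I = (LINT x|lborel. (f x)\<^sup>2)"
  define t where "t n = inverse (real (Suc n))" for n
  have t0: "0 < t n" for n by (simp add: t_def)
  have t_lim: "t \<longlonglongrightarrow> 0" unfolding t_def by (rule LIMSEQ_inverse_real_of_nat)
  let ?A = "\<lambda>n w. LINT x|lborel. f x * f (x - t n *\<^sub>R w)"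
  have F2: "integrable lborel (\<lambda>p. (norm (F p))\<^sup>2)"
    unfolding F_def by (rule bessel_lborel[OF f f2])
  have "(\<lambda>n. LINT p|lborel. (norm (F p))\<^sup>2 * gauss (t n *\<^sub>R p)) \<longlonglongrightarrow> (LINT p|lborel. (norm (F p))\<^sup>2)"
  proof (rule integral_dominated_convergence[OF _ _ F2])
    show "AE p in lborel. (\<lambda>n. (norm (F p))\<^sup>2 * gauss (t n *\<^sub>R p)) \<longlonglongrightarrow> (norm (F p))\<^sup>2"
    proof (intro AE_I2)
      fix p show "(\<lambda>n. (norm (F p))\<^sup>2 * gauss (t n *\<^sub>R p)) \<longlonglongrightarrow> (norm (F p))\<^sup>2"
        using tendsto_mult[OF tendsto_const[of "(norm (F p))\<^sup>2"] gauss_tendsto_1[of p]] by (simp add: t_def)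
    qed
    show "AE p in lborel. norm ((norm (F p))\<^sup>2 * gauss (t n *\<^sub>R p)) \<le> (norm (F p))\<^sup>2" for n
      by (auto simp: abs_mult gauss_def intro!: mult_left_le)
  qed simp_all
  moreover have "(\<lambda>n. LINT p|lborel. (norm (F p))\<^sup>2 * gauss (t n *\<^sub>R p)) \<longlonglongrightarrow> c3 * (LINT w|lborel. gauss w * I)"
    unfolding F_def gauss_weighted_autocorrelation[OF f f2 t0]
  proof (intro tendsto_mult tendsto_const integral_dominated_convergence)
    show "integrable lborel (\<lambda>w. gauss w * I)" using gauss_integral by simp
    have A: "\<bar>?A n w\<bar> \<le> I" for n w
      unfolding I_def by (rule autocorrelation_le(2)[OF _ f2]) simp
    then show "AE w in lborel. norm (gauss w * ?A n w) \<le> gauss w * I" for n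
      by (auto simp: abs_mult intro!: mult_left_mono)
    show "AE w in lborel. (\<lambda>n. gauss w * ?A n w) \<longlonglongrightarrow> gauss w * I"
    proof (intro AE_I2 tendsto_mult tendsto_const)
      fix w :: "real^3"
      show "(\<lambda>n. ?A n w) \<longlonglongrightarrow> I"
        unfolding I_def
      proof (rule integral_dominated_convergence)
        show "integrable lborel (\<lambda>x. \<bar>f x\<bar> * B)" using f by simp
        show "AE x in lborel. norm (f x * f (x - t n *\<^sub>R w)) \<le> \<bar>f x\<bar> * B" for n
          using bdd by (auto simp: abs_mult intro!: mult_left_mono)
        show "AE x in lborel. (\<lambda>n. f x * f (x - t n *\<^sub>R w)) \<longlonglongrightarrow> (f x)\<^sup>2"
        proof (intro AE_I2)
          fix x
          have "isCont f x" using cont by (simp add: continuous_on_eq_continuous_at)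
          moreover have "(\<lambda>n. x - t n *\<^sub>R w) \<longlonglongrightarrow> x - 0 *\<^sub>R w"
            by (intro tendsto_intros t_lim)
          ultimately have "(\<lambda>n. f (x - t n *\<^sub>R w)) \<longlonglongrightarrow> f x"
            by (intro isCont_tendsto_compose[of x f]) auto
          then show "(\<lambda>n. f x * f (x - t n *\<^sub>R w)) \<longlonglongrightarrow> (f x)\<^sup>2"
            unfolding power2_eq_square by (intro tendsto_intros)
        qed
      qed simp_all
    qed
  qed simp_all
  ultimately have "(LINT p|lborel. (norm (F p))\<^sup>2) = c3 * (LINT w|lborel. gauss w * I)"
    by (rule LIMSEQ_unique)
  also have "\<dots> = c3\<^sup>2 * I" using gauss_integral by (simp add: power2_eq_square)
  finally show ?thesis by (simp add: F_def I_def)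
qed

section \<open>Passage to the completed Lebesgue measure\<close>

lemma lebesgue_borel_rep:
  fixes f :: "'a::euclidean_space \<Rightarrow> real"
  assumes "f \<in> borel_measurable lebesgue"
  obtains f' where "f' \<in> borel_measurable borel" "AE x in lebesgue. f x = f' x"
  using completion_ex_borel_measurable_real[OF assms] by (auto intro: AE_completion)

lemma lebesgue_integral_borel:
  fixes f :: "'a::euclidean_space \<Rightarrow> 'b::{banach, second_countable_topology}"
  assumes "f \<in> borel_measurable borel"
  shows "integrable lebesgue f \<longleftrightarrow> integrable lborel f" "integral\<^sup>L lebesgue f = integral\<^sup>L lborel f"
  using assms by (auto simp: integrable_completion integral_completion)

lemma borel_measurable_lebesgueI:
  "f \<in> borel_measurable borel \<Longrightarrow> f \<in> borel_measurable lebesgue"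
  by (simp add: measurable_completion)

lemma exp_inner_measurable_lebesgue [measurable]:
  "(\<lambda>x. exp (- (\<i> * complex_of_real (p \<bullet> x)))) \<in> borel_measurable lebesgue"
  by (rule borel_measurable_lebesgueI) measurable

lemma fourier_integral_cong_AE:
  assumes "AE x in lebesgue. f x = g x" "f \<in> borel_measurable lebesgue" "g \<in> borel_measurable lebesgue"
  shows "fourier_integral f = fourier_integral g"
proof
  fix p :: "real^3"
  have [measurable]: "f \<in> borel_measurable lebesgue" "g \<in> borel_measurable lebesgue" by fact+
  show "fourier_integral f p = fourier_integral g p"
    unfolding fourier_integral_def
    by (intro arg_cong2[where f="(*)"] refl integral_cong_AE) (use assms(1) in auto)
qed

lemma fourier_integral_eq_fint:
  assumes [measurable]: "f \<in> borel_measurable borel"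
  shows "fourier_integral f p = of_real (1 / c3) * fint (\<lambda>x. of_real (f x)) p"
proof -
  have "(2 * pi) powr (-3/2) = 1 / c3"
    unfolding c3_def by (simp add: powr_minus_divide[symmetric])
  then show ?thesis
    unfolding fourier_integral_def fint_def
    by (subst lebesgue_integral_borel(2)) auto
qed

lemma fourier_integral_rep:
  assumes "f \<in> borel_measurable lebesgue"
  obtains f' where "f' \<in> borel_measurable borel" "AE x in lebesgue. f x = f' x"
    "fourier_integral f = (\<lambda>p. of_real (1 / c3) * fint (\<lambda>x. of_real (f' x)) p)"
proof -
  obtain f' where f': "f' \<in> borel_measurable borel" "AE x in lebesgue. f x = f' x"
    using lebesgue_borel_rep[OF assms] .
  have "fourier_integral f = fourier_integral f'"
    by (rule fourier_integral_cong_AE) (use f' assms in \<open>auto intro: borel_measurable_lebesgueI\<close>)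
  then show ?thesis using that[OF f'] fourier_integral_eq_fint[OF f'(1)] by auto
qed

lemma fourier_integral_measurable [measurable]:
  assumes "f \<in> borel_measurable lebesgue"
  shows "fourier_integral f \<in> borel_measurable borel"
proof -
  obtain f' where [measurable]: "f' \<in> borel_measurable borel" and "AE x in lebesgue. f x = f' x"
    and eq: "fourier_integral f = (\<lambda>p. of_real (1 / c3) * fint (\<lambda>x. of_real (f' x)) p)"
    using fourier_integral_rep[OF assms] .
  show ?thesis unfolding eq by measurable
qed

lemma norm_fourier_integral_le:
  assumes "f \<in> borel_measurable lebesgue"
  shows "norm (fourier_integral f p) \<le> L1_norm f / c3"
proof -
  have "(2 * pi) powr (-3/2) = 1 / c3"
    unfolding c3_def by (simp add: powr_minus_divide[symmetric])
  then show ?thesis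
    using integral_norm_bound[of lebesgue "\<lambda>x. of_real (f x) * exp (- \<i> * of_real (p \<bullet> x))"]
    by (simp add: fourier_integral_def L1_norm_def norm_mult norm_divide divide_right_mono less_imp_le[OF c3_pos])
qed

lemma fourier_integral_diff:
  assumes "integrable lebesgue f" "integrable lebesgue g"
  shows "fourier_integral (\<lambda>x. f x - g x) p = fourier_integral f p - fourier_integral g p"
proof -
  have i: "integrable lebesgue (\<lambda>x. of_real (h x) * exp (- \<i> * of_real (p \<bullet> x)))"
    if "integrable lebesgue h" for h :: "real^3 \<Rightarrow> real"
  proof -
    have [measurable]: "h \<in> borel_measurable lebesgue" using that by auto
    show ?thesis
      by (rule Bochner_Integration.integrable_bound[OF that]) (auto simp: norm_mult)
  qed
  show ?thesis
    unfolding fourier_integral_def using i[OF assms(1)] i[OF assms(2)]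
    by (simp add: left_diff_distrib right_diff_distrib)
qed

text \<open>The statement is proved for Borel functions, where the factor \<open>c3\<^sup>2\<close>
  of the unnormalized transform is cancelled by \<open>1 / c3\<close>, and is then carried over to a
  Borel representative.\<close>

lemma bessel:
  assumes f: "integrable lebesgue f" and f2: "square_integrable f"
  shows "square_integrable (fourier_integral f)" and "l2 (fourier_integral f) \<le> l2 f"
    and "continuous_on UNIV f \<Longrightarrow> (\<And>x. \<bar>f x\<bar> \<le> B) \<Longrightarrow> l2 (fourier_integral f) = l2 f"
proof -
  have fm: "f \<in> borel_measurable lebesgue" using f by auto
  have *: "square_integrable (fourier_integral h)" "l2 (fourier_integral h) \<le> l2 h"
     "continuous_on UNIV h \<Longrightarrow> (\<And>x. \<bar>h x\<bar> \<le> B) \<Longrightarrow> l2 (fourier_integral h) = l2 h"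
    if [measurable]: "h \<in> borel_measurable borel" and h: "integrable lebesgue h" "square_integrable h" for h
  proof -
    have h1: "integrable lborel h" using h(1) by (simp add: lebesgue_integral_borel)
    have h2: "integrable lborel (\<lambda>x. (h x)\<^sup>2)"
      using h(2) by (simp add: square_integrable_def lebesgue_integral_borel)
    have H: "fourier_integral h = (\<lambda>p. of_real (1 / c3) * fint (\<lambda>x. of_real (h x)) p)"
      using fourier_integral_eq_fint[OF that(1)] by auto
    have [measurable]: "fourier_integral h \<in> borel_measurable borel"
      using that(2) by (intro fourier_integral_measurable) auto
    have n: "(norm (fourier_integral h p))\<^sup>2 = (1 / c3\<^sup>2) * (norm (fint (\<lambda>x. of_real (h x)) p))\<^sup>2" for p
      unfolding H by (simp add: norm_mult norm_divide power_mult_distrib power_divide)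
    show s: "square_integrable (fourier_integral h)"
      unfolding square_integrable_def
      by (subst lebesgue_integral_borel) (use bessel_lborel(1)[OF h1 h2] in
        \<open>auto simp: n intro: borel_measurable_lebesgueI simp del: norm_mult\<close>)
    have e: "(l2 (fourier_integral h))\<^sup>2 = (1 / c3\<^sup>2) * (LINT p|lborel. (norm (fint (\<lambda>x. of_real (h x)) p))\<^sup>2)"
      unfolding l2_power2 by (subst lebesgue_integral_borel) (auto simp: n)
    have e2: "(l2 h)\<^sup>2 = (LINT x|lborel. (h x)\<^sup>2)"
      unfolding l2_power2 by (subst lebesgue_integral_borel) auto
    have "(l2 (fourier_integral h))\<^sup>2 \<le> (l2 h)\<^sup>2"
      unfolding e e2 using bessel_lborel(2)[OF h1 h2] by (simp add: pos_divide_le_eq mult.commute)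
    then show "l2 (fourier_integral h) \<le> l2 h" by (rule power2_le_imp_le) simp
    assume "continuous_on UNIV h" "\<And>x. \<bar>h x\<bar> \<le> B"
    then have "(l2 (fourier_integral h))\<^sup>2 = (l2 h)\<^sup>2"
      unfolding e e2 by (subst plancherel_continuous[OF h1 h2]) (auto simp: field_simps less_imp_neq[OF c3_pos, symmetric])
    then show "l2 (fourier_integral h) = l2 h" by simp
  qed
  obtain f' where f'[measurable]: "f' \<in> borel_measurable borel" and ae: "AE x in lebesgue. f x = f' x"
    using lebesgue_borel_rep[OF fm] .
  note f'm = borel_measurable_lebesgueI[OF f']
  have eq: "fourier_integral f = fourier_integral f'" "l2 f = l2 f'"
    by (rule fourier_integral_cong_AE l2_cong_AE; use ae fm f'm in auto)+
  have "integrable lebesgue f'" using integrable_cong_AE_imp[OF f f'm] ae by auto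
  note ** = *[OF f' this square_integrable_cong_AE[OF ae f2 f'm]]
  show "square_integrable (fourier_integral f)" "l2 (fourier_integral f) \<le> l2 f"
    using ** eq by auto
  \<comment> \<open>The representative \<open>f'\<close> need not be continuous, but a continuous
    \<open>f\<close> is itself Borel, so the Borel case applies to \<open>f\<close>
    directly.\<close>
  assume "continuous_on UNIV f" "\<And>x. \<bar>f x\<bar> \<le> B"
  then show "l2 (fourier_integral f) = l2 f"
    using *(3)[OF borel_measurable_continuous_onI f f2] by auto
qed

section \<open>Density of bounded continuous functions and the full Plancherel identity\<close>

lemma l2_dominated_convergence:
  fixes f :: "real^3 \<Rightarrow> 'b::{real_normed_vector, second_countable_topology}"
  assumes w: "integrable lebesgue (\<lambda>x. (w x)\<^sup>2)"
    and m: "f \<in> borel_measurable lebesgue" "\<And>n. h n \<in> borel_measurable lebesgue"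
    and ae: "AE x in lebesgue. (\<lambda>n. h n x) \<longlonglongrightarrow> f x"
    and bound: "\<And>n. AE x in lebesgue. norm (f x - h n x) \<le> w x"
  shows "(\<lambda>n. l2 (\<lambda>x. f x - h n x)) \<longlonglongrightarrow> 0"
proof -
  have [measurable]: "f \<in> borel_measurable lebesgue" "\<And>n. h n \<in> borel_measurable lebesgue" by fact+
  have "(\<lambda>n. LINT x|lebesgue. (norm (f x - h n x))\<^sup>2) \<longlonglongrightarrow> (LINT x|(lebesgue :: (real^3) measure). 0)"
  proof (rule integral_dominated_convergence[OF _ _ w])
    show "AE x in lebesgue. (\<lambda>n. (norm (f x - h n x))\<^sup>2) \<longlonglongrightarrow> 0"
      using ae
    proof eventually_elim
      case (elim x)
      have "(\<lambda>n. (norm (f x - h n x))\<^sup>2) \<longlonglongrightarrow> (norm (f x - f x))\<^sup>2"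
        by (intro tendsto_intros elim)
      then show ?case by simp
    qed
    show "AE x in lebesgue. norm ((norm (f x - h n x))\<^sup>2) \<le> (w x)\<^sup>2" for n
      using bound[of n] by eventually_elim (simp add: power_mono)
  qed simp_all
  then have "(\<lambda>n. sqrt (LINT x|lebesgue. (norm (f x - h n x))\<^sup>2)) \<longlonglongrightarrow> sqrt 0"
    by (intro tendsto_intros) simp
  then show ?thesis by (simp add: l2_def)
qed

lemma indicator_power2 [simp]: "(indicator A x :: real)\<^sup>2 = indicator A x"
  by (simp add: indicator_def)

text \<open>Clipping the values of \<open>f\<close> and cutting it off in space costs little in L^2.
  The result is then approximated by continuous functions under the same clipping and cut-off, which
  provides a majorant living on one ball.\<close>

lemma l2_dense_continuous:
  fixes f :: "real^3 \<Rightarrow> real"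
  assumes f: "square_integrable f" and e: "0 < e"
  obtains h B where "continuous_on UNIV h" "\<And>x. \<bar>h x\<bar> \<le> B" "integrable lebesgue h"
    "square_integrable h" "l2 (\<lambda>x. f x - h x) < e"
proof -
  have fm[measurable]: "f \<in> borel_measurable lebesgue" using f by (rule square_integrable_measurable)
  \<comment> \<open>\<open>T k\<close> clips values to [-k, k]; \<open>X k\<close> is a continuous
    cut-off, equal to 1 where |x| <= k - 1 and vanishing where |x| >= k. Both are continuous, so
    they preserve continuity of the approximants.\<close>
  define T where "T k y = max (- real k) (min (real k) y)" for k :: nat and y
  define X where "X k x = max 0 (min 1 (real k - norm x))" for k :: nat and x :: "real^3"
  have X: "0 \<le> X k x" "X k x \<le> 1" "norm x \<ge> k \<Longrightarrow> X k x = 0" "real k \<ge> norm x + 1 \<Longrightarrow> X k x = 1" for k x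
    by (auto simp: X_def)
  have T: "\<bar>T k y\<bar> \<le> k" "\<bar>T k y\<bar> \<le> \<bar>y\<bar>" "0 \<le> T k y * y" "k \<ge> \<bar>y\<bar> \<Longrightarrow> T k y = y" for k y
    by (auto simp: T_def max_def min_def mult_nonneg_nonneg mult_nonpos_nonpos zero_le_mult_iff)
  have contX: "continuous_on UNIV (X k)" for k unfolding X_def by (intro continuous_intros)
  have Xm[measurable]: "X k \<in> borel_measurable borel" for k
    using contX by (rule borel_measurable_continuous_onI)
  have Xm'[measurable]: "X k \<in> borel_measurable lebesgue" for k
    by (rule borel_measurable_lebesgueI) simp
  have Tm[measurable]: "(\<lambda>x. T k (g x)) \<in> borel_measurable M" if "g \<in> borel_measurable M" for k g and M :: "'x measure"
    using that unfolding T_def by measurable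
  let ?h = "\<lambda>k x. T k (f x) * X k x"
  have "(\<lambda>k. l2 (\<lambda>x. f x - ?h k x)) \<longlonglongrightarrow> 0"
  proof (rule l2_dominated_convergence[where w="\<lambda>x. \<bar>f x\<bar>"])
    show "AE x in lebesgue. (\<lambda>k. ?h k x) \<longlonglongrightarrow> f x"
    proof (intro AE_I2 tendsto_eventually)
      fix x
      obtain K :: nat where "max \<bar>f x\<bar> (norm x + 1) \<le> K" using real_arch_simple by blast
      then show "\<forall>\<^sub>F k in sequentially. ?h k x = f x"
        by (intro eventually_sequentiallyI[of K]) (simp add: T X)
    qed
    show "AE x in lebesgue. norm (f x - ?h k x) \<le> \<bar>f x\<bar>" for k
    proof (intro AE_I2)
      fix x
      show "norm (f x - ?h k x) \<le> \<bar>f x\<bar>"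
      proof (cases "0 \<le> f x")
        case True
        then have "0 \<le> T k (f x)" "T k (f x) \<le> f x" by (auto simp: T_def)
        moreover from this have "0 \<le> ?h k x" "?h k x \<le> T k (f x)"
          using X by (auto intro: mult_left_le)
        ultimately show ?thesis using True by simp
      next
        case False
        then have "T k (f x) \<le> 0" "f x \<le> T k (f x)" by (auto simp: T_def)
        moreover from this have "?h k x \<le> 0" "T k (f x) \<le> ?h k x"
          using X mult_left_le[of "X k x" "- T k (f x)"] by (auto intro: mult_nonpos_nonneg)
        ultimately show ?thesis using False by simp
      qed
    qed
  qed (use f in \<open>auto simp: square_integrable_def\<close>)
  from order_tendstoD(2)[OF this, of "e / 2"] e
  obtain k where k: "l2 (\<lambda>x. f x - ?h k x) < e / 2"
    by (auto simp: eventually_sequentially)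
  \<comment> \<open>Measurability gives continuous functions converging to \<open>f\<close> off a
    negligible set, but without any bound on them; applying \<open>T k\<close> and
    \<open>X k\<close> to each of them restores domination.\<close>
  have "f measurable_on UNIV"
    using lebesgue_measurable_imp_measurable_on_real[OF fm] by simp
  then obtain N g where N: "negligible N" and g: "\<And>n. continuous_on UNIV (g n)"
    and lim: "\<And>x. x \<notin> N \<Longrightarrow> (\<lambda>n. g n x) \<longlonglongrightarrow> f x"
    unfolding measurable_on_def by auto
  have [measurable]: "g n \<in> borel_measurable lebesgue" for n
    by (intro borel_measurable_lebesgueI borel_measurable_continuous_onI g)
  let ?g = "\<lambda>n x. T k (g n x) * X k x"
  have ball: "integrable lebesgue (\<lambda>x. c * indicator (cball 0 (real k)) x :: real)" for c
    by (intro integrable_mult_right integrable_real_indicator)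
      (auto simp: emeasure_cball)
  have le: "\<bar>T k y * X k x\<bar> \<le> real k * indicator (cball 0 (real k)) x" for x y
  proof (cases "norm x \<le> real k")
    case True
    have "\<bar>T k y\<bar> * \<bar>X k x\<bar> \<le> real k * 1" using T(1)[of k y] X(1)[of k x] X(2)[of k x] by (intro mult_mono) auto
    then show ?thesis using True by (simp add: abs_mult)
  qed (use X in auto)
  have "(\<lambda>n. l2 (\<lambda>x. ?h k x - ?g n x)) \<longlonglongrightarrow> 0"
  proof (rule l2_dominated_convergence[where w="\<lambda>x. 2 * real k * indicator (cball 0 (real k)) x"])
    show "AE x in lebesgue. (\<lambda>n. ?g n x) \<longlonglongrightarrow> ?h k x"
    proof -
      have "AE x in lebesgue. x \<notin> N"
        using N by (simp add: negligible_iff_null_sets AE_not_in)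
      then show ?thesis
        by eventually_elim (unfold T_def, intro tendsto_intros lim)
    qed
    show "integrable lebesgue (\<lambda>x. (2 * real k * indicator (cball 0 (real k)) x)\<^sup>2)"
      using ball[of "(2 * real k)\<^sup>2"] by (simp add: power_mult_distrib)
    show "AE x in lebesgue. norm (?h k x - ?g n x) \<le> 2 * real k * indicator (cball 0 (real k)) x" for n
    proof (intro AE_I2)
      fix x
      show "norm (?h k x - ?g n x) \<le> 2 * real k * indicator (cball 0 (real k)) x"
        using le[of "f x" x] le[of "g n x" x] by simp
    qed
  qed simp_all
  from order_tendstoD(2)[OF this, of "e / 2"] e
  obtain n where n: "l2 (\<lambda>x. ?h k x - ?g n x) < e / 2"
    by (auto simp: eventually_sequentially)
  have m: "(\<lambda>x. T k (v x) * X k x) \<in> borel_measurable lebesgue"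
    if "v \<in> borel_measurable lebesgue" for v using that by measurable
  have int: "integrable lebesgue (\<lambda>x. T k (v x) * X k x)"
    if "v \<in> borel_measurable lebesgue" for v
    by (rule Bochner_Integration.integrable_bound[OF ball[of "real k"] m[OF that]])
      (use le in auto)
  have sq: "square_integrable (\<lambda>x. T k (v x) * X k x)"
    if "v \<in> borel_measurable lebesgue" for v
  proof (rule square_integrable_bound(1)[OF _ m[OF that]])
    show "square_integrable (\<lambda>x. real k * indicator (cball 0 (real k)) x :: real)"
      unfolding square_integrable_def
      using ball[of "(real k)\<^sup>2"] borel_measurable_integrable[OF ball[of "real k"]] by (simp add: power_mult_distrib)
  qed (use le in auto)
  show ?thesis
  proof (rule that[of "?g n" "real k"])
    show "continuous_on UNIV (?g n)"
      unfolding T_def by (intro continuous_intros contX g)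
    show "\<bar>?g n x\<bar> \<le> real k" for x
      by (rule order_trans[OF le]) (simp add: mult_left_le)
    show "integrable lebesgue (?g n)" "square_integrable (?g n)"
      by (rule int sq; simp)+
    have "l2 (\<lambda>x. f x - ?g n x) = l2 (\<lambda>x. (f x - ?h k x) + (?h k x - ?g n x))"
      by (simp add: algebra_simps)
    also have "\<dots> \<le> l2 (\<lambda>x. f x - ?h k x) + l2 (\<lambda>x. ?h k x - ?g n x)"
      by (intro square_integrable_add square_integrable_diff f sq fm) auto
    also have "\<dots> < e" using k n by simp
    finally show "l2 (\<lambda>x. f x - ?g n x) < e" .
  qed
qed

text \<open>Only the lower bound on the transform is left. A continuous approximant \<open>h\<close>
  satisfies the identity, and the error \<open>h - f\<close> is controlled by e/2 before the
  transform by choice of \<open>h\<close> and after it by the Bessel inequality.\<close>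

lemma plancherel:
  assumes f: "integrable lebesgue f" and f2: "square_integrable f"
  shows "l2 (fourier_integral f) = l2 f"
proof (rule antisym[OF bessel(2)[OF f f2]], rule field_le_epsilon)
  fix e :: real assume "0 < e"
  then obtain h B where h: "continuous_on UNIV h" "\<And>x. \<bar>h x\<bar> \<le> B" "integrable lebesgue h"
    "square_integrable h" "l2 (\<lambda>x. f x - h x) < e / 2"
    using l2_dense_continuous[OF f2, of "e / 2"] by auto
  let ?F = "fourier_integral"
  have d: "integrable lebesgue (\<lambda>x. h x - f x)" "square_integrable (\<lambda>x. h x - f x)"
    using f f2 h by (auto intro: square_integrable_diff)
  have c: "l2 (\<lambda>x. h x - f x) < e / 2"
    using h(5) by (simp add: l2_def power2_commute)
  have "l2 f = l2 (\<lambda>x. (f x - h x) + h x)" by simp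
  also have "\<dots> \<le> l2 (\<lambda>x. f x - h x) + l2 h"
    using square_integrable_diff(1)[OF f2 h(4)] h(4) by (rule square_integrable_add)
  also have "l2 h = l2 (?F h)" by (rule bessel(3)[symmetric, OF h(3,4,1,2)])
  also have "\<dots> = l2 (\<lambda>p. ?F (\<lambda>x. h x - f x) p + ?F f p)"
    by (simp add: fourier_integral_diff[OF h(3) f])
  also have "\<dots> \<le> l2 (?F (\<lambda>x. h x - f x)) + l2 (?F f)"
    by (intro square_integrable_add bessel f f2 d)
  also have "l2 (?F (\<lambda>x. h x - f x)) \<le> l2 (\<lambda>x. h x - f x)" by (rule bessel[OF d])
  finally show "l2 f \<le> l2 (?F f) + e" using h(5) c by simp
qed

section \<open>Null sets under reflection and the convolution theorem\<close>

text \<open>Completeness of the measure: preimages under \<open>f\<close> and \<open>g\<close>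
  differ by subsets of a null set, so \<open>g\<close> needs no measurability assumption of its
  own.\<close>

lemma lebesgue_measurable_cong_AE:
  fixes f g :: "'a::euclidean_space \<Rightarrow> 'b::topological_space"
  assumes f: "f \<in> borel_measurable lebesgue" and ae: "AE x in lebesgue. f x = g x"
  shows "g \<in> borel_measurable lebesgue"
proof (rule measurableI)
  fix A :: "'b set" assume A: "A \<in> sets borel"
  have "f -` A \<in> sets lebesgue" using measurable_sets[OF f A] by simp
  then have "g -` A \<in> sets lebesgue"
    by (rule completion.in_sets_AE[rotated]) (use ae in auto)
  then show "g -` A \<inter> space lebesgue \<in> sets lebesgue" by simp
qed simp

lemma AE_lborel_reflect:
  fixes x :: "'a::euclidean_space"
  assumes "AE y in lebesgue. P y"
  shows "AE y in lebesgue. P (x - y)"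
proof -
  have "AE y in lborel. P y" using assms by (simp add: AE_completion_iff)
  then obtain N where N: "{y. \<not> P y} \<subseteq> N" "N \<in> sets borel" "emeasure lborel N = 0"
    by (auto elim!: AE_E)
  have [measurable]: "N \<in> sets borel" by fact
  have "(\<integral>\<^sup>+y. indicator N y \<partial>lborel) = ennreal (\<bar>-1\<bar> ^ DIM('a)) * (\<integral>\<^sup>+y. indicator N (x + (-1) *\<^sub>R y) \<partial>lborel)"
    by (rule nn_integral_lborel_affine) auto
  then have "(\<integral>\<^sup>+y. indicator N (x - y) \<partial>lborel) = 0" using N by simp
  then have "AE y in lborel. x - y \<notin> N"
    by (subst (asm) nn_integral_0_iff_AE) (auto simp: indicator_eq_0_iff)
  then have "AE y in lborel. P (x - y)" by eventually_elim (use N in auto)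
  then show ?thesis by (rule AE_completion)
qed

text \<open>The factor \<open>c3\<close> is a matter of normalization: (2 pi)^(-3/2) occurs once in
  the transform of the convolution and twice in the product of the transforms.\<close>

lemma fourier_convolution:
  fixes f g :: "real^3 \<Rightarrow> real"
  assumes f: "integrable lebesgue f" and g: "integrable lebesgue g"
  shows "integrable lebesgue (\<lambda>x. LINT y|lebesgue. f (x - y) * g y)" (is "integrable _ ?c")
    and "fourier_integral (\<lambda>x. LINT y|lebesgue. f (x - y) * g y) p
       = of_real c3 * fourier_integral f p * fourier_integral g p"
proof -
  obtain f' where f'[measurable]: "f' \<in> borel_measurable borel" "AE x in lebesgue. f x = f' x"
    "fourier_integral f = (\<lambda>p. of_real (1 / c3) * fint (\<lambda>x. of_real (f' x)) p)"
    using fourier_integral_rep f by blast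
  obtain g' where g'[measurable]: "g' \<in> borel_measurable borel" "AE x in lebesgue. g x = g' x"
    "fourier_integral g = (\<lambda>p. of_real (1 / c3) * fint (\<lambda>x. of_real (g' x)) p)"
    using fourier_integral_rep g by blast
  have fi: "integrable lborel f'"
    using integrable_cong_AE_imp[OF f borel_measurable_lebesgueI[OF f'(1)]] f'(2)
    by (auto simp: lebesgue_integral_borel)
  have gi: "integrable lborel g'"
    using integrable_cong_AE_imp[OF g borel_measurable_lebesgueI[OF g'(1)]] g'(2)
    by (auto simp: lebesgue_integral_borel)
  \<comment> \<open>Replacing both functions by Borel representatives leaves the convolution
    unchanged at every single x, since reflection about any x preserves null sets. Thus the
    convolution is Borel measurable although \<open>f\<close> and \<open>g\<close> are only Lebesgue
    measurable.\<close>
  have c: "?c x = (LINT y|lborel. f' (x - y) * g' y)" for x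
  proof -
    have ae: "AE y in lebesgue. f' (x - y) * g' y = f (x - y) * g y"
      using AE_lborel_reflect[OF f'(2), of x] g'(2) by eventually_elim simp
    have m: "(\<lambda>y. f' (x - y) * g' y) \<in> borel_measurable lebesgue"
      by (rule borel_measurable_lebesgueI) measurable
    have "(LINT y|lebesgue. f' (x - y) * g' y) = ?c x"
      by (rule integral_cong_AE[OF m lebesgue_measurable_cong_AE[OF m ae] ae])
    then show ?thesis by (simp add: lebesgue_integral_borel)
  qed
  define F where "F = (\<lambda>x. complex_of_real (f' x))"
  define G where "G = (\<lambda>x. complex_of_real (g' x))"
  have FG: "integrable lborel F" "integrable lborel G" using fi gi by (auto simp: F_def G_def)
  have [measurable]: "F \<in> borel_measurable borel" "G \<in> borel_measurable borel"
    unfolding F_def G_def by measurable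
  have tr: "integrable lborel (\<lambda>x. h (x - y))" "(LINT x|lborel. h (x - y)) = (LINT x|lborel. h x)"
    if "integrable lborel h" for h :: "real^3 \<Rightarrow> 'b::{banach, second_countable_topology}" and y
    using integrable_lborel_affine[OF that, of 1 "- y"] integral_lborel_affine[of h 1 "- y"] that
    by auto
  have prod: "integrable (lborel \<Otimes>\<^sub>M lborel) (\<lambda>(y, x). f' (x - y) * g' y)"
  proof (rule lborel_pair.Fubini_integrable)
    show "(\<lambda>(y, x). f' (x - y) * g' y) \<in> borel_measurable (lborel \<Otimes>\<^sub>M lborel)" by measurable
    have e: "(LINT x|lborel. norm (f' (x - y) * g' y)) = (LINT x|lborel. \<bar>f' x\<bar>) * \<bar>g' y\<bar>" for y
      using tr(2)[of "\<lambda>x. \<bar>f' x\<bar>" y] fi by (simp add: abs_mult)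
    show "integrable lborel (\<lambda>y. LINT x|lborel. norm (case (y, x) of (y, x) \<Rightarrow> f' (x - y) * g' y))"
      using gi by (simp add: e del: real_norm_def)
    show "AE y in lborel. integrable lborel (\<lambda>x. case (y, x) of (y, x) \<Rightarrow> f' (x - y) * g' y)"
      using tr(1)[OF fi] by simp
  qed
  have "integrable lborel (\<lambda>x. LINT y|lborel. f' (x - y) * g' y)"
    using lborel_pair.integrable_snd[OF prod] by simp
  then show "integrable lebesgue ?c"
    unfolding c by (subst lebesgue_integral_borel) auto
  have "integrable (lborel \<Otimes>\<^sub>M lborel) (\<lambda>(y, x). F (x - y) * G y * exp (- \<i> * of_real (p \<bullet> x)))"
    by (rule Bochner_Integration.integrable_bound[OF prod]) (auto simp: F_def G_def norm_mult)
  from lborel_pair.Fubini_integral[OF this]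
  have sw: "(LINT x|lborel. LINT y|lborel. F (x - y) * G y * exp (- \<i> * of_real (p \<bullet> x)))
     = (LINT y|lborel. LINT x|lborel. F (x - y) * G y * exp (- \<i> * of_real (p \<bullet> x)))" by simp
  have "fint (\<lambda>x. of_real (LINT y|lborel. f' (x - y) * g' y)) p
     = (LINT x|lborel. LINT y|lborel. F (x - y) * G y * exp (- \<i> * of_real (p \<bullet> x)))"
    unfolding fint_def integral_complex_of_real[symmetric] by (simp add: F_def G_def)
  also note sw
  also have "(LINT y|lborel. LINT x|lborel. F (x - y) * G y * exp (- \<i> * of_real (p \<bullet> x)))
     = (LINT y|lborel. fint F p * (G y * exp (- \<i> * of_real (p \<bullet> y))))"
  proof (intro Bochner_Integration.integral_cong refl)
    fix y :: "real^3"
    have "(LINT x|lborel. F (x - y) * G y * exp (- \<i> * of_real (p \<bullet> x)))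
       = (LINT x|lborel. F x * G y * exp (- \<i> * of_real (p \<bullet> (y + x))))"
      by (subst integral_lborel_affine[of _ 1 y]) auto
    also have "\<dots> = (LINT x|lborel. (F x * exp (- \<i> * of_real (p \<bullet> x))) * (G y * exp (- \<i> * of_real (p \<bullet> y))))"
      by (intro Bochner_Integration.integral_cong) (auto simp: inner_add_right algebra_simps exp_add exp_diff exp_minus field_simps)
    also have "\<dots> = fint F p * (G y * exp (- \<i> * of_real (p \<bullet> y)))"
      unfolding fint_def by (rule integral_mult_left_zero)
    finally show "(LINT x|lborel. F (x - y) * G y * exp (- \<i> * of_real (p \<bullet> x)))
       = fint F p * (G y * exp (- \<i> * of_real (p \<bullet> y)))" .
  qed
  also have "\<dots> = fint F p * fint G p"
    unfolding fint_def[of G] by (rule integral_mult_right_zero)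
  finally show "fourier_integral ?c p = of_real c3 * fourier_integral f p * fourier_integral g p"
    unfolding c f' g' by (subst fourier_integral_eq_fint) (auto simp: F_def G_def)
qed

subsection \<open>The Fourier transform on \<open>L\<^sup>2\<close>\<close>

definition trunc :: "real \<Rightarrow> (real^3 \<Rightarrow> real) \<Rightarrow> real^3 \<Rightarrow> real" where
  "trunc R f = (\<lambda>x. indicator (cball 0 R) x * f x)"

text \<open>The second clause of \<open>is_fourier\<close>, with the real distance \<open>l2\<close>
  in place of an extended integral, so that the triangle inequality and limits of reals apply. It
  stays a relation because a transform is determined only up to null sets.\<close>

definition L2_fourier :: "(real^3 \<Rightarrow> real) \<Rightarrow> (real^3 \<Rightarrow> complex) \<Rightarrow> bool" where
  "L2_fourier f F \<longleftrightarrow> square_integrable f \<and> square_integrable F \<and>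
     ((\<lambda>R. l2 (\<lambda>p. F p - fourier_integral (trunc R f) p)) \<longlongrightarrow> 0) at_top"

text \<open>Balls have finite measure, so Cauchy-Schwarz against their indicator makes a truncated
  L^2 function integrable; its Fourier integral is then an honest one.\<close>

lemma trunc_integrable:
  assumes f: "square_integrable f"
  shows "integrable lebesgue (trunc R f)" "square_integrable (trunc R f)" "l2 (trunc R f) \<le> l2 f"
proof -
  have [measurable]: "f \<in> borel_measurable lebesgue" using f by (rule square_integrable_measurable)
  have "emeasure lborel (cball (0::real^3) R) < \<infinity>"
    by (cases "0 \<le> R") (auto simp: emeasure_cball)
  then have i: "integrable lebesgue (indicator (cball (0::real^3) R) :: _ \<Rightarrow> real)"
    by (intro integrable_real_indicator) auto
  show "integrable lebesgue (trunc R f)"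
      unfolding trunc_def
    by (rule integral_mult_CS(1)[OF borel_measurable_indicator square_integrable_measurable[OF f]])
      (use f i in \<open>auto simp: square_integrable_def\<close>)
  have m: "trunc R f \<in> borel_measurable lebesgue" unfolding trunc_def
    by (intro borel_measurable_times borel_measurable_indicator square_integrable_measurable f) simp
  show "square_integrable (trunc R f)" "l2 (trunc R f) \<le> l2 f"
    by (rule square_integrable_bound[OF f m]; simp add: trunc_def indicator_def)+
qed

lemma trunc_tendsto:
  assumes f: "square_integrable f"
  shows "((\<lambda>R. l2 (\<lambda>x. f x - trunc R f x)) \<longlongrightarrow> 0) at_top"
proof (rule tendsto_at_topI_sequentially)
  fix X :: "nat \<Rightarrow> real" assume X: "filterlim X at_top sequentially"
  show "(\<lambda>n. l2 (\<lambda>x. f x - trunc (X n) f x)) \<longlonglongrightarrow> 0"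
  proof (rule l2_dominated_convergence[where w="\<lambda>x. \<bar>f x\<bar>"])
    show "AE x in lebesgue. (\<lambda>n. trunc (X n) f x) \<longlonglongrightarrow> f x"
    proof (intro AE_I2 tendsto_eventually)
      fix x :: "real^3"
      have "\<forall>\<^sub>F n in sequentially. norm x \<le> X n"
        using X by (simp add: filterlim_at_top)
      then show "\<forall>\<^sub>F n in sequentially. trunc (X n) f x = f x"
        by eventually_elim (simp add: trunc_def)
    qed
    show "AE x in lebesgue. norm (f x - trunc (X n) f x) \<le> \<bar>f x\<bar>" for n
      by (simp add: trunc_def indicator_def)
  qed (use f trunc_integrable[OF f] in \<open>auto simp: square_integrable_def\<close>)
qed

lemma square_integrable_fourier_trunc:
  "square_integrable f \<Longrightarrow> square_integrable (fourier_integral (trunc R f))"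
  by (intro bessel trunc_integrable)

lemma L2_fourier_iff_nn:
  assumes f: "square_integrable f" and F: "square_integrable F"
  shows "L2_fourier f F \<longleftrightarrow>
    ((\<lambda>R. \<integral>\<^sup>+ p. ennreal ((norm (F p - fourier_integral (trunc R f) p))\<^sup>2) \<partial>lebesgue) \<longlongrightarrow> 0) at_top"
    (is "_ \<longleftrightarrow> ?R")
proof -
  let ?a = "\<lambda>R. l2 (\<lambda>p. F p - fourier_integral (trunc R f) p)"
  have "(\<integral>\<^sup>+ p. ennreal ((norm (F p - fourier_integral (trunc R f) p))\<^sup>2) \<partial>lebesgue) = ennreal ((?a R)\<^sup>2)" for R
    by (intro nn_integral_eq_l2 square_integrable_diff F square_integrable_fourier_trunc f)
  then have "?R \<longleftrightarrow> ((\<lambda>R. ennreal ((?a R)\<^sup>2)) \<longlongrightarrow> ennreal 0) at_top" by simp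
  also have "\<dots> \<longleftrightarrow> ((\<lambda>R. (?a R)\<^sup>2) \<longlongrightarrow> 0) at_top"
    by (rule tendsto_ennreal_iff) auto
  also have "\<dots> \<longleftrightarrow> (?a \<longlongrightarrow> 0) at_top"
  proof
    assume "((\<lambda>R. (?a R)\<^sup>2) \<longlongrightarrow> 0) at_top"
    from tendsto_real_sqrt[OF this] show "(?a \<longlongrightarrow> 0) at_top" by simp
  next
    assume "(?a \<longlongrightarrow> 0) at_top"
    from tendsto_power[OF this, of 2] show "((\<lambda>R. (?a R)\<^sup>2) \<longlongrightarrow> 0) at_top" by simp
  qed
  finally show ?thesis using f F by (simp add: L2_fourier_def)
qed

lemma is_fourier_iff:
  "is_fourier f F \<longleftrightarrow> integrable lebesgue f \<and> (AE p in lebesgue. F p = fourier_integral f p) \<or> L2_fourier f F"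
proof (cases "square_integrable f \<and> square_integrable F")
  case True
  then show ?thesis
    unfolding is_fourier_def trunc_def[symmetric] by (simp add: L2_fourier_iff_nn)
next
  case False
  then show ?thesis by (auto simp: is_fourier_def L2_fourier_def)
qed

text \<open>Truncations lie in L^1 and L^2 and satisfy Plancherel; as the radius grows they converge
  to \<open>f\<close>, and their transforms to \<open>F\<close>, so the norms agree in the
  limit.\<close>

lemma L2_fourier_norm:
  assumes "L2_fourier f F" shows "l2 F = l2 f"
proof -
  have f: "square_integrable f" and F: "square_integrable F" 
    and lim: "((\<lambda>R. l2 (\<lambda>p. F p - fourier_integral (trunc R f) p)) \<longlongrightarrow> 0) at_top"
    using assms by (auto simp: L2_fourier_def)
  note T = square_integrable_fourier_trunc[OF f]
  have pl: "l2 (fourier_integral (trunc R f)) = l2 (trunc R f)" for R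
    by (intro plancherel trunc_integrable f)
  have 1: "l2 F \<le> l2 (\<lambda>p. F p - fourier_integral (trunc R f) p) + l2 f" for R
  proof -
    have "l2 F = l2 (\<lambda>p. (F p - fourier_integral (trunc R f) p) + fourier_integral (trunc R f) p)" by simp
    also have "\<dots> \<le> l2 (\<lambda>p. F p - fourier_integral (trunc R f) p) + l2 (fourier_integral (trunc R f))"
      by (intro square_integrable_add square_integrable_diff F T)
    finally show ?thesis using pl[of R] trunc_integrable(3)[OF f, of R] by simp
  qed
  have 2: "l2 f \<le> l2 (\<lambda>x. f x - trunc R f x) + (l2 (\<lambda>p. F p - fourier_integral (trunc R f) p) + l2 F)" for R
  proof -
    have "l2 f = l2 (\<lambda>x. (f x - trunc R f x) + trunc R f x)" by simp
    also have "\<dots> \<le> l2 (\<lambda>x. f x - trunc R f x) + l2 (trunc R f)"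
      by (intro square_integrable_add square_integrable_diff f trunc_integrable)
    also have "l2 (trunc R f) = l2 (\<lambda>p. F p - (F p - fourier_integral (trunc R f) p))"
      by (simp add: pl)
    also have "\<dots> \<le> l2 F + l2 (\<lambda>p. F p - fourier_integral (trunc R f) p)"
      by (intro square_integrable_diff F T)
    finally show ?thesis by simp
  qed
  have "((\<lambda>R. l2 (\<lambda>p. F p - fourier_integral (trunc R f) p) + l2 f) \<longlongrightarrow> 0 + l2 f) at_top"
    by (intro tendsto_intros lim)
  then have "l2 F \<le> 0 + l2 f"
    by (rule tendsto_lowerbound) (use 1 in auto)
  moreover have "((\<lambda>R. l2 (\<lambda>x. f x - trunc R f x) + (l2 (\<lambda>p. F p - fourier_integral (trunc R f) p) + l2 F))
      \<longlongrightarrow> 0 + (0 + l2 F)) at_top"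
    by (intro tendsto_intros lim trunc_tendsto f)
  then have "l2 f \<le> 0 + (0 + l2 F)"
    by (rule tendsto_lowerbound) (use 2 in auto)
  ultimately show ?thesis by simp
qed

lemma fourier_integral_scale:
  "fourier_integral (\<lambda>x. c * f x) p = of_real c * fourier_integral f p"
  unfolding fourier_integral_def by (simp add: mult.assoc)

text \<open>The coefficient \<open>c\<close> lets a single limit argument serve for differences
  (\<open>c\<close> = 1) and sums (\<open>c\<close> = -1).\<close>

lemma L2_fourier_lin:
  assumes f: "L2_fourier f F" and g: "L2_fourier g G"
  shows "L2_fourier (\<lambda>x. f x - c * g x) (\<lambda>p. F p - of_real c * G p)"
proof -
  have f': "square_integrable f" "square_integrable F" and g': "square_integrable g" "square_integrable G"
    and lim: "((\<lambda>R. l2 (\<lambda>p. F p - fourier_integral (trunc R f) p)) \<longlongrightarrow> 0) at_top"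
    "((\<lambda>R. l2 (\<lambda>p. G p - fourier_integral (trunc R g) p)) \<longlongrightarrow> 0) at_top"
    using assms by (auto simp: L2_fourier_def)
  have cg: "square_integrable (\<lambda>x. c * g x)" "square_integrable (\<lambda>p. of_real c * G p)"
    using g'[THEN square_integrable_scaleR(1), of c] by (simp_all add: scaleR_conv_of_real)
  have ft: "fourier_integral (trunc R (\<lambda>x. f x - c * g x)) p =
     fourier_integral (trunc R f) p - of_real c * fourier_integral (trunc R g) p" for R p
  proof -
    have "trunc R (\<lambda>x. f x - c * g x) = (\<lambda>x. trunc R f x - c * trunc R g x)"
      by (auto simp: trunc_def algebra_simps)
    then show ?thesis
      using fourier_integral_diff[of "trunc R f" "\<lambda>x. c * trunc R g x" p] trunc_integrable f' g'
      by (simp add: fourier_integral_scale)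
  qed
  let ?a = "\<lambda>R. l2 (\<lambda>p. (F p - of_real c * G p) - fourier_integral (trunc R (\<lambda>x. f x - c * g x)) p)"
  have bound: "?a R \<le> l2 (\<lambda>p. F p - fourier_integral (trunc R f) p) + \<bar>c\<bar> * l2 (\<lambda>p. G p - fourier_integral (trunc R g) p)" for R
  proof -
    note d = square_integrable_diff(1)[OF f'(2) square_integrable_fourier_trunc[OF f'(1)]]
       square_integrable_diff(1)[OF g'(2) square_integrable_fourier_trunc[OF g'(1)]]
    have "?a R = l2 (\<lambda>p. (F p - fourier_integral (trunc R f) p) - c *\<^sub>R (G p - fourier_integral (trunc R g) p))"
      unfolding ft by (simp add: algebra_simps scaleR_conv_of_real)
    also have "\<dots> \<le> l2 (\<lambda>p. F p - fourier_integral (trunc R f) p) + l2 (\<lambda>p. c *\<^sub>R (G p - fourier_integral (trunc R g) p))"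
      by (intro square_integrable_diff(2) d square_integrable_scaleR)
    finally show ?thesis using square_integrable_scaleR(2)[OF d(2), of c] by simp
  qed
  have "(?a \<longlongrightarrow> 0) at_top"
  proof (rule tendsto_sandwich[OF _ _ tendsto_const])
    show "((\<lambda>R. l2 (\<lambda>p. F p - fourier_integral (trunc R f) p) + \<bar>c\<bar> * l2 (\<lambda>p. G p - fourier_integral (trunc R g) p)) \<longlongrightarrow> 0) at_top"
      using tendsto_add[OF lim(1) tendsto_mult[OF tendsto_const[of "\<bar>c\<bar>"] lim(2)]] by simp
  qed (use bound in auto)
  then show ?thesis
    unfolding L2_fourier_def using square_integrable_diff(1)[OF f'(1) cg(1)] square_integrable_diff(1)[OF f'(2) cg(2)]
    by simp
qed

lemma L2_fourier_diff:
  "L2_fourier f F \<Longrightarrow> L2_fourier g G \<Longrightarrow> L2_fourier (\<lambda>x. f x - g x) (\<lambda>p. F p - G p)"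
  using L2_fourier_lin[of f F g G 1] by simp

lemma L2_fourier_add:
  "L2_fourier f F \<Longrightarrow> L2_fourier g G \<Longrightarrow> L2_fourier (\<lambda>x. f x + g x) (\<lambda>p. F p + G p)"
  using L2_fourier_lin[of f F g G "-1"] by simp

text \<open>The two clauses of \<open>is_fourier\<close> are compatible: by the Bessel inequality
  the transforms of the truncations approach the Fourier integral at least as fast as the
  truncations approach \<open>f\<close>.\<close>

lemma L2_fourier_integrable:
  assumes f: "integrable lebesgue f" "square_integrable f"
  shows "L2_fourier f (fourier_integral f)"
proof -
  have "l2 (\<lambda>p. fourier_integral f p - fourier_integral (trunc R f) p) \<le> l2 (\<lambda>x. f x - trunc R f x)" for R
  proof -
    note t = trunc_integrable[OF f(2), of R]
    have "l2 (\<lambda>p. fourier_integral f p - fourier_integral (trunc R f) p) = l2 (fourier_integral (\<lambda>x. f x - trunc R f x))"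
      by (intro arg_cong[where f=l2] ext fourier_integral_diff[OF f(1) t(1), symmetric])
    also have "\<dots> \<le> l2 (\<lambda>x. f x - trunc R f x)"
      using f t by (intro bessel(2) square_integrable_diff) auto
    finally show ?thesis .
  qed
  then have "((\<lambda>R. l2 (\<lambda>p. fourier_integral f p - fourier_integral (trunc R f) p)) \<longlongrightarrow> 0) at_top"
    by (intro tendsto_sandwich[OF _ _ tendsto_const trunc_tendsto[OF f(2)]]) auto
  then show ?thesis unfolding L2_fourier_def using f bessel[OF f] by simp
qed

text \<open>By linearity the difference of two transforms of \<open>f\<close> is a transform of 0,
  and the isometry makes its norm vanish.\<close>

lemma L2_fourier_unique:
  assumes "L2_fourier f F" "L2_fourier f G"
  shows "AE p in lebesgue. F p = G p"
proof -
  have *: "L2_fourier (\<lambda>x. f x - f x) (\<lambda>p. F p - G p)" using assms by (rule L2_fourier_diff)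
  from L2_fourier_norm[OF this] have "l2 (\<lambda>p. F p - G p) = 0" by (simp add: l2_def)
  then have "AE p in lebesgue. F p - G p = 0" 
    using * by (intro l2_eq_0_AE) (auto simp: L2_fourier_def)
  then show ?thesis by eventually_elim simp
qed

lemma L2_fourier_cong_AE:
  assumes F: "L2_fourier f F" and fg: "AE x in lebesgue. f x = g x" and FG: "AE p in lebesgue. F p = G p"
  shows "L2_fourier g G"
proof -
  have f: "square_integrable f" "square_integrable F" using F by (auto simp: L2_fourier_def)
  note fm = f[THEN square_integrable_measurable]
  note gm = lebesgue_measurable_cong_AE[OF fm(1) fg] and Gm = lebesgue_measurable_cong_AE[OF fm(2) FG]
  have g: "square_integrable g" "square_integrable G"
    using square_integrable_cong_AE fg FG f gm Gm by blast+
  have ft: "fourier_integral (trunc R f) = fourier_integral (trunc R g)" for R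
    by (rule fourier_integral_cong_AE)
      (use fg trunc_integrable f g in \<open>auto simp: trunc_def square_integrable_def\<close>)
  have "l2 (\<lambda>p. F p - fourier_integral (trunc R f) p) = l2 (\<lambda>p. G p - fourier_integral (trunc R g) p)" for R
    unfolding ft
  proof (rule l2_cong_AE)
    show "AE p in lebesgue. norm (F p - fourier_integral (trunc R g) p) = norm (G p - fourier_integral (trunc R g) p)"
      using FG by eventually_elim simp
  qed (intro square_integrable_measurable square_integrable_diff f g square_integrable_fourier_trunc)+
  then show ?thesis using F g by (simp add: L2_fourier_def)
qed

text \<open>Removes the case distinction in \<open>is_fourier\<close>: if the first clause is the
  one that holds, then \<open>f\<close> lies in L^1 and L^2, where both clauses give the same
  transform.\<close>

lemma is_fourier_L2:
  assumes "is_fourier f F" "square_integrable f" shows "L2_fourier f F"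
  using assms(1) unfolding is_fourier_iff
proof
  assume "integrable lebesgue f \<and> (AE p in lebesgue. F p = fourier_integral f p)"
  then show ?thesis
    by (intro L2_fourier_cong_AE[OF L2_fourier_integrable[OF _ assms(2)]]) (auto elim: AE_mp)
qed

lemma is_fourier_L1:
  assumes F: "is_fourier f F" and f: "integrable lebesgue f"
  shows "AE p in lebesgue. F p = fourier_integral f p"
  using F unfolding is_fourier_iff
proof
  assume F: "L2_fourier f F"
  then show ?thesis
    by (intro L2_fourier_unique[OF F] L2_fourier_integrable f) (simp add: L2_fourier_def)
qed simp

section \<open>Fractional Laplacians on the Fourier side\<close>

lemma norm_powr_measurable [measurable]:
  "(\<lambda>p::real^3. complex_of_real (norm p powr a)) \<in> borel_measurable lebesgue"
  by (rule borel_measurable_lebesgueI) measurable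

text \<open>The definition only asserts that some transform is multiplied by the symbol; uniqueness
  allows it to be replaced by the given one, so several fractional Laplacians of one function can be
  compared through the same \<open>F\<close>.\<close>

lemma is_frac_laplacian_L2_fourier:
  assumes \<phi>: "L2_fourier \<phi> F" and \<psi>: "is_frac_laplacian s \<phi> \<psi>"
  shows "L2_fourier \<psi> (\<lambda>p. of_real (norm p powr (2 * s)) * F p)"
proof -
  obtain F' G where *: "square_integrable \<psi>" "is_fourier \<phi> F'" "is_fourier \<psi> G"
    "AE p in lebesgue. G p = of_real (norm p powr (2 * s)) * F' p"
    using \<psi> by (auto simp: is_frac_laplacian_def)
  have "L2_fourier \<phi> F'" using \<phi> *(2) by (intro is_fourier_L2) (auto simp: L2_fourier_def)
  then have "AE p in lebesgue. F' p = F p" using \<phi> by (intro L2_fourier_unique)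
  with *(4) have "AE p in lebesgue. G p = of_real (norm p powr (2 * s)) * F p"
    by eventually_elim simp
  then show ?thesis by (rule L2_fourier_cong_AE[OF is_fourier_L2[OF *(3,1)], rotated]) simp
qed

text \<open>The counterpart for the kernels of the system, which are assumed integrable but not
  square integrable: the symbol acts on the Fourier integral.\<close>

lemma is_frac_laplacian_L1:
  assumes \<phi>: "integrable lebesgue \<phi>" and \<psi>: "is_frac_laplacian s \<phi> \<psi>"
  shows "L2_fourier \<psi> (\<lambda>p. of_real (norm p powr (2 * s)) * fourier_integral \<phi> p)"
proof -
  obtain F' G where *: "square_integrable \<psi>" "is_fourier \<phi> F'" "is_fourier \<psi> G"
    "AE p in lebesgue. G p = of_real (norm p powr (2 * s)) * F' p"
    using \<psi> by (auto simp: is_frac_laplacian_def)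
  have "AE p in lebesgue. G p = of_real (norm p powr (2 * s)) * fourier_integral \<phi> p"
    using *(4) is_fourier_L1[OF *(2) \<phi>] by eventually_elim simp
  then show ?thesis by (rule L2_fourier_cong_AE[OF is_fourier_L2[OF *(3,1)], rotated]) simp
qed

lemma is_frac_laplacianI:
  assumes "L2_fourier \<phi> F" "L2_fourier \<psi> (\<lambda>p. of_real (norm p powr (2 * s)) * F p)"
  shows "is_frac_laplacian s \<phi> \<psi>"
  unfolding is_frac_laplacian_def is_fourier_iff
proof (intro conjI exI)
  show "square_integrable \<psi>" using assms(2) by (simp add: L2_fourier_def)
qed (use assms in auto)

lemma frac_laplacian_spec:
  "frac_laplacian_L2 s \<phi> \<Longrightarrow> is_frac_laplacian s \<phi> (frac_laplacian s \<phi>)"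
  unfolding frac_laplacian_L2_def frac_laplacian_def by (erule someI_ex)

lemma sobolev_space_fourier:
  assumes "\<phi> \<in> sobolev_space s"
  obtains F where "L2_fourier \<phi> F"
    "L2_fourier (frac_laplacian s \<phi>) (\<lambda>p. of_real (norm p powr (2 * s)) * F p)"
proof -
  have *: "square_integrable \<phi>" "is_frac_laplacian s \<phi> (frac_laplacian s \<phi>)"
    using assms frac_laplacian_spec by (auto simp: sobolev_space_def)
  then obtain F where "is_fourier \<phi> F" by (auto simp: is_frac_laplacian_def)
  from that[OF is_fourier_L2[OF this *(1)]] is_frac_laplacian_L2_fourier[OF is_fourier_L2[OF this *(1)] *(2)]
  show ?thesis by auto
qed

lemma sobolev_space_diff:
  assumes f: "f \<in> sobolev_space s" and g: "g \<in> sobolev_space s"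
  shows "(\<lambda>x. f x - g x) \<in> sobolev_space s"
proof -
  obtain F where F: "L2_fourier f F" "L2_fourier (frac_laplacian s f) (\<lambda>p. of_real (norm p powr (2 * s)) * F p)"
    using sobolev_space_fourier[OF f] .
  obtain G where G: "L2_fourier g G" "L2_fourier (frac_laplacian s g) (\<lambda>p. of_real (norm p powr (2 * s)) * G p)"
    using sobolev_space_fourier[OF g] .
  have "is_frac_laplacian s (\<lambda>x. f x - g x) (\<lambda>x. frac_laplacian s f x - frac_laplacian s g x)"
    by (rule is_frac_laplacianI[OF L2_fourier_diff[OF F(1) G(1)]])
      (use L2_fourier_diff[OF F(2) G(2)] in \<open>simp add: algebra_simps\<close>)
  moreover have "square_integrable (\<lambda>x. f x - g x)"
    using L2_fourier_diff[OF F(1) G(1)] by (simp add: L2_fourier_def)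
  ultimately show ?thesis by (auto simp: sobolev_space_def frac_laplacian_L2_def)
qed

section \<open>Frequency splitting and the optimal cut-off radius\<close>

lemma powr_mult_cube: "0 < x \<Longrightarrow> a + 3 = b \<Longrightarrow> x powr a * x ^ 3 = x powr b" for x :: real
  using powr_add[of x a 3] by simp

lemma nn_integral_indicator_add:
  assumes "A \<in> sets borel" and [measurable]: "J \<in> borel_measurable borel"
  shows "(\<integral>\<^sup>+p. c * indicator A p + J p \<partial>lborel) = c * emeasure lborel A + (\<integral>\<^sup>+p. J p \<partial>lborel)"
proof -
  have [measurable]: "A \<in> sets borel" by fact
  have "(\<integral>\<^sup>+p. c * indicator A p + J p \<partial>lborel) = (\<integral>\<^sup>+p. c * indicator A p \<partial>lborel) + (\<integral>\<^sup>+p. J p \<partial>lborel)"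
    by (rule nn_integral_add) measurable
  then show ?thesis by (simp add: nn_integral_cmult_indicator)
qed

text \<open>Layer-cake: \<open>\<bar>p\<bar>\<^sup>-\<^sup>\<alpha> = R\<^sup>-\<^sup>\<alpha> + \<integral> \<alpha> r\<^sup>-\<^sup>\<alpha>\<^sup>-\<^sup>1 dr\<close> over \<open>\<bar>p\<bar> \<le> r \<le> R\<close>,
  so only the volume of balls is needed, no polar coordinates.\<close>

lemma nn_integral_norm_powr_cball:
  fixes \<alpha> R :: real
  assumes \<alpha>: "0 < \<alpha>" "\<alpha> < 3" and R: "0 < R"
  shows "(\<integral>\<^sup>+p. ennreal (indicator (cball (0::real^3) R) p * norm p powr (- \<alpha>)) \<partial>lebesgue)
     = ennreal (4 * pi * R powr (3 - \<alpha>) / (3 - \<alpha>))"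
proof -
  define w where "w r = \<alpha> * r powr (- \<alpha> - 1)" for r
  have w0: "0 \<le> w r" for r unfolding w_def using \<alpha> by simp
  have [measurable]: "w \<in> borel_measurable borel" unfolding w_def by measurable
  have V: "emeasure lborel (cball (0::real^3) r) = ennreal (4 / 3 * pi * r ^ 3)" if "0 \<le> r" for r
    using that by (simp add: emeasure_cball unit_ball_vol_3)
  have layer: "ennreal (indicator (cball 0 R) p * norm p powr (- \<alpha>)) =
      ennreal (R powr (- \<alpha>)) * indicator (cball 0 R) p
      + (\<integral>\<^sup>+r. ennreal (w r) * indicator {(p, r). norm p \<le> r \<and> r \<le> R} (p, r) \<partial>lborel)"
    if "p \<noteq> 0" for p :: "real^3"
  proof (cases "norm p \<le> R")
    case True
    have "(\<integral>\<^sup>+r. ennreal (w r) * indicator {norm p..R} r \<partial>lborel) = ennreal (- (R powr - \<alpha>) - - (norm p powr - \<alpha>))"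
    proof (rule nn_integral_FTC_Icc[where F="\<lambda>r. - (r powr (- \<alpha>))"])
      fix r assume "r \<in> {norm p..R}"
      then have "norm p \<le> r" by simp
      then have "0 < r" using that by (meson less_le_trans zero_less_norm_iff)
      then show "((\<lambda>r. - (r powr (- \<alpha>))) has_real_derivative w r) (at r)"
        unfolding w_def by (auto intro!: derivative_eq_intros simp: powr_diff)
    qed (use True w0 in auto)
    also have "(\<lambda>r. ennreal (w r) * indicator {norm p..R} r) = (\<lambda>r. ennreal (w r) * indicator {(p, r). norm p \<le> r \<and> r \<le> R} (p, r))"
      by (auto simp: indicator_def)
    finally have e: "(\<integral>\<^sup>+r. ennreal (w r) * indicator {(p, r). norm p \<le> r \<and> r \<le> R} (p, r) \<partial>lborel)
       = ennreal (norm p powr - \<alpha> - R powr - \<alpha>)" by simp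
    have "R powr - \<alpha> \<le> norm p powr - \<alpha>"
      using \<alpha> True that by (intro powr_mono2') auto
    then show ?thesis
      unfolding e using True by (simp add: ennreal_plus[symmetric] del: ennreal_plus)
  next
    case False
    then have "(\<lambda>r. indicator {(p, r). norm p \<le> r \<and> r \<le> R} (p, r) :: ennreal) = (\<lambda>_. 0)"
      by (auto simp: indicator_def)
    then show ?thesis using False by simp
  qed
  have m: "(\<lambda>(p, r). ennreal (w r) * indicator {(p::real^3, r). norm p \<le> r \<and> r \<le> R} (p, r)) \<in> borel_measurable (lborel \<Otimes>\<^sub>M lborel)"
    by measurable
  have "(\<integral>\<^sup>+p. (\<integral>\<^sup>+r. ennreal (w r) * indicator {(p::real^3, r). norm p \<le> r \<and> r \<le> R} (p, r) \<partial>lborel) \<partial>lborel)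
     = (\<integral>\<^sup>+r. (\<integral>\<^sup>+p. ennreal (w r) * indicator {(p::real^3, r). norm p \<le> r \<and> r \<le> R} (p, r) \<partial>lborel) \<partial>lborel)"
    using lborel_pair.Fubini'[OF m] by simp
  also have "\<dots> = (\<integral>\<^sup>+r. ennreal (4 / 3 * pi * \<alpha> * (if r \<in> {0..R} then r powr (2 - \<alpha>) else 0)) \<partial>lborel)"
  proof (intro nn_integral_cong)
    fix r :: real
    show "(\<integral>\<^sup>+p. ennreal (w r) * indicator {(p::real^3, r). norm p \<le> r \<and> r \<le> R} (p, r) \<partial>lborel)
      = ennreal (4 / 3 * pi * \<alpha> * (if r \<in> {0..R} then r powr (2 - \<alpha>) else 0))"
    proof (cases "r \<in> {0..R}")
      case True
      then have "indicator {(p::real^3, r). norm p \<le> r \<and> r \<le> R} (p, r) = (indicator (cball 0 r) p :: ennreal)" for p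
        by (auto simp: indicator_def)
      then have "(\<integral>\<^sup>+p. ennreal (w r) * indicator {(p::real^3, r). norm p \<le> r \<and> r \<le> R} (p, r) \<partial>lborel)
         = ennreal (w r) * ennreal (4 / 3 * pi * r ^ 3)"
        using V[of r] True by (simp add: nn_integral_cmult_indicator)
      also have "\<dots> = ennreal (w r * (4 / 3 * pi * r ^ 3))"
        using w0 True by (intro ennreal_mult[symmetric]) auto
      also have "w r * (4 / 3 * pi * r ^ 3) = 4 / 3 * pi * \<alpha> * r powr (2 - \<alpha>)"
      proof (cases "r = 0")
        case False
        then have "r powr (- \<alpha> - 1) * r ^ 3 = r powr (2 - \<alpha>)"
          using True by (intro powr_mult_cube) auto
        then show ?thesis by (simp add: w_def mult_ac)
      qed (simp add: w_def)
      finally show ?thesis using True by simp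
    next
      case False
      then have "indicator {(p::real^3, r). norm p \<le> r \<and> r \<le> R} (p, r) = (0 :: ennreal)" for p
        by (auto simp: indicator_def intro: order_trans[OF norm_ge_zero])
      then show ?thesis using False by auto
    qed
  qed
  also have "\<dots> = ennreal (4 / 3 * pi * \<alpha> * (R powr (2 - \<alpha> + 1) / (2 - \<alpha> + 1)))"
  proof (rule nn_integral_has_integral_lborel)
    show "(\<lambda>r. 4 / 3 * pi * \<alpha> * (if r \<in> {0..R} then r powr (2 - \<alpha>) else 0)) \<in> borel_measurable borel"
      by measurable
    show "0 \<le> 4 / 3 * pi * \<alpha> * (if r \<in> {0..R} then r powr (2 - \<alpha>) else 0)" for r
      using \<alpha> by simp
    show "((\<lambda>r. 4 / 3 * pi * \<alpha> * (if r \<in> {0..R} then r powr (2 - \<alpha>) else 0)) has_integral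
       4 / 3 * pi * \<alpha> * (R powr (2 - \<alpha> + 1) / (2 - \<alpha> + 1))) UNIV"
      by (intro has_integral_mult_right)
        (subst has_integral_restrict_UNIV, intro has_integral_powr_from_0, use \<alpha> R in auto)
  qed
  finally have I: "(\<integral>\<^sup>+p. (\<integral>\<^sup>+r. ennreal (w r) * indicator {(p::real^3, r). norm p \<le> r \<and> r \<le> R} (p, r) \<partial>lborel) \<partial>lborel)
     = ennreal (4 / 3 * pi * \<alpha> * (R powr (3 - \<alpha>) / (3 - \<alpha>)))" by simp
  have mi: "(\<lambda>p. \<integral>\<^sup>+r. ennreal (w r) * indicator {(p::real^3, r). norm p \<le> r \<and> r \<le> R} (p, r) \<partial>lborel) \<in> borel_measurable borel"
    using lborel.borel_measurable_nn_integral_fst[OF m] by simp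
  \<comment> \<open>At the origin \<open>0 powr (- \<alpha>)\<close> is 0 whereas the layer integral
    diverges, so this null point has to be set aside.\<close>
  have ne: "AE p in lborel. p \<noteq> (0::real^3)" by (rule AE_lborel_singleton)
  have "(\<integral>\<^sup>+p. ennreal (indicator (cball (0::real^3) R) p * norm p powr (- \<alpha>)) \<partial>lborel)
    = (\<integral>\<^sup>+p. ennreal (R powr (- \<alpha>)) * indicator (cball (0::real^3) R) p
      + (\<integral>\<^sup>+r. ennreal (w r) * indicator {(p, r). norm p \<le> r \<and> r \<le> R} (p, r) \<partial>lborel) \<partial>lborel)"
    by (rule nn_integral_cong_AE) (use ne in eventually_elim, rule layer)
  also have "\<dots> = ennreal (R powr (- \<alpha>)) * ennreal (4 / 3 * pi * R ^ 3)
       + ennreal (4 / 3 * pi * \<alpha> * (R powr (3 - \<alpha>) / (3 - \<alpha>)))"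
    unfolding I[symmetric] using R V[of R]
    by (subst nn_integral_indicator_add[OF _ mi]) simp_all
  also have "\<dots> = ennreal (R powr (- \<alpha>) * (4 / 3 * pi * R ^ 3) + 4 / 3 * pi * \<alpha> * (R powr (3 - \<alpha>) / (3 - \<alpha>)))"
  proof -
    have "ennreal a * ennreal b + ennreal c = ennreal (a * b + c)" if "0 \<le> a" "0 \<le> b" "0 \<le> c" for a b c
      using that by (simp add: ennreal_mult)
    note cmb = this
    show ?thesis by (rule cmb) (use \<alpha> R in auto)
  qed
  also have "R powr (- \<alpha>) * (4 / 3 * pi * R ^ 3) + 4 / 3 * pi * \<alpha> * (R powr (3 - \<alpha>) / (3 - \<alpha>))
     = 4 * pi * R powr (3 - \<alpha>) / (3 - \<alpha>)"
  proof -
    have "R powr (- \<alpha>) * R ^ 3 = R powr (3 - \<alpha>)"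
      using R by (intro powr_mult_cube) auto
    then have split: "R powr (- \<alpha>) * (4 / 3 * pi * R ^ 3) = 4 / 3 * pi * R powr (3 - \<alpha>)" by simp
    have alg: "4 / 3 * pi * X + 4 / 3 * pi * \<alpha> * (X / (3 - \<alpha>)) = 4 * pi * X / (3 - \<alpha>)" for X
      using \<alpha> by (simp add: field_simps)
    show ?thesis unfolding split by (rule alg)
  qed
  finally show ?thesis by (simp add: nn_integral_completion)
qed

text \<open>The minimum over R > 0 of D^2 R^(3 - 4 s) / (2 pi^2 (3 - 4 s)) + R^(-4 s), the sum of
  the low and high frequency contributions per unit of h^2 B^2.\<close>

definition kappa :: "real \<Rightarrow> real \<Rightarrow> real" where
  "kappa s D = 3 * D powr (8 * s / 3) / ((3 - 4 * s) * (4 * s) powr (4 * s / 3) * (2 * pi\<^sup>2) powr (4 * s / 3))"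

text \<open>The bound is the minimum over the cut-off radius \<open>R\<close>, attained at \<open>R\<^sup>3 = 8 \<pi>\<^sup>2 s / D\<^sup>2\<close>.\<close>

lemma low_high_frequency_bound:
  fixes W G :: "real^3 \<Rightarrow> complex"
  assumes W: "square_integrable W" and G: "square_integrable G"
    and le: "AE p in lebesgue. norm p powr (2 * s) * norm (W p) \<le> h * norm (G p)"
    and sup: "\<And>p. norm (G p) \<le> D * B / c3" and l2: "l2 G \<le> B"
    and s: "1/4 < s" "s < 3/4" and D: "0 < D" and h: "0 \<le> h"
  shows "(l2 W)\<^sup>2 \<le> h\<^sup>2 * B\<^sup>2 * kappa s D"
proof -
  have B: "0 \<le> B" using order_trans[OF l2_nonneg l2] .
  define R where "R = (8 * pi\<^sup>2 * s / D\<^sup>2) powr (1/3)"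
  have R: "0 < R" unfolding R_def using s D by simp
  have R3: "R ^ 3 = 8 * pi\<^sup>2 * s / D\<^sup>2"
  proof -
    have "R ^ 3 = R powr 3" using R by simp
    also have "\<dots> = 8 * pi\<^sup>2 * s / D\<^sup>2"
      unfolding R_def powr_powr using s D by simp
    finally show ?thesis .
  qed
  have [measurable]: "G \<in> borel_measurable lebesgue" using G by (rule square_integrable_measurable)
  have "(\<lambda>p::real^3. norm p powr a) \<in> borel_measurable borel" for a by measurable
  then have pm: "(\<lambda>p::real^3. indicator (cball 0 R) p * norm p powr (- 4 * s)) \<in> borel_measurable lebesgue"
    by (intro borel_measurable_lebesgueI borel_measurable_times borel_measurable_indicator) auto
  let ?a = "h\<^sup>2 * (D * B / c3)\<^sup>2" and ?b = "h\<^sup>2 * R powr (- 4 * s)"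
  \<comment> \<open>Since \<open>0 powr (2 * s)\<close> is 0, the hypothesis \<open>le\<close> says
    nothing about \<open>W\<close> at the origin.\<close>
  have "AE p in lebesgue. p \<noteq> (0::real^3)" by (intro AE_completion AE_lborel_singleton)
  with le have ae: "AE p in lebesgue. (norm (W p))\<^sup>2 \<le>
     ?a * (indicator (cball 0 R) p * norm p powr (- 4 * s)) + ?b * (norm (G p))\<^sup>2"
  proof eventually_elim
    case (elim p)
    then have n: "0 < norm p" by simp
    have "norm (W p) \<le> h * norm (G p) * norm p powr (- 2 * s)"
      using elim n by (simp add: powr_minus field_simps)
    then have "(norm (W p))\<^sup>2 \<le> (h * norm (G p) * norm p powr (- 2 * s))\<^sup>2"
      by (rule power_mono) simp
    also have "\<dots> = h\<^sup>2 * (norm (G p))\<^sup>2 * norm p powr (- 4 * s)"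
    proof -
      have "(norm p powr (- 2 * s))\<^sup>2 = norm p powr (- 4 * s)"
        unfolding power2_eq_square powr_add[symmetric] by simp
      then show ?thesis by (simp only: power_mult_distrib)
    qed
    finally have 1: "(norm (W p))\<^sup>2 \<le> h\<^sup>2 * (norm (G p))\<^sup>2 * norm p powr (- 4 * s)" .
    show ?case
    proof (cases "norm p \<le> R")
      case True
      have "h\<^sup>2 * (norm (G p))\<^sup>2 * norm p powr (- 4 * s) \<le> ?a * norm p powr (- 4 * s)"
        using sup[of p] by (intro mult_right_mono mult_left_mono power_mono) auto
      then show ?thesis using 1 True by (simp add: add_increasing2)
    next
      case False
      have "h\<^sup>2 * (norm (G p))\<^sup>2 * norm p powr (- 4 * s) \<le> h\<^sup>2 * (norm (G p))\<^sup>2 * R powr (- 4 * s)"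
        using False R s by (intro mult_left_mono powr_mono2') auto
      then show ?thesis using 1 False by (simp add: mult_ac)
    qed
  qed
  have "ennreal ((l2 W)\<^sup>2) = (\<integral>\<^sup>+p. ennreal ((norm (W p))\<^sup>2) \<partial>lebesgue)"
    by (rule nn_integral_eq_l2[OF W, symmetric])
  also have "\<dots> \<le> (\<integral>\<^sup>+p. ennreal ?a * ennreal (indicator (cball 0 R) p * norm p powr (- 4 * s)) + ennreal ?b * ennreal ((norm (G p))\<^sup>2) \<partial>lebesgue)"
    by (rule nn_integral_mono_AE, use ae in eventually_elim)
      (simp add: ennreal_mult[symmetric] ennreal_plus[symmetric] ennreal_leI del: ennreal_plus)
  also have "\<dots> = ennreal ?a * ennreal (4 * pi * R powr (3 - 4 * s) / (3 - 4 * s)) + ennreal ?b * ennreal ((l2 G)\<^sup>2)"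
    using nn_integral_norm_powr_cball[of "4 * s" R] s R pm nn_integral_eq_l2[OF G]
    by (subst nn_integral_add) (auto simp: nn_integral_cmult)
  also have "\<dots> = ennreal (?a * (4 * pi * R powr (3 - 4 * s) / (3 - 4 * s)) + ?b * (l2 G)\<^sup>2)"
    using s R by (simp add: ennreal_mult[symmetric] ennreal_plus[symmetric] del: ennreal_plus)
  finally have "(l2 W)\<^sup>2 \<le> ?a * (4 * pi * R powr (3 - 4 * s) / (3 - 4 * s)) + ?b * (l2 G)\<^sup>2"
    by (rule ennreal_le_iff[THEN iffD1, rotated]) (use s R in \<open>auto intro!: add_nonneg_nonneg\<close>)
  also have "\<dots> \<le> ?a * (4 * pi * R powr (3 - 4 * s) / (3 - 4 * s)) + ?b * B\<^sup>2"
    using l2 by (intro add_left_mono mult_left_mono power_mono) auto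
  \<comment> \<open>With R^3 inserted, both contributions become multiples of R^(-4 s), with
    coefficients 4 s / (3 - 4 s) and 1; their sum is 3 / (3 - 4 s).\<close>
  also have "R powr (3 - 4 * s) = R powr (- 4 * s) * (8 * pi\<^sup>2 * s / D\<^sup>2)"
    unfolding R3[symmetric] using R by (intro powr_mult_cube[symmetric]) auto
  also have "?a * (4 * pi * (R powr (- 4 * s) * (8 * pi\<^sup>2 * s / D\<^sup>2)) / (3 - 4 * s)) + ?b * B\<^sup>2
      = h\<^sup>2 * B\<^sup>2 * (R powr (- 4 * s) * (3 / (3 - 4 * s)))"
  proof -
    have "(D * B / c3)\<^sup>2 = D\<^sup>2 * B\<^sup>2 / (8 * pi ^ 3)"
      by (simp add: power_divide power_mult_distrib c3_sq)
    then show ?thesis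
      unfolding \<open>(D * B / c3)\<^sup>2 = _\<close> using s D
      by (simp add: power2_eq_square power3_eq_cube field_simps)
  qed
  also have "R powr (- 4 * s) * (3 / (3 - 4 * s)) = kappa s D"
  proof -
    have "R powr (- 4 * s) = (4 * s * (2 * pi\<^sup>2) / D\<^sup>2) powr (- (4 * s / 3))"
      unfolding R_def by (simp add: powr_powr mult_ac)
    also have "\<dots> = D powr (8 * s / 3) / ((4 * s) powr (4 * s / 3) * (2 * pi\<^sup>2) powr (4 * s / 3))"
    proof -
      have "(D\<^sup>2) powr (4 * s / 3) = D powr (8 * s / 3)"
      proof -
        have "D\<^sup>2 = D powr 2" using D by simp
        then show ?thesis by (simp only: powr_powr) simp
      qed
      note D8 = this
      have quot: "(a * b / d) powr (- e) = d powr e / (a powr e * b powr e)"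
        if "0 < a" "0 < b" "0 < d" for a b d e :: real
        using that by (simp add: powr_divide powr_mult powr_minus field_simps)
      show ?thesis
        unfolding D8[symmetric] by (rule quot) (use s D in auto)
    qed
    finally show ?thesis by (simp add: kappa_def mult_ac)
  qed
  finally show ?thesis .
qed

text \<open>The bases \<open>4 * s\<close>, \<open>2 * pi\<^sup>2\<close> and \<open>D\<close> are
  all at least 1, so each power increases with its exponent. The numerator and
  \<open>3 - 4 * s\<close> are therefore estimated at the largest exponent, the remaining factors of
  the denominator at the least.\<close>

lemma kappa_mono:
  assumes "1/4 < s\<^sub>1" "s\<^sub>1 \<le> s" "s \<le> S\<^sub>1" "S\<^sub>1 < 3/4" "1 \<le> D"
  shows "kappa s D \<le> 3 * D powr (8 * S\<^sub>1 / 3) / ((3 - 4 * S\<^sub>1) * (4 * s\<^sub>1) powr (4 * s\<^sub>1 / 3) * (2 * pi\<^sup>2) powr (4 * s\<^sub>1 / 3))"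
  unfolding kappa_def
proof (rule frac_le)
  have "(4 * s\<^sub>1) powr (4 * s\<^sub>1 / 3) \<le> (4 * s) powr (4 * s\<^sub>1 / 3)"
    using assms by (intro powr_mono2) auto
  also have "\<dots> \<le> (4 * s) powr (4 * s / 3)" using assms by (intro powr_mono) auto
  finally have 1: "(4 * s\<^sub>1) powr (4 * s\<^sub>1 / 3) \<le> (4 * s) powr (4 * s / 3)" .
  have "1 \<le> pi\<^sup>2" using pi_gt3 by (simp add: one_le_power)
  then have 2: "(2 * pi\<^sup>2) powr (4 * s\<^sub>1 / 3) \<le> (2 * pi\<^sup>2) powr (4 * s / 3)"
    using assms by (intro powr_mono) auto
  show "(3 - 4 * S\<^sub>1) * (4 * s\<^sub>1) powr (4 * s\<^sub>1 / 3) * (2 * pi\<^sup>2) powr (4 * s\<^sub>1 / 3) \<le>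
    (3 - 4 * s) * (4 * s) powr (4 * s / 3) * (2 * pi\<^sup>2) powr (4 * s / 3)"
    using assms 1 2 by (intro mult_mono) auto
  show "0 < (3 - 4 * S\<^sub>1) * (4 * s\<^sub>1) powr (4 * s\<^sub>1 / 3) * (2 * pi\<^sup>2) powr (4 * s\<^sub>1 / 3)"
    using assms by (intro mult_pos_pos) auto
  show "3 * D powr (8 * s / 3) \<le> 3 * D powr (8 * S\<^sub>1 / 3)"
    using assms by (intro mult_left_mono powr_mono) auto
qed simp

subsection \<open>\<open>C\<^sup>2\<close> functions on a ball\<close>

lemma has_vector_derivative_segment:
  fixes h :: "'a::real_normed_vector \<Rightarrow> real"
  assumes S: "convex S" "w \<in> S" "z \<in> S" and t: "t \<in> {0..1}"
    and h: "(h has_derivative D) (at (w + t *\<^sub>R (z - w)) within S)"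
  shows "((\<lambda>t. h (w + t *\<^sub>R (z - w))) has_vector_derivative D (z - w)) (at t within {0..1})"
proof -
  have sub: "(\<lambda>t. w + t *\<^sub>R (z - w)) ` {0..1} \<subseteq> S"
  proof clarify
    fix u :: real assume "u \<in> {0..1}"
    then show "w + u *\<^sub>R (z - w) \<in> S"
      using convexD_alt[OF S, of u] by (simp add: algebra_simps)
  qed
  have p: "((\<lambda>t. w + t *\<^sub>R (z - w)) has_derivative (\<lambda>u. u *\<^sub>R (z - w))) (at t within {0..1})"
    by (auto intro!: derivative_eq_intros)
  have "((\<lambda>t. h (w + t *\<^sub>R (z - w))) has_derivative (\<lambda>u. D (u *\<^sub>R (z - w)))) (at t within {0..1})"
    by (rule has_derivative_in_compose[OF p has_derivative_subset[OF h sub]])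
  moreover have "D (u *\<^sub>R (z - w)) = u *\<^sub>R D (z - w)" for u
    using has_derivative_linear[OF h] by (rule linear_scale)
  ultimately show ?thesis unfolding has_vector_derivative_def by simp
qed

text \<open>At a boundary point the difference of two derivatives vanishes on \<open>w - z\<close> for all \<open>w\<close> in
  the ball, and these vectors span.\<close>

lemma has_derivative_unique_cball:
  fixes h :: "'a::real_normed_vector \<Rightarrow> real"
  assumes r: "0 < r" and z: "z \<in> cball 0 r"
    and D1: "(h has_derivative D1) (at z within cball 0 r)"
    and D2: "(h has_derivative D2) (at z within cball 0 r)"
  shows "D1 = D2"
proof
  fix v
  have l: "linear D1" "linear D2" using D1 D2 by (auto intro: has_derivative_linear)
  have e: "D1 (w - z) = D2 (w - z)" if "w \<in> cball 0 r" for w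
  proof -
    have "((\<lambda>t. h (z + t *\<^sub>R (w - z))) has_vector_derivative D (w - z)) (at 0 within cbox 0 1)"
      if "(h has_derivative D) (at z within cball 0 r)" for D
      using has_vector_derivative_segment[OF convex_cball z \<open>w \<in> _\<close>, of 0 h D] that by simp
    from vector_derivative_unique_within_closed_interval[OF _ _ this[OF D1] this[OF D2]]
    show ?thesis by simp
  qed
  have e': "D1 w = D2 w" if "w \<in> cball 0 r" for w
    using e[OF that] e[of 0] r by (simp add: linear_diff[OF l(1)] linear_diff[OF l(2)] linear_neg[OF l(1)] linear_neg[OF l(2)] linear_0[OF l(1)] linear_0[OF l(2)])
  show "D1 v = D2 v"
  proof (cases "v = 0")
    case False
    have "(r / norm v) *\<^sub>R v \<in> cball 0 r" using False r by simp
    from e'[OF this] False r show ?thesis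
      by (simp add: linear_scale[OF l(1)] linear_scale[OF l(2)])
  qed (simp add: linear_0[OF l(1)] linear_0[OF l(2)])
qed

context
  fixes r :: real and I :: "(real^'n::finite) set"
  assumes r: "0 < r" and I: "I = cball 0 r"
begin

lemma frechet_derivative_eq:
  assumes "z \<in> I" "(h has_derivative D) (at z within I)"
  shows "frechet_derivative h (at z within I) = (D :: _ \<Rightarrow> real)"
proof -
  have "(h has_derivative frechet_derivative h (at z within I)) (at z within I)"
    using assms frechet_derivative_works differentiable_def by blast
  then show ?thesis using assms has_derivative_unique_cball[OF r] unfolding I by blast
qed

lemma partial_deriv_eq:
  assumes "z \<in> I" "(h has_derivative D) (at z within I)"
  shows "partial_deriv I n h z = D (axis n 1)"
  by (simp add: partial_deriv_def frechet_derivative_eq[OF assms])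

lemma partial_deriv_works:
  assumes "h differentiable_on I" "z \<in> I"
  shows "(h has_derivative (\<lambda>v. \<Sum>n\<in>UNIV. v $ n * partial_deriv I n h z)) (at z within I)"
proof -
  let ?D = "frechet_derivative h (at z within I)"
  have D: "(h has_derivative ?D) (at z within I)"
    using assms frechet_derivative_works by (auto simp: differentiable_on_def)
  then have l: "linear ?D" by (rule has_derivative_linear)
  have "?D v = (\<Sum>n\<in>UNIV. v $ n * partial_deriv I n h z)" for v
  proof -
    have "v = (\<Sum>n\<in>UNIV. (v $ n) *\<^sub>R axis n 1)"
      by (simp add: vec_eq_iff axis_def if_distrib cong: if_cong)
    then have "?D v = ?D (\<Sum>n\<in>UNIV. (v $ n) *\<^sub>R axis n 1)" by simp
    also have "\<dots> = (\<Sum>n\<in>UNIV. (v $ n) * ?D (axis n 1))"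
      by (simp add: linear_sum[OF l] linear_scale[OF l])
    finally show ?thesis by (simp add: partial_deriv_def)
  qed
  then have "?D = (\<lambda>v. \<Sum>n\<in>UNIV. v $ n * partial_deriv I n h z)" by auto
  with D show ?thesis by simp
qed

text \<open>Derivatives within \<open>I\<close> see only values on \<open>I\<close>. This is what
  makes iterated partial derivatives tractable, as identities between first partial derivatives are
  known on \<open>I\<close> only.\<close>

lemma partial_deriv_cong:
  assumes "f differentiable_on I" "\<And>z. z \<in> I \<Longrightarrow> f z = g z" "z \<in> I"
  shows "partial_deriv I n f z = partial_deriv I n g z"
proof -
  obtain D where D: "(f has_derivative D) (at z within I)"
    using assms by (auto simp: differentiable_on_def differentiable_def)
  then have "(g has_derivative D) (at z within I)"
    by (rule has_derivative_transform[OF assms(3), rotated]) (use assms in auto)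
  then show ?thesis using partial_deriv_eq[OF assms(3) D] partial_deriv_eq[OF assms(3)] by simp
qed

lemma partial_deriv_diff:
  assumes "f differentiable_on I" "g differentiable_on I" "z \<in> I"
  shows "partial_deriv I n (\<lambda>z. f z - g z) z = partial_deriv I n f z - partial_deriv I n g z"
proof -
  obtain D where D: "(f has_derivative D) (at z within I)"
    using assms(1,3) by (auto simp: differentiable_on_def differentiable_def)
  obtain E where E: "(g has_derivative E) (at z within I)"
    using assms(2,3) by (auto simp: differentiable_on_def differentiable_def)
  show ?thesis
    using partial_deriv_eq[OF assms(3) D] partial_deriv_eq[OF assms(3) E]
      partial_deriv_eq[OF assms(3) has_derivative_diff[OF D E]] by simp
qed

lemma C2_on_diff:
  assumes f: "C2_on I f" and g: "C2_on I g"
  shows "C2_on I (\<lambda>z. f z - g z)"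
proof -
  have d: "f differentiable_on I" "g differentiable_on I"
    and p: "partial_deriv I n f differentiable_on I" "partial_deriv I n g differentiable_on I"
    and q: "continuous_on I (partial_deriv I l (partial_deriv I n f))"
       "continuous_on I (partial_deriv I l (partial_deriv I n g))" for n l
    using f g by (auto simp: C2_on_def)
  have p': "partial_deriv I n (\<lambda>z. f z - g z) differentiable_on I" for n
    unfolding differentiable_on_def
  proof
    fix z assume z: "z \<in> I"
    obtain D where "((\<lambda>z. partial_deriv I n f z - partial_deriv I n g z) has_derivative D) (at z within I)"
      using differentiable_on_diff[OF p, of n n] z by (auto simp: differentiable_on_def differentiable_def)
    from has_derivative_transform[OF z partial_deriv_diff[OF d] this]
    show "partial_deriv I n (\<lambda>z. f z - g z) differentiable (at z within I)"
      by (auto simp: differentiable_def)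
  qed
  have e: "partial_deriv I l (partial_deriv I n (\<lambda>z. f z - g z)) z
    = partial_deriv I l (partial_deriv I n f) z - partial_deriv I l (partial_deriv I n g) z"
    if z: "z \<in> I" for l n z
    using partial_deriv_cong[OF p' partial_deriv_diff[OF d] z] partial_deriv_diff[OF p z] by simp
  have "continuous_on I (partial_deriv I l (partial_deriv I n (\<lambda>z. f z - g z)))" for l n
    by (subst continuous_on_cong[OF refl e]) (auto intro: continuous_on_diff q)
  then show ?thesis using d p' by (simp add: C2_on_def)
qed

text \<open>The ball is compact, so the supremum in \<open>C_norm\<close> is taken over a bounded
  set and really is an upper bound.\<close>

lemma C_norm_ge:
  assumes h: "continuous_on I h" and z: "z \<in> I"
  shows "\<bar>h z\<bar> \<le> C_norm I h"
  unfolding C_norm_def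
proof (rule cSUP_upper[OF z])
  have "compact ((\<lambda>z. \<bar>h z\<bar>) ` I)"
    by (intro compact_continuous_image continuous_intros h) (simp add: I)
  then show "bdd_above ((\<lambda>z. \<bar>h z\<bar>) ` I)" by (intro bounded_imp_bdd_above compact_imp_bounded)
qed

lemma C_norm_nonneg: "continuous_on I h \<Longrightarrow> 0 \<le> C_norm I h"
  using C_norm_ge[of h 0] r I by simp

lemma C2_norm_nonneg:
  assumes "C2_on I h" shows "0 \<le> C2_norm I h"
  unfolding C2_norm_def using assms
  by (intro add_nonneg_nonneg sum_nonneg C_norm_nonneg)
    (auto simp: C2_on_def intro: differentiable_imp_continuous_on)

text \<open>The first bound uses the first-order part of the norm. The second uses the second-order
  part: if the gradient vanishes at 0, the mean value inequality on the segment from 0 gains a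
  factor |z|. Sums over components need no dimensional constant because each |v_n| is at most
  |v|.\<close>

lemma C2_gradient_bounds:
  assumes h: "C2_on I h" and z: "z \<in> I"
  shows "\<bar>\<Sum>n\<in>UNIV. v $ n * partial_deriv I n h z\<bar> \<le> C2_norm I h * norm v"
    and "(\<And>n. partial_deriv I n h 0 = 0) \<Longrightarrow>
      \<bar>\<Sum>n\<in>UNIV. v $ n * partial_deriv I n h z\<bar> \<le> C2_norm I h * norm z * norm v"
proof -
  have d: "h differentiable_on I" and p: "partial_deriv I n h differentiable_on I"
    and q: "continuous_on I (partial_deriv I l (partial_deriv I n h))" for n l
    using h by (auto simp: C2_on_def)
  note c = d[THEN differentiable_imp_continuous_on] p[THEN differentiable_imp_continuous_on]
  let ?C = "C_norm I h" and ?P = "\<lambda>n. C_norm I (partial_deriv I n h)"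
    and ?Q = "\<lambda>n l. C_norm I (partial_deriv I l (partial_deriv I n h))"
  have nn: "0 \<le> ?C" "0 \<le> ?P n" "0 \<le> ?Q n l" for n l by (intro C_norm_nonneg c q)+
  have bound: "\<bar>\<Sum>n\<in>UNIV. v $ n * a n\<bar> \<le> (\<Sum>n\<in>UNIV. b n) * norm v"
    if "\<And>n. \<bar>a n\<bar> \<le> b n" for a b and v :: "real^'n"
  proof -
    have "\<bar>\<Sum>n\<in>UNIV. v $ n * a n\<bar> \<le> (\<Sum>n\<in>UNIV. \<bar>v $ n * a n\<bar>)" by (rule sum_abs)
    also have "\<dots> \<le> (\<Sum>n\<in>UNIV. norm v * b n)"
      using that by (intro sum_mono) (auto simp: abs_mult intro!: mult_mono component_le_norm_cart)
    finally show ?thesis by (simp add: sum_distrib_left mult.commute)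
  qed
  have "\<bar>\<Sum>n\<in>UNIV. v $ n * partial_deriv I n h z\<bar> \<le> (\<Sum>n\<in>UNIV. ?P n) * norm v"
    by (intro bound C_norm_ge c z)
  also have "\<dots> \<le> C2_norm I h * norm v"
    unfolding C2_norm_def using nn by (intro mult_right_mono) (auto intro!: add_nonneg_nonneg sum_nonneg)
  finally show "\<bar>\<Sum>n\<in>UNIV. v $ n * partial_deriv I n h z\<bar> \<le> C2_norm I h * norm v" .
  assume 0: "\<And>n. partial_deriv I n h 0 = 0"
  have "\<bar>partial_deriv I n h z\<bar> \<le> (\<Sum>l\<in>UNIV. ?Q n l) * norm z" for n
  proof -
    have "norm (partial_deriv I n h z - partial_deriv I n h 0) \<le> (\<Sum>l\<in>UNIV. ?Q n l) * norm (z - 0)"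
    proof (rule differentiable_bound)
      show "convex I" by (simp add: I)
      show "(partial_deriv I n h has_derivative (\<lambda>v. \<Sum>l\<in>UNIV. v $ l * partial_deriv I l (partial_deriv I n h) y)) (at y within I)"
        if "y \<in> I" for y by (rule partial_deriv_works[OF p that])
      show "onorm (\<lambda>v. \<Sum>l\<in>UNIV. v $ l * partial_deriv I l (partial_deriv I n h) y) \<le> (\<Sum>l\<in>UNIV. ?Q n l)"
        if "y \<in> I" for y
        by (rule onorm_le, unfold real_norm_def, rule bound, rule C_norm_ge[OF q that])
    qed (use z r I in auto)
    then show ?thesis by (simp add: 0)
  qed
  then have "\<bar>\<Sum>n\<in>UNIV. v $ n * partial_deriv I n h z\<bar> \<le> (\<Sum>n\<in>UNIV. (\<Sum>l\<in>UNIV. ?Q n l) * norm z) * norm v"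
    by (intro bound)
  also have "\<dots> = (\<Sum>n\<in>UNIV. \<Sum>l\<in>UNIV. ?Q n l) * norm z * norm v" by (simp add: sum_distrib_right)
  also have "\<dots> \<le> C2_norm I h * norm z * norm v"
    unfolding C2_norm_def using nn by (intro mult_right_mono) (auto intro!: add_nonneg_nonneg sum_nonneg)
  finally show "\<bar>\<Sum>n\<in>UNIV. v $ n * partial_deriv I n h z\<bar> \<le> C2_norm I h * norm z * norm v" .
qed

text \<open>The gradient bounds are followed along the segment from \<open>w\<close> to
  \<open>z\<close>. If the gradient vanishes at 0, its size at the point of parameter t is at most a
  multiple of (1 - t) |w| + t |z|, whose mean over [0, 1] is the average of the two norms.\<close>

lemma C2_increment_bounds:
  assumes h: "C2_on I h" and z: "z \<in> I" and w: "w \<in> I"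
  shows "\<bar>h z - h w\<bar> \<le> C2_norm I h * norm (z - w)"
    and "(\<And>n. partial_deriv I n h 0 = 0) \<Longrightarrow>
      \<bar>h z - h w\<bar> \<le> C2_norm I h * ((norm z + norm w) / 2 * norm (z - w))"
proof -
  have d: "h differentiable_on I" using h by (auto simp: C2_on_def)
  define p where "p t = w + t *\<^sub>R (z - w)" for t
  define g where "g t = (\<Sum>n\<in>UNIV. (z - w) $ n * partial_deriv I n h (p t))" for t
  have cv: "convex I" by (simp add: I)
  have pI: "p t \<in> I" if "t \<in> {0..1}" for t
    using convexD_alt[OF cv w z, of t] that by (simp add: p_def algebra_simps)
  have der: "((\<lambda>t. h (p t)) has_vector_derivative g t) (at t within {0..1})" if "t \<in> {0..1}" for t
    unfolding p_def g_def
    by (rule has_vector_derivative_segment[OF cv w z that partial_deriv_works[OF d]])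
      (use pI[OF that] in \<open>simp add: p_def\<close>)
  \<comment> \<open>The increment is compared with an explicit majorant \<open>\<phi>\<close> whose
    derivative dominates that of h along the segment, so that derivative never has to be
    integrated.\<close>
  have main: "\<bar>h z - h w\<bar> \<le> \<phi> 1 - \<phi> 0"
    if "continuous_on {0..1} \<phi>" "\<And>t. 0 < t \<Longrightarrow> t < 1 \<Longrightarrow> (\<phi> has_vector_derivative \<phi>' t) (at t)"
      "\<And>t. 0 < t \<Longrightarrow> t < 1 \<Longrightarrow> \<bar>g t\<bar> \<le> \<phi>' t" for \<phi> \<phi>' :: "real \<Rightarrow> real"
  proof -
    have "norm (h (p 1) - h (p 0)) \<le> \<phi> 1 - \<phi> 0"
    proof (rule differentiable_bound_general[where f'=g and \<phi>'=\<phi>'])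
      show "continuous_on {0..1} (\<lambda>t. h (p t))"
        using der has_vector_derivative_continuous continuous_on_eq_continuous_within by blast
      show "((\<lambda>t. h (p t)) has_vector_derivative g t) (at t)" if "0 < t" "t < 1" for t
        using der[of t] that at_within_Icc_at[of 0 t 1] by simp
    qed (use that in auto)
    then show ?thesis by (simp add: p_def)
  qed
  let ?m = "C2_norm I h"
  have "\<bar>h z - h w\<bar> \<le> (1 * (?m * norm (z - w))) - (0 * (?m * norm (z - w)))"
  proof (rule main[where \<phi>'="\<lambda>_. ?m * norm (z - w)"])
    show "((\<lambda>t. t * (?m * norm (z - w))) has_vector_derivative ?m * norm (z - w)) (at t)" for t
      unfolding has_real_derivative_iff_has_vector_derivative[symmetric] by (auto intro!: derivative_eq_intros)
    show "\<bar>g t\<bar> \<le> ?m * norm (z - w)" if "0 < t" "t < 1" for t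
      unfolding g_def by (rule C2_gradient_bounds[OF h pI]) (use that in auto)
  qed (auto intro!: continuous_intros)
  then show "\<bar>h z - h w\<bar> \<le> ?m * norm (z - w)" by simp
  assume 0: "\<And>n. partial_deriv I n h 0 = 0"
  \<comment> \<open>An antiderivative of the linear interpolation (1 - t) |w| + t |z|, scaled by the
    norm of h and the length of the segment.\<close>
  define \<phi> where "\<phi> t = ?m * norm (z - w) * (norm w * (t - t\<^sup>2 / 2) + norm z * (t\<^sup>2 / 2))" for t
  have "\<bar>h z - h w\<bar> \<le> \<phi> 1 - \<phi> 0"
  proof (rule main[where \<phi>'="\<lambda>t. ?m * norm (z - w) * (norm w * (1 - t) + norm z * t)"])
    show "continuous_on {0..1} \<phi>" unfolding \<phi>_def by (intro continuous_intros) auto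
    show "(\<phi> has_vector_derivative ?m * norm (z - w) * (norm w * (1 - t) + norm z * t)) (at t)" for t
      unfolding has_real_derivative_iff_has_vector_derivative[symmetric] \<phi>_def
      by (auto intro!: derivative_eq_intros simp: field_simps)
    fix t :: real assume t: "0 < t" "t < 1"
    have "\<bar>g t\<bar> \<le> ?m * norm (p t) * norm (z - w)"
      unfolding g_def by (rule C2_gradient_bounds(2)[OF h pI 0]) (use t in auto)
    also have "norm (p t) \<le> norm w * (1 - t) + norm z * t"
    proof -
      have "p t = (1 - t) *\<^sub>R w + t *\<^sub>R z" by (simp add: p_def algebra_simps)
      then show ?thesis
        using norm_triangle_ineq[of "(1 - t) *\<^sub>R w" "t *\<^sub>R z"] t by (simp add: mult.commute)
    qed
    finally show "\<bar>g t\<bar> \<le> ?m * norm (z - w) * (norm w * (1 - t) + norm z * t)"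
      using C2_norm_nonneg[OF h] by (simp add: mult_ac mult_left_mono mult_right_mono)
  qed
  also have "\<dots> = ?m * ((norm z + norm w) / 2 * norm (z - w))"
    by (simp add: \<phi>_def field_simps)
  finally show "\<bar>h z - h w\<bar> \<le> ?m * ((norm z + norm w) / 2 * norm (z - w))" .
qed

lemma partial_deriv_0_of_GDERIV:
  assumes "GDERIV h 0 :> 0"
  shows "partial_deriv I n h 0 = 0"
proof -
  have "(h has_derivative (\<lambda>v. v \<bullet> 0)) (at 0 within I)"
    using assms unfolding gderiv_def by (rule has_derivative_at_withinI)
  then show ?thesis using r I by (subst partial_deriv_eq) auto
qed

lemma C2_norm_le_vec:
  assumes "\<And>m. C2_on I (\<lambda>z. g z $ m)"
  shows "C2_norm I (\<lambda>z. g z $ m) \<le> C2_norm_vec I g"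
  unfolding C2_norm_vec_def using assms by (intro member_le_sum C2_norm_nonneg) auto

end

subsection \<open>Estimates for the system\<close>

lemma H2_space_square_integrable:
  fixes u :: "real^3 \<Rightarrow> real^'n::finite"
  assumes "u \<in> H2_space"
  shows "square_integrable u" and "l2 u \<le> H2_norm u" and "0 \<le> H2_norm u"
proof -
  have c: "square_integrable (\<lambda>x. u x $ m)" for m
    using assms by (simp add: H2_space_def sobolev_space_def)
  show "square_integrable u" by (rule square_integrable_vec(1)[OF c])
  show "0 \<le> H2_norm u" unfolding H2_norm_def by (intro real_sqrt_ge_zero sum_nonneg) simp
  have "l2 u = sqrt ((l2 u)\<^sup>2)" by simp
  also have "\<dots> \<le> H2_norm u"
    unfolding H2_norm_def square_integrable_vec(2)[of u, OF c] L2_norm_eq_l2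
    by (intro real_sqrt_le_mono sum_mono) simp
  finally show "l2 u \<le> H2_norm u" .
qed

text \<open>Squaring and adding the scalar embeddings reproduces the sum that defines
  \<open>H2_norm\<close>, so the vector embedding keeps the scalar constant, with no factor
  depending on the number of components.\<close>

lemma H2_space_bounded:
  fixes u :: "real^3 \<Rightarrow> real^'n::finite"
  assumes c: "sobolev_embedding_constant c" and u: "u \<in> H2_space"
  shows "AE x in lebesgue. norm (u x) \<le> c * H2_norm u"
proof -
  let ?n = "\<lambda>m. sobolev_norm 1 (\<lambda>x. u x $ m)"
  have c0: "0 < c" using c by (simp add: sobolev_embedding_constant_def)
  have "AE x in lebesgue. \<forall>m. \<bar>u x $ m\<bar> \<le> c * ?n m"
    using c u by (subst AE_all_countable) (auto simp: sobolev_embedding_constant_def H2_space_def)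
  then show ?thesis
  proof eventually_elim
    case (elim x)
    have "norm (u x) = sqrt (\<Sum>m\<in>UNIV. (u x $ m)\<^sup>2)" by (simp add: norm_vec_def L2_set_def)
    also have "\<dots> \<le> sqrt (\<Sum>m\<in>UNIV. (c * ?n m)\<^sup>2)"
    proof (intro real_sqrt_le_mono sum_mono)
      fix m
      show "(u x $ m)\<^sup>2 \<le> (c * ?n m)\<^sup>2"
        using power_mono[OF elim[rule_format, of m], of 2] by simp
    qed
    also have "\<dots> = c * H2_norm u"
      using c0 by (simp add: H2_norm_def sobolev_norm_def power_mult_distrib sum_distrib_left[symmetric] real_sqrt_mult)
    finally show ?case .
  qed
qed

text \<open>Extending \<open>h\<close> by 0 off the closed set \<open>I\<close> gives a Borel
  function, whose composition with \<open>u\<close> is Lebesgue measurable; completeness of the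
  measure then absorbs the null set on which \<open>u\<close> leaves \<open>I\<close>.\<close>

lemma compose_measurable:
  fixes u :: "real^3 \<Rightarrow> real^'n::finite" and h :: "real^'n \<Rightarrow> real"
  assumes u: "u \<in> borel_measurable lebesgue" and I: "closed I" "AE x in lebesgue. u x \<in> I"
    and h: "continuous_on I h"
  shows "(\<lambda>x. h (u x)) \<in> borel_measurable lebesgue"
proof -
  have "(\<lambda>z. if z \<in> I then h z else 0) \<in> borel_measurable borel"
    using I(1) h by (intro borel_measurable_continuous_on_if) auto
  then have "(\<lambda>x. if u x \<in> I then h (u x) else 0) \<in> borel_measurable lebesgue"
    by (rule measurable_compose[OF u])
  then show ?thesis
    by (rule lebesgue_measurable_cong_AE) (use I(2) in eventually_elim, simp)
qed

text \<open>Increments from the origin: h and its gradient vanish there, so |h(z)| has a quadratic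
  bound, which gives integrability, and a linear bound, which gives square integrability.\<close>

lemma nonlinearity_integrable:
  fixes u :: "real^3 \<Rightarrow> real^'n::finite" and h :: "real^'n \<Rightarrow> real"
  assumes r: "0 < r" and u: "square_integrable u" "AE x in lebesgue. u x \<in> cball 0 r"
    and h: "C2_on (cball 0 r) h" "h 0 = 0" "\<And>n. partial_deriv (cball 0 r) n h 0 = 0"
  shows "integrable lebesgue (\<lambda>x. h (u x))" and "square_integrable (\<lambda>x. h (u x))"
    and "L1_norm (\<lambda>x. h (u x)) \<le> C2_norm (cball 0 r) h / 2 * (l2 u)\<^sup>2"
    and "l2 (\<lambda>x. h (u x)) \<le> C2_norm (cball 0 r) h * l2 u"
proof -
  let ?I = "cball 0 r :: (real^'n) set" and ?m = "C2_norm (cball 0 r) h"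
  have m0: "0 \<le> ?m" by (rule C2_norm_nonneg[OF r refl h(1)])
  have "continuous_on ?I h" using h(1) by (auto simp: C2_on_def intro: differentiable_imp_continuous_on)
  then have meas: "(\<lambda>x. h (u x)) \<in> borel_measurable lebesgue"
    using u by (intro compose_measurable[where I="?I"]) (auto simp: square_integrable_def)
  have b1: "AE x in lebesgue. \<bar>h (u x)\<bar> \<le> ?m / 2 * (norm (u x))\<^sup>2"
    using u(2)
  proof eventually_elim
    case (elim x)
    from C2_increment_bounds(2)[OF r refl h(1) elim _ h(3), of 0] r show ?case
      by (simp add: h(2) power2_eq_square)
  qed
  have b2: "AE x in lebesgue. \<bar>h (u x)\<bar> \<le> ?m * norm (u x)"
    using u(2)
  proof eventually_elim
    case (elim x)
    from C2_increment_bounds(1)[OF r refl h(1) elim, of 0] r show ?case by (simp add: h(2))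
  qed
  have i: "integrable lebesgue (\<lambda>x. ?m / 2 * (norm (u x))\<^sup>2)"
    using u(1) by (simp add: square_integrable_def)
  show ii: "integrable lebesgue (\<lambda>x. h (u x))"
    by (rule Bochner_Integration.integrable_bound[OF i meas]) (use b1 m0 in \<open>auto elim!: AE_mp\<close>)
  have "L1_norm (\<lambda>x. h (u x)) \<le> (LINT x|lebesgue. ?m / 2 * (norm (u x))\<^sup>2)"
    unfolding L1_norm_def by (rule integral_mono_AE[OF _ i b1]) (use ii in simp)
  then show "L1_norm (\<lambda>x. h (u x)) \<le> ?m / 2 * (l2 u)\<^sup>2" by (simp add: l2_power2)
  note sc = square_integrable_scaleR[OF u(1), of ?m]
  have b3: "AE x in lebesgue. norm (h (u x)) \<le> norm (?m *\<^sub>R u x)" using b2 m0 by simp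
  show "square_integrable (\<lambda>x. h (u x))" by (rule square_integrable_bound(1)[OF sc(1) meas b3])
  show "l2 (\<lambda>x. h (u x)) \<le> ?m * l2 u"
    using square_integrable_bound(2)[OF sc(1) meas b3] sc(2) m0 by simp
qed

lemma L1_norm_add_le:
  assumes "integrable lebesgue f" "integrable lebesgue g"
  shows "L1_norm (\<lambda>x. f x + g x) \<le> L1_norm f + L1_norm g"
proof -
  have "L1_norm (\<lambda>x. f x + g x) \<le> (LINT x|lebesgue. \<bar>f x\<bar> + \<bar>g x\<bar>)"
    unfolding L1_norm_def using assms by (intro integral_mono) auto
  then show ?thesis using assms by (simp add: L1_norm_def)
qed

lemma nonlinearity_difference:
  fixes u\<^sub>1 u\<^sub>2 :: "real^3 \<Rightarrow> real^'n::finite" and h\<^sub>1 h\<^sub>2 :: "real^'n \<Rightarrow> real"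
  assumes r: "0 < r"
    and u1: "square_integrable u\<^sub>1" "AE x in lebesgue. u\<^sub>1 x \<in> cball 0 r" "l2 u\<^sub>1 \<le> D"
    and u2: "square_integrable u\<^sub>2" "AE x in lebesgue. u\<^sub>2 x \<in> cball 0 r" "l2 u\<^sub>2 \<le> D"
    and h1: "C2_on (cball 0 r) h\<^sub>1" "h\<^sub>1 0 = 0" "\<And>n. partial_deriv (cball 0 r) n h\<^sub>1 0 = 0"
    and h2: "C2_on (cball 0 r) h\<^sub>2" "h\<^sub>2 0 = 0" "\<And>n. partial_deriv (cball 0 r) n h\<^sub>2 0 = 0"
    and M: "C2_norm (cball 0 r) h\<^sub>1 \<le> M" and N: "C2_norm (cball 0 r) (\<lambda>z. h\<^sub>1 z - h\<^sub>2 z) \<le> N"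
  shows "L1_norm (\<lambda>x. h\<^sub>1 (u\<^sub>1 x) - h\<^sub>2 (u\<^sub>2 x)) \<le> D * (M * l2 (\<lambda>x. u\<^sub>1 x - u\<^sub>2 x) + N * D)"
    and "l2 (\<lambda>x. h\<^sub>1 (u\<^sub>1 x) - h\<^sub>2 (u\<^sub>2 x)) \<le> M * l2 (\<lambda>x. u\<^sub>1 x - u\<^sub>2 x) + N * D"
proof -
  let ?I = "cball 0 r :: (real^'n) set" and ?g = "\<lambda>z. h\<^sub>1 z - h\<^sub>2 z" and ?U = "\<lambda>x. u\<^sub>1 x - u\<^sub>2 x"
  let ?m = "C2_norm ?I h\<^sub>1" and ?n = "C2_norm ?I ?g" and ?A = "\<lambda>x. h\<^sub>1 (u\<^sub>1 x) - h\<^sub>1 (u\<^sub>2 x)"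
  have D0: "0 \<le> D" using order_trans[OF l2_nonneg u1(3)] .
  have g: "C2_on ?I ?g" by (rule C2_on_diff[OF r refl h1(1) h2(1)])
  have pg: "partial_deriv ?I n ?g 0 = 0" for n
    using partial_deriv_diff[OF r refl, of h\<^sub>1 h\<^sub>2 0 n] h1 h2 r by (simp add: C2_on_def)
  have m0: "0 \<le> ?m" "0 \<le> ?n" using C2_norm_nonneg[OF r refl] h1(1) g by auto
  note 1 = nonlinearity_integrable[OF r u1(1,2) h1] and 2 = nonlinearity_integrable[OF r u2(1,2) h1]
  have g0: "?g 0 = 0" using h1 h2 by simp
  note 3 = nonlinearity_integrable[OF r u2(1,2) g g0 pg]
  have eq: "(\<lambda>x. h\<^sub>1 (u\<^sub>1 x) - h\<^sub>2 (u\<^sub>2 x)) = (\<lambda>x. ?A x + ?g (u\<^sub>2 x))" by auto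
  have Ai: "integrable lebesgue ?A" "square_integrable ?A"
    using 1 2 by (auto intro: square_integrable_diff)
  have U: "square_integrable ?U" by (rule square_integrable_diff[OF u1(1) u2(1)])
  \<comment> \<open>Twice the averaged norm from the increment bound. Its L^2 norm is at most 2 D,
    and the factor 1/2 of the average brings this back to D.\<close>
  let ?V = "\<lambda>x. norm (u\<^sub>1 x) + norm (u\<^sub>2 x)"
  have V: "square_integrable ?V" "l2 ?V \<le> 2 * D"
    using square_integrable_add[OF square_integrable_norm[OF u1(1)] square_integrable_norm[OF u2(1)]] u1(3) u2(3)
    by auto
  have in_I: "AE x in lebesgue. u\<^sub>1 x \<in> ?I \<and> u\<^sub>2 x \<in> ?I" using u1(2) u2(2) by eventually_elim simp
  have b1: "AE x in lebesgue. \<bar>?A x\<bar> \<le> ?m / 2 * (norm (?V x) * norm (?U x))"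
    using in_I
  proof eventually_elim
    case (elim x)
    from C2_increment_bounds(2)[OF r refl h1(1) _ _ h1(3), of "u\<^sub>1 x" "u\<^sub>2 x"] elim show ?case
      by simp
  qed
  have b2: "AE x in lebesgue. norm (?A x) \<le> norm (?m *\<^sub>R ?U x)"
    using in_I
  proof eventually_elim
    case (elim x)
    from C2_increment_bounds(1)[OF r refl h1(1), of "u\<^sub>1 x" "u\<^sub>2 x"] elim m0 show ?case by simp
  qed
  have "L1_norm ?A \<le> (LINT x|lebesgue. ?m / 2 * (norm (?V x) * norm (?U x)))"
    unfolding L1_norm_def
    by (rule integral_mono_AE[OF _ _ b1]) (use Ai(1) l2_CS(1)[OF V(1) U] in auto)
  also have "\<dots> \<le> ?m / 2 * (l2 ?V * l2 ?U)"
    using l2_CS(2)[OF V(1) U] m0 by (simp add: mult_left_mono)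
  also have "\<dots> \<le> M / 2 * (2 * D * l2 ?U)"
    using M V(2) m0 D0 by (intro mult_mono) auto
  finally have A1: "L1_norm ?A \<le> M * D * l2 ?U" by simp
  have "l2 ?A \<le> ?m * l2 ?U"
    using square_integrable_bound(2)[OF square_integrable_scaleR(1)[OF U, of ?m] _ b2] Ai(1)
      square_integrable_scaleR(2)[OF U, of ?m] m0 by auto
  also have "\<dots> \<le> M * l2 ?U" using M by (intro mult_right_mono) auto
  finally have A2: "l2 ?A \<le> M * l2 ?U" .
  have "L1_norm (\<lambda>x. ?g (u\<^sub>2 x)) \<le> ?n / 2 * (l2 u\<^sub>2)\<^sup>2" by (rule 3)
  \<comment> \<open>The factor 1/2 is dropped on purpose: the L^1 bound then becomes exactly
    \<open>D\<close> times the L^2 bound.\<close>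
  also have "\<dots> \<le> N * D\<^sup>2" using N m0 u2(3) by (intro mult_mono power_mono) auto
  finally have B1: "L1_norm (\<lambda>x. ?g (u\<^sub>2 x)) \<le> N * D\<^sup>2" .
  have "l2 (\<lambda>x. ?g (u\<^sub>2 x)) \<le> ?n * l2 u\<^sub>2" by (rule 3)
  also have "\<dots> \<le> N * D" using N m0 u2(3) D0 by (intro mult_mono) auto
  finally have B2: "l2 (\<lambda>x. ?g (u\<^sub>2 x)) \<le> N * D" .
  show "L1_norm (\<lambda>x. h\<^sub>1 (u\<^sub>1 x) - h\<^sub>2 (u\<^sub>2 x)) \<le> D * (M * l2 ?U + N * D)"
    unfolding eq using L1_norm_add_le[OF Ai(1) 3(1)] A1 B1
    by (simp add: algebra_simps power2_eq_square)
  show "l2 (\<lambda>x. h\<^sub>1 (u\<^sub>1 x) - h\<^sub>2 (u\<^sub>2 x)) \<le> M * l2 ?U + N * D"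
    unfolding eq using square_integrable_add(2)[OF Ai(2) 3(2)] A2 B2 by linarith
qed

text \<open>The right-hand side has a transform by the symbols acting on \<open>F\<close>, and
  another by the convolution theorem. Being both integrable and square integrable, it has only one
  up to null sets.\<close>

lemma solves_linear_fourier:
  assumes u: "L2_fourier u F" and H: "integrable lebesgue H" and G: "integrable lebesgue G"
    and sol: "solves_linear s\<^sub>1 s\<^sub>2 u (\<lambda>x. e * (LINT y|lebesgue. H (x - y) * G y))"
  shows "AE p in lebesgue. of_real (norm p powr (2 * s\<^sub>1) + norm p powr (2 * s\<^sub>2)) * F p
     = of_real (e * c3) * fourier_integral H p * fourier_integral G p"
proof -
  let ?c = "\<lambda>x. LINT y|lebesgue. H (x - y) * G y"
  obtain a b where ab: "is_frac_laplacian s\<^sub>1 u a" "is_frac_laplacian s\<^sub>2 u b"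
    "AE x in lebesgue. a x + b x = e * ?c x"
    using sol by (auto simp: solves_linear_def)
  have "L2_fourier (\<lambda>x. a x + b x) (\<lambda>p. of_real (norm p powr (2 * s\<^sub>1)) * F p + of_real (norm p powr (2 * s\<^sub>2)) * F p)"
    by (intro L2_fourier_add is_frac_laplacian_L2_fourier[OF u] ab)
  from L2_fourier_cong_AE[OF this ab(3)]
  have 1: "L2_fourier (\<lambda>x. e * ?c x) (\<lambda>p. of_real (norm p powr (2 * s\<^sub>1)) * F p + of_real (norm p powr (2 * s\<^sub>2)) * F p)"
    by simp
  have 2: "L2_fourier (\<lambda>x. e * ?c x) (fourier_integral (\<lambda>x. e * ?c x))"
    using 1 fourier_convolution(1)[OF H G] by (intro L2_fourier_integrable) (auto simp: L2_fourier_def)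
  show ?thesis
    using L2_fourier_unique[OF 1 2]
    by eventually_elim
      (simp add: fourier_integral_scale fourier_convolution(2)[OF H G] distrib_right mult.assoc)
qed

text \<open>The constants that enter are only those of the weaker symbol \<open>\<bar>p\<bar>\<^sup>2\<^sup>s\<close>: the
  second fractional Laplacian only helps.\<close>

lemma component_estimate:
  fixes u\<^sub>1 u\<^sub>2 H G\<^sub>1 G\<^sub>2 :: "real^3 \<Rightarrow> real"
  assumes u: "u\<^sub>1 \<in> sobolev_space 1" "u\<^sub>2 \<in> sobolev_space 1"
    and H: "integrable lebesgue H" "frac_laplacian_L2 (1 - s\<^sub>1) H"
    and G1: "integrable lebesgue G\<^sub>1" "square_integrable G\<^sub>1"
    and G2: "integrable lebesgue G\<^sub>2" "square_integrable G\<^sub>2"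
    and sol1: "solves_linear s\<^sub>1 s\<^sub>2 u\<^sub>1 (\<lambda>x. e * (LINT y|lebesgue. H (x - y) * G\<^sub>1 y))"
    and sol2: "solves_linear s\<^sub>1 s\<^sub>2 u\<^sub>2 (\<lambda>x. e * (LINT y|lebesgue. H (x - y) * G\<^sub>2 y))"
    and s: "1/4 < s\<^sub>1" "s\<^sub>1 < 3/4" and e: "0 \<le> e" and D: "0 < D"
    and L1: "L1_norm (\<lambda>x. G\<^sub>1 x - G\<^sub>2 x) \<le> D * B" and L2: "l2 (\<lambda>x. G\<^sub>1 x - G\<^sub>2 x) \<le> B"
  shows "(L2_norm (\<lambda>x. u\<^sub>1 x - u\<^sub>2 x))\<^sup>2 + (L2_norm (frac_laplacian 1 (\<lambda>x. u\<^sub>1 x - u\<^sub>2 x)))\<^sup>2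
    \<le> e\<^sup>2 * B\<^sup>2 * ((L1_norm H)\<^sup>2 * kappa s\<^sub>1 D + D\<^sup>2 * (L2_norm (frac_laplacian (1 - s\<^sub>1) H))\<^sup>2)"
proof -
  have B: "0 \<le> B" using order_trans[OF l2_nonneg L2] .
  let ?H = "fourier_integral H" and ?G = "fourier_integral (\<lambda>x. G\<^sub>1 x - G\<^sub>2 x)" and ?U = "\<lambda>x. u\<^sub>1 x - u\<^sub>2 x"
  obtain F\<^sub>1 where F1: "L2_fourier u\<^sub>1 F\<^sub>1" using sobolev_space_fourier[OF u(1)] .
  obtain F\<^sub>2 where F2: "L2_fourier u\<^sub>2 F\<^sub>2" using sobolev_space_fourier[OF u(2)] .
  let ?W = "\<lambda>p. F\<^sub>1 p - F\<^sub>2 p"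
  have W: "L2_fourier ?U ?W" by (rule L2_fourier_diff[OF F1 F2])
  have L: "L2_fourier (frac_laplacian 1 ?U) (\<lambda>p. of_real (norm p powr (2 * 1)) * ?W p)"
    using sobolev_space_diff[OF u]
    by (intro is_frac_laplacian_L2_fourier[OF W] frac_laplacian_spec) (simp add: sobolev_space_def)
  have K: "L2_fourier (frac_laplacian (1 - s\<^sub>1) H) (\<lambda>p. of_real (norm p powr (2 * (1 - s\<^sub>1))) * ?H p)"
    by (rule is_frac_laplacian_L1[OF H(1) frac_laplacian_spec[OF H(2)]])
  have L1H: "0 \<le> L1_norm H" by (simp add: L1_norm_def)
  have Gi: "integrable lebesgue (\<lambda>x. G\<^sub>1 x - G\<^sub>2 x)" "square_integrable (\<lambda>x. G\<^sub>1 x - G\<^sub>2 x)"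
    using G1 G2 by (auto intro: square_integrable_diff)
  have supG: "norm (?G p) \<le> D * B / c3" for p
    using norm_fourier_integral_le[of "\<lambda>x. G\<^sub>1 x - G\<^sub>2 x" p] Gi(1) L1
    by (auto intro: order_trans simp: divide_right_mono less_imp_le[OF c3_pos])
  have supH: "c3 * norm (?H p) \<le> L1_norm H" for p
    using norm_fourier_integral_le[of H p] H(1) by (simp add: field_simps)
  have "AE p in lebesgue. of_real (norm p powr (2 * s\<^sub>1) + norm p powr (2 * s\<^sub>2)) * ?W p
     = of_real (e * c3) * ?H p * ?G p"
    using solves_linear_fourier[OF F1 H(1) G1(1) sol1] solves_linear_fourier[OF F2 H(1) G2(1) sol2]
    by eventually_elim (simp add: fourier_integral_diff[OF G1(1) G2(1)] right_diff_distrib)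
  then have key: "AE p in lebesgue. norm p powr (2 * s\<^sub>1) * norm (?W p) \<le> e * (c3 * norm (?H p)) * norm (?G p)"
  proof eventually_elim
    case (elim p)
    have "norm p powr (2 * s\<^sub>1) * norm (?W p) \<le> (norm p powr (2 * s\<^sub>1) + norm p powr (2 * s\<^sub>2)) * norm (?W p)"
      by (intro mult_right_mono) auto
    also have "\<dots> = norm (of_real (norm p powr (2 * s\<^sub>1) + norm p powr (2 * s\<^sub>2)) * ?W p)"
      by (simp only: norm_mult norm_of_real) simp
    also have "\<dots> = e * (c3 * norm (?H p)) * norm (?G p)"
      unfolding elim using e by (simp add: norm_mult less_imp_le[OF c3_pos] mult.assoc)
    finally show ?case .
  qed
  have 1: "(L2_norm ?U)\<^sup>2 \<le> (e * L1_norm H)\<^sup>2 * B\<^sup>2 * kappa s\<^sub>1 D"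
    unfolding L2_norm_eq_l2 L2_fourier_norm[OF W, symmetric]
  proof (rule low_high_frequency_bound[OF _ bessel(1)[OF Gi] _ supG order_trans[OF bessel(2)[OF Gi] L2] s D])
    show "square_integrable ?W" using W by (simp add: L2_fourier_def)
    show "AE p in lebesgue. norm p powr (2 * s\<^sub>1) * norm (?W p) \<le> e * L1_norm H * norm (?G p)"
      using key
    proof eventually_elim
      case (elim p)
      \<comment> \<open>For U itself the kernel enters through the supremum of its transform, hence
        through its L^1 norm, and G is split by frequency. For the Laplacian the roles are
        exchanged: G enters through its supremum and the kernel through an L^2 norm.\<close>
      also have "e * (c3 * norm (?H p)) * norm (?G p) \<le> e * L1_norm H * norm (?G p)"
        using supH[of p] e by (intro mult_right_mono mult_left_mono) auto
      finally show ?case .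
    qed
  qed (use e L1H in simp)
  have Ks: "square_integrable (\<lambda>p. of_real (norm p powr (2 * (1 - s\<^sub>1))) * ?H p)"
    using K by (simp add: L2_fourier_def)
  have c3DB: "c3 * norm (?G p) \<le> D * B" for p using supG[of p] by (simp add: field_simps)
  have "l2 (\<lambda>p. of_real (norm p powr (2 * 1)) * ?W p)
     \<le> l2 (\<lambda>p. (e * D * B) *\<^sub>R (of_real (norm p powr (2 * (1 - s\<^sub>1))) * ?H p))"
  proof (rule square_integrable_bound(2)[OF square_integrable_scaleR(1)[OF Ks]])
    show "(\<lambda>p. of_real (norm p powr (2 * 1)) * ?W p) \<in> borel_measurable lebesgue"
      using L by (auto simp: L2_fourier_def square_integrable_def)
    show "AE p in lebesgue. norm (of_real (norm p powr (2 * 1)) * ?W p)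
       \<le> norm ((e * D * B) *\<^sub>R (of_real (norm p powr (2 * (1 - s\<^sub>1))) * ?H p))"
      using key
    proof eventually_elim
      case (elim p)
      \<comment> \<open>The symbol |p|^2 is shared out: |p|^(2 s) is consumed by the equation, and
        the remaining |p|^(2 (1 - s)) falls on the transform of the kernel, where it is exactly what
        the regularity assumption on the kernel controls.\<close>
      have "norm (of_real (norm p powr (2 * 1)) * ?W p) = norm p powr (2 * (1 - s\<^sub>1)) * (norm p powr (2 * s\<^sub>1) * norm (?W p))"
        unfolding mult.assoc[symmetric] powr_add[symmetric] by (simp add: norm_mult norm_power)
      also have "\<dots> \<le> norm p powr (2 * (1 - s\<^sub>1)) * (e * (c3 * norm (?H p)) * norm (?G p))"
        using elim by (intro mult_left_mono) auto
      also have "\<dots> = (norm p powr (2 * (1 - s\<^sub>1)) * e * norm (?H p)) * (c3 * norm (?G p))" by simp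
      also have "\<dots> \<le> (norm p powr (2 * (1 - s\<^sub>1)) * e * norm (?H p)) * (D * B)"
        using c3DB[of p] e by (intro mult_left_mono) auto
      also have "\<dots> = norm ((e * D * B) *\<^sub>R (of_real (norm p powr (2 * (1 - s\<^sub>1))) * ?H p))"
        using e D B by (simp add: norm_mult mult_ac)
      finally show ?case .
    qed
  qed
  then have "L2_norm (frac_laplacian 1 ?U) \<le> e * D * B * L2_norm (frac_laplacian (1 - s\<^sub>1) H)"
    unfolding L2_norm_eq_l2 L2_fourier_norm[OF L] L2_fourier_norm[OF K] square_integrable_scaleR(2)[OF Ks]
    using e D B by simp
  from power_mono[OF this, of 2]
  have 2: "(L2_norm (frac_laplacian 1 ?U))\<^sup>2 \<le> e\<^sup>2 * B\<^sup>2 * (D\<^sup>2 * (L2_norm (frac_laplacian (1 - s\<^sub>1) H))\<^sup>2)"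
    by (simp add: L2_norm_eq_l2 power_mult_distrib mult_ac)
  show ?thesis using 1 2 by (simp add: power_mult_distrib algebra_simps)
qed

text \<open>A null function has null fractional Laplacians. In contrapositive form, a nontrivial
  source forces a nonzero solution, which will make \<open>D\<close> strictly larger than 1.\<close>

lemma solves_linear_zero:
  assumes u: "square_integrable u" "l2 u = 0" and sol: "solves_linear s\<^sub>1 s\<^sub>2 u f"
  shows "AE x in lebesgue. f x = 0"
proof -
  obtain a b where ab: "is_frac_laplacian s\<^sub>1 u a" "is_frac_laplacian s\<^sub>2 u b"
    "AE x in lebesgue. a x + b x = f x"
    using sol by (auto simp: solves_linear_def)
  have "u \<in> sobolev_space s\<^sub>2" using sol by (simp add: solves_linear_def)
  then obtain F where F: "L2_fourier u F" using sobolev_space_fourier by blast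
  then have F0: "AE p in lebesgue. F p = 0"
    using L2_fourier_norm[OF F] u by (intro l2_eq_0_AE) (auto simp: L2_fourier_def)
  have z: "AE x in lebesgue. v x = 0" if "is_frac_laplacian s u v" for s v
  proof -
    have V: "L2_fourier v (\<lambda>p. of_real (norm p powr (2 * s)) * F p)"
      by (rule is_frac_laplacian_L2_fourier[OF F that])
    have "L2_fourier v (\<lambda>p. 0)"
      by (rule L2_fourier_cong_AE[OF V]) (use F0 in \<open>auto elim: AE_mp\<close>)
    from L2_fourier_norm[OF this] show ?thesis
      using V by (intro l2_eq_0_AE) (auto simp: l2_def L2_fourier_def)
  qed
  from z[OF ab(1)] z[OF ab(2)] ab(3) show ?thesis by eventually_elim simp
qed

section \<open>Summation over the components and absorption\<close>

theorem theorem1p5: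
  fixes s\<^sub>1\<^sub>m s\<^sub>2\<^sub>m \<epsilon>\<^sub>m :: "'n::finite \<Rightarrow> real"
    and f H :: "'n \<Rightarrow> real^3 \<Rightarrow> real"
    and u\<^sub>0 u\<^sub>p\<^sub>1 u\<^sub>p\<^sub>2 u\<^sub>1 u\<^sub>2 :: "real^3 \<Rightarrow> real^'n"
    and g\<^sub>1 g\<^sub>2 :: "real^'n \<Rightarrow> real^'n"
    and I :: "(real^'n) set"
    and \<epsilon> s\<^sub>1 S\<^sub>1 H_sq Q_sq c\<^sub>e M \<rho> \<sigma> :: real
  assumes "CARD('n) \<ge> 2"
    and "\<And>m. 1/4 < s\<^sub>1\<^sub>m m \<and> s\<^sub>1\<^sub>m m < 3/4"
    and "\<And>m. s\<^sub>1\<^sub>m m < s\<^sub>2\<^sub>m m \<and> s\<^sub>2\<^sub>m m < 1"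
    and "\<And>m. \<epsilon>\<^sub>m m \<ge> 0"
    and "\<epsilon> = Max (range \<epsilon>\<^sub>m)"
    and "s\<^sub>1 = Min (range s\<^sub>1\<^sub>m)"
    and "S\<^sub>1 = Max (range s\<^sub>1\<^sub>m)"
    and "\<And>m. integrable lebesgue (f m) \<and> frac_laplacian_L2 (1 - s\<^sub>1\<^sub>m m) (f m)"
    and "\<And>m. integrable lebesgue (H m) \<and> frac_laplacian_L2 (1 - s\<^sub>1\<^sub>m m) (H m)"
    and "\<exists>m. \<not> (AE x in lebesgue. f m x = 0)"
    and "H_sq = (\<Sum>m\<in>UNIV. (L1_norm (H m))\<^sup>2)" and "H_sq > 0"
    and "Q_sq = (\<Sum>m\<in>UNIV. (L2_norm (frac_laplacian (1 - s\<^sub>1\<^sub>m m) (H m)))\<^sup>2)" and "Q_sq > 0"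
    and "u\<^sub>0 \<in> H2_space"
    and "\<And>m. solves_linear (s\<^sub>1\<^sub>m m) (s\<^sub>2\<^sub>m m) (\<lambda>x. u\<^sub>0 x $ m) (f m)"
    and "sobolev_embedding_constant c\<^sub>e"
    and "I = {z. norm z \<le> c\<^sub>e * H2_norm u\<^sub>0 + c\<^sub>e}"
    and "M > 0"
    and "admissible I M g\<^sub>1" and "admissible I M g\<^sub>2"
    and "0 < \<rho>" and "\<rho> \<le> 1"
    and "0 < \<epsilon>"
    and "\<epsilon> \<le> \<rho> / (M * (H2_norm u\<^sub>0 + 1)\<^sup>2) *
           (H_sq * (H2_norm u\<^sub>0 + 1) powr (8 * S\<^sub>1 / 3 - 2) * (1 / (4 * s\<^sub>1) powr (4 * s\<^sub>1 / 3))
              * (3 / ((3 - 4 * S\<^sub>1) * (2 * pi\<^sup>2) powr (4 * s\<^sub>1 / 3))) + Q_sq) powr (-1/2)"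
    and "tau_graph s\<^sub>1\<^sub>m s\<^sub>2\<^sub>m \<epsilon>\<^sub>m H u\<^sub>0 \<rho> g\<^sub>1 u\<^sub>p\<^sub>1 u\<^sub>p\<^sub>1"
    and "tau_graph s\<^sub>1\<^sub>m s\<^sub>2\<^sub>m \<epsilon>\<^sub>m H u\<^sub>0 \<rho> g\<^sub>2 u\<^sub>p\<^sub>2 u\<^sub>p\<^sub>2"
    and "u\<^sub>1 = (\<lambda>x. u\<^sub>0 x + u\<^sub>p\<^sub>1 x)" and "u\<^sub>2 = (\<lambda>x. u\<^sub>0 x + u\<^sub>p\<^sub>2 x)"
    and "\<sigma> = M * (H2_norm u\<^sub>0 + 1) *
           (3 * H_sq * (H2_norm u\<^sub>0 + 1) powr (8 * S\<^sub>1 / 3 - 2)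
                / ((3 - 4 * S\<^sub>1) * (2 * pi\<^sup>2) powr (4 * s\<^sub>1 / 3))
              * (1 / (4 * s\<^sub>1) powr (4 * s\<^sub>1 / 3)) + Q_sq) powr (1/2)"
  shows "H2_norm (\<lambda>x. u\<^sub>1 x - u\<^sub>2 x) \<le>
           \<epsilon> * \<sigma> / (M * (1 - \<epsilon> * \<sigma>)) * (H2_norm u\<^sub>0 + 1) * C2_norm_vec I (\<lambda>z. g\<^sub>1 z - g\<^sub>2 z)"
proof -
  define D where "D = H2_norm u\<^sub>0 + 1"
  define r where "r = c\<^sub>e * D"
  define N where "N = C2_norm_vec I (\<lambda>z. g\<^sub>1 z - g\<^sub>2 z)"
  \<comment> \<open>The common upper bound of all \<open>kappa (s\<^sub>1\<^sub>m m) D\<close>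
    supplied by \<open>kappa_mono\<close>.\<close>
  define K where "K = 3 * D powr (8 * S\<^sub>1 / 3) / ((3 - 4 * S\<^sub>1) * (4 * s\<^sub>1) powr (4 * s\<^sub>1 / 3) * (2 * pi\<^sup>2) powr (4 * s\<^sub>1 / 3))"
  define U where "U = (\<lambda>x. u\<^sub>p\<^sub>1 x - u\<^sub>p\<^sub>2 x)"
  define B where "B = M * l2 U + N * D"
  note sm = assms(2) and \<epsilon>m = assms(4) and fH = assms(9) and H_sq = assms(11) and Q_sq = assms(13,14)
    and u0 = assms(15) and ce = assms(17) and M = assms(19) and adm = assms(20,21) and \<rho> = assms(22,23)
  have fin: "finite (range s\<^sub>1\<^sub>m)" "finite (range \<epsilon>\<^sub>m)" by auto
  have s1_le: "s\<^sub>1 \<le> s\<^sub>1\<^sub>m m" "s\<^sub>1\<^sub>m m \<le> S\<^sub>1" "\<epsilon>\<^sub>m m \<le> \<epsilon>" for m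
    using assms(5,6,7) by (auto intro: Min_le Max_ge)
  have s1: "1/4 < s\<^sub>1" "S\<^sub>1 < 3/4"
  proof -
    have "s\<^sub>1 \<in> range s\<^sub>1\<^sub>m" "S\<^sub>1 \<in> range s\<^sub>1\<^sub>m" using assms(6,7) by (auto intro!: Min_in Max_in simp del: Max_in Min_in)
    then show "1/4 < s\<^sub>1" "S\<^sub>1 < 3/4" using sm by auto
  qed
  note u0_sq = H2_space_square_integrable[OF u0]
  \<comment> \<open>Strictness matters: as \<rho> may equal 1, the bound \<rho> / D is below 1 only
    for D > 1, and the final division by 1 - \<epsilon> \<sigma> depends on it.\<close>
  have D1: "1 < D"
  proof (rule ccontr)
    assume "\<not> 1 < D"
    then have "H2_norm u\<^sub>0 = 0" using u0_sq(3) by (simp add: D_def)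
    then have z: "l2 u\<^sub>0 = 0" using u0_sq(2) by (simp add: antisym)
    have "AE x in lebesgue. f m x = 0" for m
    proof (rule solves_linear_zero[OF _ _ assms(16)])
      show sq: "square_integrable (\<lambda>x. u\<^sub>0 x $ m)" using u0 by (simp add: H2_space_def sobolev_space_def)
      have "AE x in lebesgue. norm (u\<^sub>0 x $ m) \<le> norm (u\<^sub>0 x)" by (simp add: component_le_norm_cart)
      from square_integrable_bound(2)[OF u0_sq(1) _ this] z sq
      show "l2 (\<lambda>x. u\<^sub>0 x $ m) = 0" by (simp add: square_integrable_def antisym)
    qed
    then show False using assms(10) by blast
  qed
  have ce0: "0 < c\<^sub>e" using ce by (simp add: sobolev_embedding_constant_def)
  have r: "0 < r" using ce0 D1 by (simp add: r_def)
  \<comment> \<open>The radius c_e (|u_0| + 1) is the embedding bound for u_0 plus any perturbation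
    of norm at most 1, so both solutions take almost all their values in \<open>I\<close>.\<close>
  have I: "I = cball 0 r" unfolding assms(18) r_def D_def by (auto simp: algebra_simps)
  have up: "u\<^sub>p\<^sub>1 \<in> H2_space" "H2_norm u\<^sub>p\<^sub>1 \<le> 1" "u\<^sub>p\<^sub>2 \<in> H2_space" "H2_norm u\<^sub>p\<^sub>2 \<le> 1"
    using assms(26,27) \<rho> by (auto simp: tau_graph_def H2_ball_def)
  have u: "square_integrable (\<lambda>x. u\<^sub>0 x + v x)" "AE x in lebesgue. u\<^sub>0 x + v x \<in> cball 0 r"
      "l2 (\<lambda>x. u\<^sub>0 x + v x) \<le> D" if v: "v \<in> H2_space" "H2_norm v \<le> 1" for v
  proof -
    note v_sq = H2_space_square_integrable[OF v(1)]
    show "square_integrable (\<lambda>x. u\<^sub>0 x + v x)" by (rule square_integrable_add[OF u0_sq(1) v_sq(1)])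
    show "l2 (\<lambda>x. u\<^sub>0 x + v x) \<le> D"
      using square_integrable_add(2)[OF u0_sq(1) v_sq(1)] u0_sq(2) v_sq(2) v(2) by (simp add: D_def)
    show "AE x in lebesgue. u\<^sub>0 x + v x \<in> cball 0 r"
      using H2_space_bounded[OF ce u0] H2_space_bounded[OF ce v(1)]
    proof eventually_elim
      case (elim x)
      have "norm (u\<^sub>0 x + v x) \<le> c\<^sub>e * H2_norm u\<^sub>0 + c\<^sub>e * H2_norm v"
        using norm_triangle_ineq[of "u\<^sub>0 x" "v x"] elim by simp
      also have "\<dots> \<le> r" using v(2) ce0 by (simp add: r_def D_def distrib_left)
      finally show ?case by simp
    qed
  qed
  note u1 = u[OF up(1,2)] and u2 = u[OF up(3,4)]
  have g: "C2_on (cball 0 r) (\<lambda>z. g z $ m)" "g 0 $ m = 0"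
      "partial_deriv (cball 0 r) n (\<lambda>z. g z $ m) 0 = 0" "C2_norm_vec (cball 0 r) g \<le> M"
    if "admissible I M g" for g m n
    using that partial_deriv_0_of_GDERIV[OF r refl] by (auto simp: admissible_def I)
  note g1 = g[OF adm(1)] and g2 = g[OF adm(2)]
  have Mm: "C2_norm (cball 0 r) (\<lambda>z. g\<^sub>1 z $ m) \<le> M" for m
    using C2_norm_le_vec[OF r refl, of g\<^sub>1 m] g1 by force
  have Nm: "C2_norm (cball 0 r) (\<lambda>z. g\<^sub>1 z $ m - g\<^sub>2 z $ m) \<le> N" for m
    using C2_norm_le_vec[OF r refl, of "\<lambda>z. g\<^sub>1 z - g\<^sub>2 z" m] C2_on_diff[OF r refl g1(1) g2(1)]
    by (simp add: N_def I)
  have U_eq: "(\<lambda>x. (u\<^sub>0 x + u\<^sub>p\<^sub>1 x) - (u\<^sub>0 x + u\<^sub>p\<^sub>2 x)) = U" by (auto simp: U_def)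
  have dU: "l2 U \<le> H2_norm U"
  proof -
    have "U \<in> H2_space"
      using up(1,3) sobolev_space_diff unfolding H2_space_def U_def by auto
    then show ?thesis by (rule H2_space_square_integrable)
  qed
  have N0: "0 \<le> N" using C2_norm_nonneg[OF r refl C2_on_diff[OF r refl g1(1) g2(1)]] Nm order_trans by blast
  have B0: "0 \<le> B" using M N0 D1 by (simp add: B_def)
  have est: "(L2_norm (\<lambda>x. U x $ m))\<^sup>2 + (L2_norm (frac_laplacian 1 (\<lambda>x. U x $ m)))\<^sup>2
     \<le> \<epsilon>\<^sup>2 * B\<^sup>2 * ((L1_norm (H m))\<^sup>2 * K + D\<^sup>2 * (L2_norm (frac_laplacian (1 - s\<^sub>1\<^sub>m m) (H m)))\<^sup>2)" (is "_ \<le> ?R") for m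
  proof -
    let ?G\<^sub>1 = "\<lambda>y. g\<^sub>1 (u\<^sub>0 y + u\<^sub>p\<^sub>1 y) $ m" and ?G\<^sub>2 = "\<lambda>y. g\<^sub>2 (u\<^sub>0 y + u\<^sub>p\<^sub>2 y) $ m"
    note G1 = nonlinearity_integrable[OF r u1(1,2) g1(1-3), of m] and G2 = nonlinearity_integrable[OF r u2(1,2) g2(1-3), of m]
    note dif = nonlinearity_difference[OF r u1 u2 g1(1-3) g2(1-3) Mm Nm, of m, unfolded U_eq B_def[symmetric]]
    have "(L2_norm (\<lambda>x. U x $ m))\<^sup>2 + (L2_norm (frac_laplacian 1 (\<lambda>x. U x $ m)))\<^sup>2
      \<le> (\<epsilon>\<^sub>m m)\<^sup>2 * B\<^sup>2 * ((L1_norm (H m))\<^sup>2 * kappa (s\<^sub>1\<^sub>m m) D + D\<^sup>2 * (L2_norm (frac_laplacian (1 - s\<^sub>1\<^sub>m m) (H m)))\<^sup>2)"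
      unfolding U_def vector_minus_component
    proof (rule component_estimate)
      show "solves_linear (s\<^sub>1\<^sub>m m) (s\<^sub>2\<^sub>m m) (\<lambda>x. u\<^sub>p\<^sub>1 x $ m) (\<lambda>x. \<epsilon>\<^sub>m m * (LINT y|lebesgue. H m (x - y) * ?G\<^sub>1 y))"
        "solves_linear (s\<^sub>1\<^sub>m m) (s\<^sub>2\<^sub>m m) (\<lambda>x. u\<^sub>p\<^sub>2 x $ m) (\<lambda>x. \<epsilon>\<^sub>m m * (LINT y|lebesgue. H m (x - y) * ?G\<^sub>2 y))"
        using assms(26,27) by (auto simp: tau_graph_def)
      show "(\<lambda>x. u\<^sub>p\<^sub>1 x $ m) \<in> sobolev_space 1" "(\<lambda>x. u\<^sub>p\<^sub>2 x $ m) \<in> sobolev_space 1"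
        using up by (auto simp: H2_space_def)
    qed (use fH sm \<epsilon>m D1 G1 G2 dif in auto)
    \<comment> \<open>The component's own coefficient and exponent are traded for \<epsilon> and
      \<open>K\<close>, which do not depend on m and can be taken out of the sum.\<close>
    also have "\<dots> \<le> ?R"
    proof (intro mult_mono add_mono power_mono order_refl)
      show "kappa (s\<^sub>1\<^sub>m m) D \<le> K"
        unfolding K_def by (rule kappa_mono) (use s1 s1_le[of m] D1 in auto)
      have "0 \<le> kappa (s\<^sub>1\<^sub>m m) D"
        unfolding kappa_def using sm[of m] by auto
      then show "0 \<le> (L1_norm (H m))\<^sup>2 * kappa (s\<^sub>1\<^sub>m m) D + D\<^sup>2 * (L2_norm (frac_laplacian (1 - s\<^sub>1\<^sub>m m) (H m)))\<^sup>2"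
        "0 \<le> kappa (s\<^sub>1\<^sub>m m) D" by auto
    qed (use s1_le \<epsilon>m B0 D1 in \<open>auto simp: L1_norm_def L2_norm_def\<close>)
    finally show ?thesis .
  qed
  \<comment> \<open>The bracket common to \<sigma> and to the smallness condition. Extracting D^2
    from \<open>K\<close> lowers the power of D to 8 S_1 / 3 - 2, and H_sq K + D^2 Q_sq becomes D^2
    E = (\<sigma> / M)^2.\<close>
  define E where "E = H_sq * K / D\<^sup>2 + Q_sq"
  have K0: "0 \<le> K" unfolding K_def using s1 by auto
  have E0: "0 < E" unfolding E_def using assms(12,14) K0 by (simp add: add_nonneg_pos)
  have KD: "K / D\<^sup>2 = D powr (8 * S\<^sub>1 / 3 - 2) * (1 / (4 * s\<^sub>1) powr (4 * s\<^sub>1 / 3)) * (3 / ((3 - 4 * S\<^sub>1) * (2 * pi\<^sup>2) powr (4 * s\<^sub>1 / 3)))"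
  proof -
    have "D powr (8 * S\<^sub>1 / 3 - 2) = D powr (8 * S\<^sub>1 / 3) / D\<^sup>2" using D1 by (simp add: powr_diff)
    then show ?thesis by (simp add: K_def mult_ac)
  qed
  have \<sigma>: "\<sigma> = M * D * sqrt E"
  proof -
    have "E = 3 * H_sq * D powr (8 * S\<^sub>1 / 3 - 2) / ((3 - 4 * S\<^sub>1) * (2 * pi\<^sup>2) powr (4 * s\<^sub>1 / 3))
              * (1 / (4 * s\<^sub>1) powr (4 * s\<^sub>1 / 3)) + Q_sq"
      unfolding E_def times_divide_eq_right[symmetric] KD by (simp add: mult_ac)
    then show ?thesis using assms(30) E0 by (simp add: D_def[symmetric] powr_half_sqrt)
  qed
  \<comment> \<open>The smallness condition reads \<epsilon> M D^2 sqrt(E) \<le> \<rho>, and its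
    left side is \<epsilon> \<sigma> D.\<close>
  have "\<epsilon> * \<sigma> \<le> \<rho> / D"
  proof -
    have "E = H_sq * D powr (8 * S\<^sub>1 / 3 - 2) * (1 / (4 * s\<^sub>1) powr (4 * s\<^sub>1 / 3))
              * (3 / ((3 - 4 * S\<^sub>1) * (2 * pi\<^sup>2) powr (4 * s\<^sub>1 / 3))) + Q_sq"
      unfolding E_def times_divide_eq_right[symmetric] KD by (simp add: mult_ac)
    then have "\<epsilon> \<le> \<rho> / (M * D\<^sup>2) * E powr (- (1/2))"
      using assms(25) by (simp add: D_def)
    also have "E powr (- (1/2)) = 1 / sqrt E" using E0 by (simp add: powr_minus_divide powr_half_sqrt)
    finally have "\<epsilon> * \<sigma> \<le> \<rho> / (M * D\<^sup>2) * (1 / sqrt E) * \<sigma>"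
      using M D1 E0 by (intro mult_right_mono) (auto simp: \<sigma>)
    also have "\<dots> = \<rho> / D" unfolding \<sigma> using M D1 E0 by (simp add: power2_eq_square)
    finally show ?thesis .
  qed
  also have "\<rho> / D < 1" using \<rho> D1 by simp
  finally have \<epsilon>\<sigma>: "\<epsilon> * \<sigma> < 1" .
  have "(H2_norm U)\<^sup>2 = (\<Sum>m\<in>UNIV. (L2_norm (\<lambda>x. U x $ m))\<^sup>2 + (L2_norm (frac_laplacian 1 (\<lambda>x. U x $ m)))\<^sup>2)"
    unfolding H2_norm_def by (intro real_sqrt_pow2 sum_nonneg) simp
  also have "\<dots> \<le> (\<Sum>m\<in>UNIV. \<epsilon>\<^sup>2 * B\<^sup>2 * ((L1_norm (H m))\<^sup>2 * K + D\<^sup>2 * (L2_norm (frac_laplacian (1 - s\<^sub>1\<^sub>m m) (H m)))\<^sup>2))"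
    by (intro sum_mono est)
  also have "\<dots> = \<epsilon>\<^sup>2 * B\<^sup>2 * (H_sq * K + D\<^sup>2 * Q_sq)"
    by (simp only: H_sq Q_sq(1) sum.distrib sum_distrib_left[symmetric] sum_distrib_right[symmetric])
  also have "\<dots> = (\<epsilon> * \<sigma> / M * B)\<^sup>2"
    unfolding \<sigma> using M D1 E0 by (simp add: power_mult_distrib E_def distrib_left distrib_right mult_ac)
  finally have "H2_norm U \<le> \<epsilon> * \<sigma> / M * B"
    by (rule power2_le_imp_le) (use assms(24) M D1 E0 B0 \<sigma> in auto)
  \<comment> \<open>\<open>B\<close> contains the unknown difference through its L^2 norm; passing
    to the full norm makes this term \<epsilon> \<sigma> times the left side, which is absorbed
    since \<epsilon> \<sigma> < 1.\<close>
  also have "\<dots> \<le> \<epsilon> * \<sigma> / M * (M * H2_norm U + N * D)"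
    unfolding B_def using dU assms(24) M D1 E0 N0 by (intro mult_left_mono add_mono) (auto simp: \<sigma>)
  also have "\<dots> = \<epsilon> * \<sigma> * H2_norm U + \<epsilon> * \<sigma> / M * (N * D)"
    using M by (simp add: distrib_left)
  finally have "(1 - \<epsilon> * \<sigma>) * H2_norm U \<le> \<epsilon> * \<sigma> / M * (N * D)" by (simp add: left_diff_distrib)
  then have "H2_norm U \<le> \<epsilon> * \<sigma> / M * (N * D) / (1 - \<epsilon> * \<sigma>)"
    by (subst pos_le_divide_eq) (use \<epsilon>\<sigma> in \<open>simp_all only: mult.commute[of "H2_norm U"] diff_gt_0_iff_gt\<close>)
  also have "\<dots> = \<epsilon> * \<sigma> / (M * (1 - \<epsilon> * \<sigma>)) * D * N" by simp
  finally show ?thesis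
    unfolding assms(28,29) U_eq N_def D_def .
qed

end
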